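(* Let $P_1,P_2$ be non-commutative Poisson algebras over $K$ of the same class (both of Class 1 or both of Class 2), with degree maps $u_i:P_i\to\mathbb Z_{\ge0}\cup\{-\infty\}$ ($i=1,2$) whose induced filtrations are finite and discrete. Let $z_1\in P_1$, $z_2\in P_2$ and $\Gamma=z_1\otimes1+1\otimes z_2\in P_1\otimes P_2$. If $F(z_1)=D(z_1)$ and $F(z_2)=D(z_2)$, then $$F(\Gamma)=D(\Gamma)=D(z_1)\otimes D(z_2),\qquad N(\Gamma)=C(\Gamma).$$ Furthermore, if $C(z_1)\subsetneq D(z_1)$ or $C(z_2)\subsetneq D(z_2)$, then $$N(\Gamma)=C(\Gamma)\subsetneq D(\Gamma)=F(\Gamma),$$ and in this case $\Gamma\in\Omega_2(P_1\otimes P_2)\cup\Omega_2'(P_1\otimes P_2)$, i.e. $\Gamma$ is semisimple.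
   Context: $K$ is an algebraically closed field of characteristic zero; tensor products are over $K$. A non-commutative Poisson algebra over $K$ is a $K$-vector space $P$ with a bilinear product $\cdot$ making it a unital associative (not necessarily commutative) $K$-algebra and a bilinear bracket $\{\cdot,\cdot\}$ making it a Lie algebra, such that $\{x,yz\}=\{x,y\}z+y\{x,z\}$ for all $x,y,z\in P$. It is of Class 1 if $(P,\cdot)$ is commutative, and of Class 2 if $(P,\cdot)$ is non-commutative and $\{a,b\}=ab-ba$ for all $a,b$. Tensor product: if $P_1,P_2$ are both of Class 1, $P_1\otimes P_2$ carries the bracket $\{a_1\otimes a_2,b_1\otimes b_2\}=\{a_1,b_1\}\otimes a_2b_2+b_1a_1\otimes\{a_2,b_2\}$; if both are of Class 2, the bracket on $P_1\otimes P_2$ is the commutator. This makes $P_1\otimes P_2$ a non-commutative Poisson algebra of the same class. A degree map on $P$ is a map $u:P\to\mathbb Z\cup\{-\infty\}$ such that for all $z,w\in P$: $u(\{z,w\})\le u(zw)=u(z)+u(w)$; $u(z+w)\le\max\{u(z),u(w)\}$; $u(z)=-\infty$ iff $z=0$. Its induced filtration is $P_t=\{a\in P\mid u(a)\le t\}$, $t\in\mathbb Z$; it is finite if every $P_t$ is finite dimensional over $K$ and discrete if $P_t=\{0\}$ for all $t<0$. For an element $z$ of a non-commutative Poisson algebra $P$ put $ad_z(w)=\{z,w\}$ and $Ev(z)=\{\lambda\in K\mid \exists x\in P\setminus\{0\},\ ad_z(x)=\lambda x\}$, $F(z)=\{x\in P\mid \dim_K K[ad_z](x)<\infty\}$, $N(z)=\{x\in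 P\mid \exists m,\ ad_z^m(x)=0\}$, $C(z)=\{x\in P\mid ad_z(x)=0\}$, $D(z)=\bigoplus_{\lambda\in Ev(z)}\{x\in P\mid ad_z(x)=\lambda x\}$. For $z_i$ these are formed in $P_i$; for $\Gamma$ in $P_1\otimes P_2$. For $z$ with $Ev(z)\supsetneq\{0\}$: $z\in\Omega_2(P)$ if $D(z)=F(z)=P$; $z\in\Omega_2'(P)$ if $D(z)=F(z)\subsetneq P$. Elements of $\Omega_2(P)\cup\Omega_2'(P)$ are called semisimple. *)

theory Defs
  imports
    "HOL-Algebra.Algebraic_Closure"
    "HOL-Library.Extended"
    "Jordan_Normal_Form.Missing_VectorSpace"
begin

record ('k, 'a) poisson = "('k, 'a) module" +
  bracket :: "'a \<Rightarrow> 'a \<Rightarrow> 'a"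

text \<open>Convention: unital algebras satisfy \<open>1 \<noteq> 0\<close>. In particular \<open>0\<close> is always an eigenvalue
  of \<open>{z, \<cdot>}\<close>, with eigenvector \<open>1\<close>.\<close>

locale nc_poisson_algebra = vectorspace K P + P_ring: ring P
  for K :: "('k, 'm) ring_scheme" and P :: "('k, 'a, 'n) poisson_scheme" (structure) +
  assumes one_not_zero: "\<one> \<noteq> \<zero>"
    and mult_smult_left: "\<lbrakk>c \<in> carrier K; x \<in> carrier P; y \<in> carrier P\<rbrakk> \<Longrightarrow>
          (c \<odot> x) \<otimes> y = c \<odot> (x \<otimes> y)"
    and mult_smult_right: "\<lbrakk>c \<in> carrier K; x \<in> carrier P; y \<in> carrier P\<rbrakk> \<Longrightarrow>
          x \<otimes> (c \<odot> y) = c \<odot> (x \<otimes> y)"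
    and bracket_closed: "\<lbrakk>x \<in> carrier P; y \<in> carrier P\<rbrakk> \<Longrightarrow> bracket P x y \<in> carrier P"
    and bracket_add_left: "\<lbrakk>x \<in> carrier P; y \<in> carrier P; z \<in> carrier P\<rbrakk> \<Longrightarrow>
          bracket P (x \<oplus> y) z = bracket P x z \<oplus> bracket P y z"
    and bracket_add_right: "\<lbrakk>x \<in> carrier P; y \<in> carrier P; z \<in> carrier P\<rbrakk> \<Longrightarrow>
          bracket P x (y \<oplus> z) = bracket P x y \<oplus> bracket P x z"
    and bracket_smult_left: "\<lbrakk>c \<in> carrier K; x \<in> carrier P; y \<in> carrier P\<rbrakk> \<Longrightarrow>
          bracket P (c \<odot> x) y = c \<odot> bracket P x y"
    and bracket_smult_right: "\<lbrakk>c \<in> carrier K; x \<in> carrier P; y \<in> carrier P\<rbrakk> \<Longrightarrow>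
          bracket P x (c \<odot> y) = c \<odot> bracket P x y"
    and bracket_self: "x \<in> carrier P \<Longrightarrow> bracket P x x = \<zero>"
    and jacobi: "\<lbrakk>x \<in> carrier P; y \<in> carrier P; z \<in> carrier P\<rbrakk> \<Longrightarrow>
          bracket P x (bracket P y z) \<oplus> bracket P y (bracket P z x)
            \<oplus> bracket P z (bracket P x y) = \<zero>"
    and leibniz: "\<lbrakk>x \<in> carrier P; y \<in> carrier P; z \<in> carrier P\<rbrakk> \<Longrightarrow>
          bracket P x (y \<otimes> z) = bracket P x y \<otimes> z \<oplus> y \<otimes> bracket P x z"

definition class1 :: "('k, 'a, 'n) poisson_scheme \<Rightarrow> bool" where
  "class1 P \<longleftrightarrow> (\<forall>x\<in>carrier P. \<forall>y\<in>carrier P. x \<otimes>\<^bsub>P\<^esub> y = y \<otimes>\<^bsub>P\<^esub> x)"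

definition class2 :: "('k, 'a, 'n) poisson_scheme \<Rightarrow> bool" where
  "class2 P \<longleftrightarrow> \<not> (\<forall>x\<in>carrier P. \<forall>y\<in>carrier P. x \<otimes>\<^bsub>P\<^esub> y = y \<otimes>\<^bsub>P\<^esub> x) \<and>
     (\<forall>x\<in>carrier P. \<forall>y\<in>carrier P. bracket P x y = x \<otimes>\<^bsub>P\<^esub> y \<ominus>\<^bsub>P\<^esub> y \<otimes>\<^bsub>P\<^esub> x)"

text \<open>The set \<open>\<int> \<union> {-\<infinity>}\<close> is \<^typ>\<open>int extended\<close> without its element \<open>\<infinity>\<close>.\<close>

definition degree_map :: "('k, 'a, 'n) poisson_scheme \<Rightarrow> ('a \<Rightarrow> int extended) \<Rightarrow> bool" where
  "degree_map P u \<longleftrightarrow>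
     u \<in> carrier P \<rightarrow> range Fin \<union> {-\<infinity>} \<and>
     (\<forall>z\<in>carrier P. \<forall>w\<in>carrier P.
        u (bracket P z w) \<le> u (z \<otimes>\<^bsub>P\<^esub> w) \<and>
        u (z \<otimes>\<^bsub>P\<^esub> w) = u z + u w \<and>
        u (z \<oplus>\<^bsub>P\<^esub> w) \<le> max (u z) (u w)) \<and>
     (\<forall>z\<in>carrier P. u z = -\<infinity> \<longleftrightarrow> z = \<zero>\<^bsub>P\<^esub>)"

definition filtration :: "('k, 'a, 'n) poisson_scheme \<Rightarrow> ('a \<Rightarrow> int extended) \<Rightarrow> int \<Rightarrow> 'a set" where
  "filtration P u t = {a \<in> carrier P. u a \<le> Fin t}"

definition finite_filtration ::
    "('k, 'm) ring_scheme \<Rightarrow> ('k, 'a, 'n) poisson_scheme \<Rightarrow> ('a \<Rightarrow> int extended) \<Rightarrow> bool" where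
  "finite_filtration K P u \<longleftrightarrow>
     (\<forall>t. vectorspace.fin_dim K (P\<lparr>carrier := filtration P u t\<rparr>))"

definition discrete_filtration ::
    "('k, 'a, 'n) poisson_scheme \<Rightarrow> ('a \<Rightarrow> int extended) \<Rightarrow> bool" where
  "discrete_filtration P u \<longleftrightarrow> (\<forall>t<0. filtration P u t = {\<zero>\<^bsub>P\<^esub>})"

abbreviation ad :: "('k, 'a, 'n) poisson_scheme \<Rightarrow> 'a \<Rightarrow> 'a \<Rightarrow> 'a" where
  "ad P z \<equiv> bracket P z"

definition ad_eigenspace :: "('k, 'a, 'n) poisson_scheme \<Rightarrow> 'a \<Rightarrow> 'k \<Rightarrow> 'a set" where
  "ad_eigenspace P z c = {x \<in> carrier P. ad P z x = c \<odot>\<^bsub>P\<^esub> x}"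

definition ad_Ev :: "('k, 'm) ring_scheme \<Rightarrow> ('k, 'a, 'n) poisson_scheme \<Rightarrow> 'a \<Rightarrow> 'k set" where
  "ad_Ev K P z = {c \<in> carrier K. \<exists>x\<in>carrier P - {\<zero>\<^bsub>P\<^esub>}. ad P z x = c \<odot>\<^bsub>P\<^esub> x}"

text \<open>\<open>K[ad z](x)\<close> is the linear span of the orbit of \<open>x\<close> under \<open>ad z\<close>.\<close>

definition ad_F :: "('k, 'm) ring_scheme \<Rightarrow> ('k, 'a, 'n) poisson_scheme \<Rightarrow> 'a \<Rightarrow> 'a set" where
  "ad_F K P z = {x \<in> carrier P. vectorspace.fin_dim K
     (P\<lparr>carrier := module.span K P (range (\<lambda>n. (ad P z ^^ n) x))\<rparr>)}"

definition ad_N :: "('k, 'a, 'n) poisson_scheme \<Rightarrow> 'a \<Rightarrow> 'a set" where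
  "ad_N P z = {x \<in> carrier P. \<exists>m. (ad P z ^^ m) x = \<zero>\<^bsub>P\<^esub>}"

definition ad_C :: "('k, 'a, 'n) poisson_scheme \<Rightarrow> 'a \<Rightarrow> 'a set" where
  "ad_C P z = {x \<in> carrier P. ad P z x = \<zero>\<^bsub>P\<^esub>}"

text \<open>The internal sum of the eigenspaces; it is automatically direct, since eigenvectors for
  distinct eigenvalues are linearly independent.\<close>

definition ad_D :: "('k, 'm) ring_scheme \<Rightarrow> ('k, 'a, 'n) poisson_scheme \<Rightarrow> 'a \<Rightarrow> 'a set" where
  "ad_D K P z = {(\<Oplus>\<^bsub>P\<^esub>c\<in>L. v c) | L v.
     finite L \<and> L \<subseteq> ad_Ev K P z \<and> (\<forall>c\<in>L. v c \<in> ad_eigenspace P z c)}"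

definition Omega2 :: "('k, 'm) ring_scheme \<Rightarrow> ('k, 'a, 'n) poisson_scheme \<Rightarrow> 'a set" where
  "Omega2 K P = {z \<in> carrier P. {\<zero>\<^bsub>K\<^esub>} \<subset> ad_Ev K P z \<and>
     ad_D K P z = ad_F K P z \<and> ad_F K P z = carrier P}"

definition Omega2' :: "('k, 'm) ring_scheme \<Rightarrow> ('k, 'a, 'n) poisson_scheme \<Rightarrow> 'a set" where
  "Omega2' K P = {z \<in> carrier P. {\<zero>\<^bsub>K\<^esub>} \<subset> ad_Ev K P z \<and>
     ad_D K P z = ad_F K P z \<and> ad_F K P z \<subset> carrier P}"

text \<open>The vector space with basis \<open>I\<close>: functions on \<open>I\<close> with finite support
  (and value \<^const>\<open>undefined\<close> outside \<open>I\<close>).\<close>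

definition free_space :: "('k, 'm) ring_scheme \<Rightarrow> 'c set \<Rightarrow> ('k, 'c \<Rightarrow> 'k) module" where
  "free_space K I = (ring.func_space K I)
     \<lparr>carrier := {f \<in> I \<rightarrow>\<^sub>E carrier K. finite {x \<in> I. f x \<noteq> \<zero>\<^bsub>K\<^esub>}}\<rparr>"

definition free_gen :: "('k, 'm) ring_scheme \<Rightarrow> 'c set \<Rightarrow> 'c \<Rightarrow> 'c \<Rightarrow> 'k" where
  "free_gen K I x = (\<lambda>y\<in>I. if y = x then \<one>\<^bsub>K\<^esub> else \<zero>\<^bsub>K\<^esub>)"

definition bilinear_ext ::
    "('k, 'm) ring_scheme \<Rightarrow> 'c set \<Rightarrow> ('c \<Rightarrow> 'c \<Rightarrow> 'c \<Rightarrow> 'k) \<Rightarrow> ('c \<Rightarrow> 'k) \<Rightarrow> ('c \<Rightarrow> 'k) \<Rightarrow> 'c \<Rightarrow> 'k" where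
  "bilinear_ext K I \<phi> f g =
     (\<Oplus>\<^bsub>free_space K I\<^esub>x\<in>{x \<in> I. f x \<noteq> \<zero>\<^bsub>K\<^esub>}. \<Oplus>\<^bsub>free_space K I\<^esub>y\<in>{y \<in> I. g y \<noteq> \<zero>\<^bsub>K\<^esub>}.
        (f x \<otimes>\<^bsub>K\<^esub> g y) \<odot>\<^bsub>free_space K I\<^esub> \<phi> x y)"

context
  fixes K :: "('k, 'm) ring_scheme"
    and A :: "('k, 'a, 'n) poisson_scheme" and B :: "('k, 'b, 'l) poisson_scheme"
begin

definition tensor_free :: "('k, 'a \<times> 'b \<Rightarrow> 'k) module" where
  "tensor_free = free_space K (carrier A \<times> carrier B)"

definition tensor_gen :: "'a \<Rightarrow> 'b \<Rightarrow> 'a \<times> 'b \<Rightarrow> 'k" where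
  "tensor_gen a b = free_gen K (carrier A \<times> carrier B) (a, b)"

definition tensor_relations :: "('a \<times> 'b \<Rightarrow> 'k) set" where
  "tensor_relations = module.span K tensor_free
     ({tensor_gen (a \<oplus>\<^bsub>A\<^esub> a') b \<ominus>\<^bsub>tensor_free\<^esub> (tensor_gen a b \<oplus>\<^bsub>tensor_free\<^esub> tensor_gen a' b)
        | a a' b. a \<in> carrier A \<and> a' \<in> carrier A \<and> b \<in> carrier B} \<union>
      {tensor_gen a (b \<oplus>\<^bsub>B\<^esub> b') \<ominus>\<^bsub>tensor_free\<^esub> (tensor_gen a b \<oplus>\<^bsub>tensor_free\<^esub> tensor_gen a b')
        | a b b'. a \<in> carrier A \<and> b \<in> carrier B \<and> b' \<in> carrier B} \<union>
      {tensor_gen (c \<odot>\<^bsub>A\<^esub> a) b \<ominus>\<^bsub>tensor_free\<^esub> c \<odot>\<^bsub>tensor_free\<^esub> tensor_gen a b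
        | c a b. c \<in> carrier K \<and> a \<in> carrier A \<and> b \<in> carrier B} \<union>
      {tensor_gen a (c \<odot>\<^bsub>B\<^esub> b) \<ominus>\<^bsub>tensor_free\<^esub> c \<odot>\<^bsub>tensor_free\<^esub> tensor_gen a b
        | c a b. c \<in> carrier K \<and> a \<in> carrier A \<and> b \<in> carrier B})"

definition tensor_class :: "('a \<times> 'b \<Rightarrow> 'k) \<Rightarrow> ('a \<times> 'b \<Rightarrow> 'k) set" where
  "tensor_class f = tensor_relations +>\<^bsub>tensor_free\<^esub> f"

definition pure_tensor :: "'a \<Rightarrow> 'b \<Rightarrow> ('a \<times> 'b \<Rightarrow> 'k) set" where
  "pure_tensor a b = tensor_class (tensor_gen a b)"

text \<open>Operation induced on cosets by the bilinear extension of \<open>\<phi>\<close>. The union is a single coset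
  when that extension respects the relations.\<close>

definition tensor_lift ::
    "('a \<times> 'b \<Rightarrow> 'a \<times> 'b \<Rightarrow> 'a \<times> 'b \<Rightarrow> 'k) \<Rightarrow>
     ('a \<times> 'b \<Rightarrow> 'k) set \<Rightarrow> ('a \<times> 'b \<Rightarrow> 'k) set \<Rightarrow> ('a \<times> 'b \<Rightarrow> 'k) set" where
  "tensor_lift \<phi> S T =
     (\<Union>f\<in>S. \<Union>g\<in>T. tensor_class (bilinear_ext K (carrier A \<times> carrier B) \<phi> f g))"

definition tensor_algebra :: "('k, ('a \<times> 'b \<Rightarrow> 'k) set) module" where
  "tensor_algebra =
     \<lparr>carrier = a_rcosets\<^bsub>tensor_free\<^esub> tensor_relations,
      monoid.mult = tensor_lift (\<lambda>(a1, a2) (b1, b2). tensor_gen (a1 \<otimes>\<^bsub>A\<^esub> b1) (a2 \<otimes>\<^bsub>B\<^esub> b2)),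
      one = pure_tensor \<one>\<^bsub>A\<^esub> \<one>\<^bsub>B\<^esub>,
      zero = tensor_relations,
      add = (\<lambda>S T. S <+>\<^bsub>tensor_free\<^esub> T),
      smult = (\<lambda>c S. \<Union>f\<in>S. tensor_class (c \<odot>\<^bsub>tensor_free\<^esub> f))\<rparr>"

definition tensor_bracket ::
    "('a \<times> 'b \<Rightarrow> 'k) set \<Rightarrow> ('a \<times> 'b \<Rightarrow> 'k) set \<Rightarrow> ('a \<times> 'b \<Rightarrow> 'k) set" where
  "tensor_bracket S T =
     (if class1 A \<and> class1 B
      then tensor_lift (\<lambda>(a1, a2) (b1, b2).
             tensor_gen (bracket A a1 b1) (a2 \<otimes>\<^bsub>B\<^esub> b2) \<oplus>\<^bsub>tensor_free\<^esub>
             tensor_gen (b1 \<otimes>\<^bsub>A\<^esub> a1) (bracket B a2 b2)) S T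
      else S \<otimes>\<^bsub>tensor_algebra\<^esub> T \<ominus>\<^bsub>tensor_algebra\<^esub> T \<otimes>\<^bsub>tensor_algebra\<^esub> S)"

text \<open>Only meaningful when \<open>A\<close> and \<open>B\<close> are both of Class 1 or both of Class 2.\<close>

definition tensor_poisson :: "('k, ('a \<times> 'b \<Rightarrow> 'k) set) poisson" where
  "tensor_poisson = module.extend tensor_algebra (poisson.fields tensor_bracket)"

text \<open>For subspaces \<open>U\<close>, \<open>W\<close> of vector spaces \<open>A\<close>, \<open>B\<close> over a field, the canonical map from
  the tensor product of \<open>U\<close> and \<open>W\<close> is injective; the tensor product is identified with its
  image.\<close>

definition tensor_subspace :: "'a set \<Rightarrow> 'b set \<Rightarrow> ('a \<times> 'b \<Rightarrow> 'k) set set" where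
  "tensor_subspace U W = module.span K tensor_poisson {pure_tensor x y | x y. x \<in> U \<and> y \<in> W}"

end

end

theory Submission
  imports Defs
begin

text \<open>Write \<open>d\<^sub>i\<close> for \<open>ad z\<^sub>i\<close> and \<open>d\<close> for \<open>ad \<Gamma>\<close>. In both classes \<open>d\<close> acts on the tensor product as
  \<open>d\<^sub>1 \<otimes> 1 + 1 \<otimes> d\<^sub>2\<close>. A linear functional \<open>\<phi>\<close> on the second factor gives a contraction
  \<open>L\<^sub>\<phi> (a \<otimes> b) = \<phi> b \<cdot> a\<close> onto the first one, and
  \<open>d\<^sub>1 (L\<^sub>\<phi> u) = L\<^sub>\<phi> (d u) - L\<^sub>\<psi> u\<close> with \<open>\<psi> = \<phi> \<circ> d\<^sub>2\<close>. If the orbit of \<open>u\<close> lies in a finite-dimensional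
  space, then all first tensor factors occurring in it lie in one finite-dimensional space, which
  by this identity contains the \<open>d\<^sub>1\<close>-orbit of every \<open>L\<^sub>\<phi> u\<close>; so \<open>L\<^sub>\<phi> u\<close> lies in \<open>F(z\<^sub>1) = D(z\<^sub>1)\<close>. As
  functionals separate points, and by symmetry, \<open>F(\<Gamma>) \<subseteq> D(z\<^sub>1) \<otimes> D(z\<^sub>2)\<close>. Tensor products of
  eigenvectors are eigenvectors, whence \<open>D(z\<^sub>1) \<otimes> D(z\<^sub>2) \<subseteq> D(\<Gamma>) \<subseteq> F(\<Gamma>)\<close>. Finally \<open>N(\<Gamma>) \<subseteq> F(\<Gamma>) = D(\<Gamma>)\<close>,
  and a diagonalisable nilpotent vector is annihilated.\<close>

section \<open>Subspaces and linear maps\<close>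

text \<open>That functionals separate points does not by itself place a tensor in a product N
  \<otimes> N'. The bridge is an induction on a finite set of opposite factors: if all contractions
  of u onto the first factor lie in N, the left factors can be chosen in N while the right ones are
  kept. The functionals needed come from Zorn's lemma, applied to subspaces avoiding a vector, so no
  bases of the factors are chosen. Each application of \<open>d\<^sub>1\<close> trades \<phi> for
  its composite with \<open>d\<^sub>2\<close>; the orbit estimate therefore has to be proved for all
  functionals at once, and it is uniform because the finite set of left factors does not depend on
  the functional. The other obstacle is the concrete model: elements of the tensor product are
  cosets of finitely supported functions, and product and bracket are unions over representatives.
  That such a union is a single coset is obtained by rewriting a double sum as an iterated linear
  extension and exchanging one representative at a time.\<close>

lemma (in vectorspace) subspaceI:
  assumes "N \<subseteq> carrier V" "\<zero>\<^bsub>V\<^esub> \<in> N"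
    and "\<And>x y. \<lbrakk>x \<in> N; y \<in> N\<rbrakk> \<Longrightarrow> x \<oplus>\<^bsub>V\<^esub> y \<in> N"
    and "\<And>c x. \<lbrakk>c \<in> carrier K; x \<in> N\<rbrakk> \<Longrightarrow> c \<odot>\<^bsub>V\<^esub> x \<in> N"
  shows "subspace K N V"
  unfolding subspace_def LinearCombinations.submodule_def
  using assms vectorspace_axioms module_axioms by blast

lemma subspaceD:
  assumes "subspace K N V"
  shows "x \<in> N \<Longrightarrow> x \<in> carrier V" "\<zero>\<^bsub>V\<^esub> \<in> N"
    and "\<lbrakk>x \<in> N; y \<in> N\<rbrakk> \<Longrightarrow> x \<oplus>\<^bsub>V\<^esub> y \<in> N"
    and "\<lbrakk>c \<in> carrier K; x \<in> N\<rbrakk> \<Longrightarrow> c \<odot>\<^bsub>V\<^esub> x \<in> N"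
  using assms unfolding subspace_def LinearCombinations.submodule_def by blast+

lemma (in vectorspace) span_subset_subspace:
  "\<lbrakk>S \<subseteq> N; subspace K N V\<rbrakk> \<Longrightarrow> span S \<subseteq> N"
  by (simp add: span_is_subset)

lemma (in vectorspace) subspace_minus:
  assumes "subspace K N V" "x \<in> N" "y \<in> N"
  shows "x \<ominus>\<^bsub>V\<^esub> y \<in> N"
proof -
  have "\<ominus>\<^bsub>V\<^esub> y = (\<ominus>\<^bsub>K\<^esub> \<one>\<^bsub>K\<^esub>) \<odot>\<^bsub>V\<^esub> y"
    using assms subspaceD(1) by (metis smult_minus_1)
  then have "\<ominus>\<^bsub>V\<^esub> y \<in> N"
    using assms subspaceD(4) by (metis R.add.inv_closed R.one_closed)
  then show ?thesis
    using assms subspaceD(3) by (metis a_minus_def)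
qed

lemma (in vectorspace) finsum_mem_subspace:
  assumes "subspace K N V" "f \<in> I \<rightarrow> N"
  shows "(\<Oplus>\<^bsub>V\<^esub>i\<in>I. f i) \<in> N"
  using assms(2)
proof (induction I rule: infinite_finite_induct)
  case (insert i I)
  then have "f \<in> I \<rightarrow> carrier V" "f i \<in> carrier V"
    using subspaceD(1)[OF assms(1)] by auto
  then show ?case
    using insert subspaceD(3)[OF assms(1)] by simp
qed (use subspaceD(2)[OF assms(1)] in auto)

lemma module_homI:
  assumes "\<And>x. x \<in> carrier V \<Longrightarrow> f x \<in> carrier W"
    and "\<And>x y. \<lbrakk>x \<in> carrier V; y \<in> carrier V\<rbrakk> \<Longrightarrow> f (x \<oplus>\<^bsub>V\<^esub> y) = f x \<oplus>\<^bsub>W\<^esub> f y"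
    and "\<And>c x. \<lbrakk>c \<in> carrier K; x \<in> carrier V\<rbrakk> \<Longrightarrow> f (c \<odot>\<^bsub>V\<^esub> x) = c \<odot>\<^bsub>W\<^esub> f x"
  shows "f \<in> module_hom K V W"
  using assms unfolding module_hom_def by blast

lemma module_hom_mem: "\<lbrakk>f \<in> module_hom K V W; x \<in> carrier V\<rbrakk> \<Longrightarrow> f x \<in> carrier W"
  unfolding module_hom_def by blast

lemma module_hom_zero:
  assumes "f \<in> module_hom K V W" "module K V" "module K W"
  shows "f \<zero>\<^bsub>V\<^esub> = \<zero>\<^bsub>W\<^esub>"
proof -
  interpret mod_hom K V W f
    using assms by (simp add: mod_hom_axioms_def mod_hom_def)
  show ?thesis by simp
qed

lemma module_hom_compose:
  "\<lbrakk>f \<in> module_hom K U V; g \<in> module_hom K V W\<rbrakk> \<Longrightarrow> (\<lambda>x. g (f x)) \<in> module_hom K U W"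
  by (rule module_homI)
    (simp_all add: module_hom_mem module_hom_smult LinearCombinations.module_hom_add)

lemma (in module) module_hom_add:
  assumes "f \<in> module_hom R W M" "g \<in> module_hom R W M" "module R W"
  shows "(\<lambda>x. f x \<oplus>\<^bsub>M\<^esub> g x) \<in> module_hom R W M"
proof -
  interpret W: module R W by fact
  note mem = module_hom_mem[OF assms(1)] module_hom_mem[OF assms(2)]
  note add = LinearCombinations.module_hom_add[OF assms(1)] LinearCombinations.module_hom_add[OF assms(2)]
  note smult = module_hom_smult[OF assms(1)] module_hom_smult[OF assms(2)]
  show ?thesis
    by (rule module_homI) (auto simp: mem add smult smult_r_distr M.add.m_ac)
qed

lemma (in module) module_hom_minus:
  assumes "f \<in> module_hom R W M" "g \<in> module_hom R W M" "module R W"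
  shows "(\<lambda>x. f x \<ominus>\<^bsub>M\<^esub> g x) \<in> module_hom R W M"
proof -
  interpret W: module R W by fact
  note mem = module_hom_mem[OF assms(1)] module_hom_mem[OF assms(2)]
  note add = LinearCombinations.module_hom_add[OF assms(1)] LinearCombinations.module_hom_add[OF assms(2)]
  note smult = module_hom_smult[OF assms(1)] module_hom_smult[OF assms(2)]
  show ?thesis
    by (rule module_homI)
      (auto simp: mem add smult smult_r_distr smult_r_minus M.add.m_ac a_minus_def M.minus_add)
qed

lemma (in vectorspace) module_hom_eq_on_span:
  assumes "module K W" "f \<in> module_hom K V W" "g \<in> module_hom K V W"
    and "S \<subseteq> carrier V" "\<And>x. x \<in> S \<Longrightarrow> f x = g x" "x \<in> span S"
  shows "f x = g x"
proof -
  have "subspace K {x \<in> carrier V. f x = g x} V"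
    by (rule subspaceI)
      (use assms module_axioms in \<open>auto simp: module_hom_zero module_hom_smult
        LinearCombinations.module_hom_add\<close>)
  from span_subset_subspace[OF _ this, of S] assms show ?thesis
    by blast
qed

lemma (in vectorspace) subspace_vimage:
  assumes "vectorspace K W" "f \<in> module_hom K V W" "subspace K N W"
  shows "subspace K {x \<in> carrier V. f x \<in> N} V"
proof -
  interpret W: vectorspace K W by fact
  show ?thesis
    by (rule subspaceI)
      (use assms module_axioms W.module_axioms subspaceD[OF assms(3)] in
        \<open>auto simp: module_hom_zero module_hom_smult LinearCombinations.module_hom_add\<close>)
qed

lemma (in vectorspace) module_hom_span_subset:
  assumes "vectorspace K W" "f \<in> module_hom K V W" "subspace K N W"
    and "S \<subseteq> carrier V" "\<And>x. x \<in> S \<Longrightarrow> f x \<in> N" "x \<in> span S"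
  shows "f x \<in> N"
  using span_subset_subspace[OF _ subspace_vimage[OF assms(1-3)], of S] assms(4-6) by blast

section \<open>Finite generation of spans\<close>

lemma (in vectorspace) finite_subset_span:
  assumes "finite B" "B \<subseteq> span S"
  shows "\<exists>S0\<subseteq>S. finite S0 \<and> B \<subseteq> span S0"
proof -
  have "\<exists>F. F \<subseteq> S \<and> finite F \<and> b \<in> span F" if b: "b \<in> B" for b
  proof -
    have "b \<in> span S"
      using assms(2) b by (rule subsetD)
    then obtain a F where "b = lincomb a F" "finite F" "F \<subseteq> S" "a \<in> F \<rightarrow> carrier K"
      unfolding span_def by auto
    then show ?thesis
      unfolding span_def by auto
  qed
  then obtain F where F: "\<And>b. b \<in> B \<Longrightarrow> F b \<subseteq> S \<and> finite (F b) \<and> b \<in> span (F b)"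
    by metis
  have "B \<subseteq> span (\<Union>b\<in>B. F b)"
  proof
    fix b assume "b \<in> B"
    then show "b \<in> span (\<Union>b\<in>B. F b)"
      using F span_is_monotone[of "F b" "\<Union>b\<in>B. F b"] by (meson UN_upper subsetD)
  qed
  then show ?thesis
    using F assms(1) by (intro exI[of _ "\<Union>b\<in>B. F b"]) auto
qed

text \<open>Finite dimension of \<open>span S\<close> is an intrinsic property of the restricted
  structure; the right-hand side asks only for finitely many ambient vectors, which is what the
  orbit arguments deliver. The substantial direction is that a subspace of a finitely generated
  space is finitely generated: independent subsets of \<open>span S\<close> have at most
  \<open>card B\<close> elements, and a maximal one generates.\<close>

lemma (in vectorspace) fin_dim_span_iff:
  assumes "S \<subseteq> carrier V"
  shows "vectorspace.fin_dim K (vs (span S)) \<longleftrightarrow> (\<exists>B. finite B \<and> B \<subseteq> carrier V \<and> S \<subseteq> span B)"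
proof
  interpret U: vectorspace K "vs (span S)"
    using assms span_is_subspace subspace_is_vs by blast
  have span_eq: "U.span B = span B" "U.lin_dep B = lin_dep B" if "B \<subseteq> span S" for B
    using that assms span_li_not_depend[of B "span S"] span_is_submodule by auto
  show "\<exists>B. finite B \<and> B \<subseteq> carrier V \<and> S \<subseteq> span B" if fin: "U.fin_dim"
  proof -
    obtain B where B: "finite B" "B \<subseteq> span S" "U.span B = span S"
      using fin unfolding U.fin_dim_def by auto
    then show ?thesis
      using assms in_own_span span_eq(1) span_is_subset2 by (metis subset_trans)
  qed
  show "U.fin_dim" if ex: "\<exists>B. finite B \<and> B \<subseteq> carrier V \<and> S \<subseteq> span B"
  proof -
    obtain B where B: "finite B" "B \<subseteq> carrier V" "S \<subseteq> span B"
      using ex by blast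
    have sub: "span S \<subseteq> span B"
      using B span_is_subspace span_subset_subspace by blast
    have card: "finite A \<and> card A \<le> card B" if A: "A \<subseteq> span S" "U.lin_indpt A" for A
    proof -
      \<comment> \<open>The exchange argument is applied to finite subsets first; finiteness of
        \<open>A\<close> follows, since an infinite set has finite subsets of every size.\<close>
      have bound: "card A' \<le> card B" if A': "finite A'" "A' \<subseteq> A" for A'
      proof -
        have "lin_indpt A'"
          using A A' span_eq(2) subset_li_is_li by blast
        moreover have "A' \<subseteq> span B"
          using A A' sub by blast
        ultimately obtain C where "C \<subseteq> carrier V" "int (card C) \<le> int (card B) - int (card A')"
          using replacement[of A' B] A' B by blast
        then show ?thesis by linarith
      qed
      then have "finite A"
        by (metis finite_subset infinite_arbitrarily_large not_less_eq_eq order_refl)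
      with bound show ?thesis by blast
    qed
    obtain A where A: "finite A" "maximal A (\<lambda>A. A \<subseteq> span S \<and> U.lin_indpt A)"
      using maximal_exists[of "\<lambda>A. A \<subseteq> span S \<and> U.lin_indpt A" "card B" "{}"] card
      by (auto simp: U.lin_dep_def)
    then have "U.gen_set A" "A \<subseteq> span S"
      using U.max_li_is_gen[of A] by (auto simp: maximal_def)
    then show ?thesis
      unfolding U.fin_dim_def using A(1) by auto
  qed
qed

text \<open>The values lie in \<open>K\<close>, which is only known as a ring record and carries no
  scalar multiplication field, so functionals cannot be typed as members of
  \<open>module_hom\<close>.\<close>

definition dual_space :: "('k, 'm) ring_scheme \<Rightarrow> ('k, 'a, 'n) module_scheme \<Rightarrow> ('a \<Rightarrow> 'k) set" where
  "dual_space K V = {\<phi> \<in> carrier V \<rightarrow> carrier K.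
     (\<forall>x\<in>carrier V. \<forall>y\<in>carrier V. \<phi> (x \<oplus>\<^bsub>V\<^esub> y) = \<phi> x \<oplus>\<^bsub>K\<^esub> \<phi> y) \<and>
     (\<forall>c\<in>carrier K. \<forall>x\<in>carrier V. \<phi> (c \<odot>\<^bsub>V\<^esub> x) = c \<otimes>\<^bsub>K\<^esub> \<phi> x)}"

lemma dual_spaceD:
  assumes "\<phi> \<in> dual_space K V"
  shows "x \<in> carrier V \<Longrightarrow> \<phi> x \<in> carrier K"
    and "\<lbrakk>x \<in> carrier V; y \<in> carrier V\<rbrakk> \<Longrightarrow> \<phi> (x \<oplus>\<^bsub>V\<^esub> y) = \<phi> x \<oplus>\<^bsub>K\<^esub> \<phi> y"
    and "\<lbrakk>c \<in> carrier K; x \<in> carrier V\<rbrakk> \<Longrightarrow> \<phi> (c \<odot>\<^bsub>V\<^esub> x) = c \<otimes>\<^bsub>K\<^esub> \<phi> x"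
  using assms unfolding dual_space_def by blast+

lemma dual_space_compose:
  "\<lbrakk>f \<in> module_hom K U V; \<phi> \<in> dual_space K V\<rbrakk> \<Longrightarrow> (\<lambda>x. \<phi> (f x)) \<in> dual_space K U"
  unfolding dual_space_def[of K U]
  by (simp add: module_hom_mem module_hom_smult LinearCombinations.module_hom_add dual_spaceD)

lemma (in vectorspace) smult_eq_zeroD:
  assumes "c \<in> carrier K" "x \<in> carrier V" "c \<odot>\<^bsub>V\<^esub> x = \<zero>\<^bsub>V\<^esub>" "c \<noteq> \<zero>\<^bsub>K\<^esub>"
  shows "x = \<zero>\<^bsub>V\<^esub>"
  using mult_inverse[OF assms] assms by simp

lemma (in abelian_group) minus_zero_right: "x \<in> carrier G \<Longrightarrow> x \<ominus> \<zero> = x"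
  by (metis a_inv_closed a_minus_def l_neg r_zero zero_closed)

lemma (in vectorspace) smult_minus_l:
  assumes "a \<in> carrier K" "b \<in> carrier K" "x \<in> carrier V"
  shows "(a \<ominus>\<^bsub>K\<^esub> b) \<odot>\<^bsub>V\<^esub> x = a \<odot>\<^bsub>V\<^esub> x \<ominus>\<^bsub>V\<^esub> b \<odot>\<^bsub>V\<^esub> x"
  using assms by (simp add: a_minus_def smult_l_distr smult_l_minus)

lemma (in vectorspace) smult_mem_subspace_cancel:
  assumes "subspace K N V" "c \<in> carrier K" "c \<noteq> \<zero>\<^bsub>K\<^esub>" "x \<in> carrier V" "c \<odot>\<^bsub>V\<^esub> x \<in> N"
  shows "x \<in> N"
proof -
  have "x = inv\<^bsub>K\<^esub> c \<odot>\<^bsub>V\<^esub> (c \<odot>\<^bsub>V\<^esub> x)"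
    using assms by (intro mult_inverse) auto
  then show ?thesis
    using assms subspaceD(4) by (metis inverse_exists)
qed

text \<open>Zorn's lemma: the union of a chain of subspaces is a subspace and still avoids
  \<open>y\<close>. The maximal \<open>H\<close> turns out to be a hyperplane complementary to the
  line through \<open>y\<close>, and serves as the kernel of a functional.\<close>

lemma (in vectorspace) ex_maximal_subspace_avoiding:
  assumes "subspace K S V" "y \<notin> S"
  shows "\<exists>H. subspace K H V \<and> S \<subseteq> H \<and> y \<notin> H \<and>
    (\<forall>H'. subspace K H' V \<longrightarrow> H \<subseteq> H' \<longrightarrow> y \<notin> H' \<longrightarrow> H' = H)"
proof -
  define \<A> where "\<A> = {H. subspace K H V \<and> S \<subseteq> H \<and> y \<notin> H}"
  have "\<Union>\<C> \<in> \<A>" if ne: "\<C> \<noteq> {}" and chain: "subset.chain \<A> \<C>" for \<C>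
  proof -
    have mem: "\<And>H. H \<in> \<C> \<Longrightarrow> subspace K H V \<and> S \<subseteq> H \<and> y \<notin> H"
      using chain unfolding subset.chain_def \<A>_def by blast
    have "subspace K (\<Union>\<C>) V"
    proof (rule subspaceI)
      show "\<Union>\<C> \<subseteq> carrier V"
        by (rule Union_least) (use mem in \<open>auto dest: subspaceD(1)\<close>)
      show "\<zero>\<^bsub>V\<^esub> \<in> \<Union>\<C>"
        using ne mem by (auto dest: subspaceD(2))
      show "c \<odot>\<^bsub>V\<^esub> x \<in> \<Union>\<C>" if "c \<in> carrier K" "x \<in> \<Union>\<C>" for c x
        using that mem subspaceD(4) by (metis UnionE UnionI)
      show "x \<oplus>\<^bsub>V\<^esub> x' \<in> \<Union>\<C>" if xx': "x \<in> \<Union>\<C>" "x' \<in> \<Union>\<C>" for x x'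
      proof -
        obtain H H' where H: "x \<in> H" "H \<in> \<C>" "x' \<in> H'" "H' \<in> \<C>"
          using xx' by blast
        then have "H \<subseteq> H' \<or> H' \<subseteq> H"
          using chain unfolding subset.chain_def by blast
        then show ?thesis
          using H mem subspaceD(3) by (metis UnionI subsetD)
      qed
    qed
    then show ?thesis
      using mem ne unfolding \<A>_def by blast
  qed
  moreover have "\<A> \<noteq> {}"
    using assms unfolding \<A>_def by blast
  ultimately have "\<exists>M\<in>\<A>. \<forall>H'\<in>\<A>. M \<subseteq> H' \<longrightarrow> H' = M"
    by (rule subset_Zorn_nonempty[rotated])
  then obtain M where M: "M \<in> \<A>" "\<And>H'. \<lbrakk>H' \<in> \<A>; M \<subseteq> H'\<rbrakk> \<Longrightarrow> H' = M"
    by blast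
  then have "H' = M" if "subspace K H' V" "M \<subseteq> H'" "y \<notin> H'" for H'
    using that unfolding \<A>_def by blast
  with M(1) show ?thesis
    unfolding \<A>_def by (intro exI[of _ M]) simp
qed

text \<open>Maximality of \<open>H\<close> makes every \<open>w\<close> congruent modulo
  \<open>H\<close> to a multiple of \<open>y\<close>; as \<open>y\<close> is outside
  \<open>H\<close>, the coefficient is unique. The functional reads off this coefficient, and
  uniqueness yields its linearity.\<close>

lemma (in vectorspace) separating_functional:
  assumes S: "subspace K S V" and y: "y \<in> carrier V" "y \<notin> S"
  shows "\<exists>\<phi>\<in>dual_space K V. (\<forall>s\<in>S. \<phi> s = \<zero>\<^bsub>K\<^esub>) \<and> \<phi> y = \<one>\<^bsub>K\<^esub>"
proof -
  obtain H where H: "subspace K H V" "S \<subseteq> H" "y \<notin> H"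
    and max: "\<And>H'. \<lbrakk>subspace K H' V; H \<subseteq> H'; y \<notin> H'\<rbrakk> \<Longrightarrow> H' = H"
    using ex_maximal_subspace_avoiding[OF S y(2)] by blast
  note Hcl = subspaceD[OF H(1)]
  have "\<exists>c. c \<in> carrier K \<and> w \<ominus>\<^bsub>V\<^esub> c \<odot>\<^bsub>V\<^esub> y \<in> H" if w: "w \<in> carrier V" for w
  proof (cases "w \<in> H")
    case True
    then show ?thesis
      using w y by (intro exI[of _ "\<zero>\<^bsub>K\<^esub>"]) (simp add: M.minus_zero_right)
  next
    case False
    \<comment> \<open>Adjoining \<open>w\<close> to \<open>H\<close> gives a strictly larger
      subspace, which contains \<open>y\<close> by maximality. In \<open>y = h + c w\<close> the
      scalar \<open>c\<close> is nonzero because \<open>y\<close> is not in \<open>H\<close>, so the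
      equation can be solved for \<open>w\<close>.\<close>
    define H' where "H' = {h \<oplus>\<^bsub>V\<^esub> c \<odot>\<^bsub>V\<^esub> w | h c. h \<in> H \<and> c \<in> carrier K}"
    have H'I: "h \<oplus>\<^bsub>V\<^esub> c \<odot>\<^bsub>V\<^esub> w \<in> H'" if "h \<in> H" "c \<in> carrier K" for h c
      using that unfolding H'_def by blast
    have sub: "subspace K H' V"
    proof (rule subspaceI)
      show "H' \<subseteq> carrier V"
        using Hcl(1) w unfolding H'_def by auto
      show "\<zero>\<^bsub>V\<^esub> \<in> H'"
        using H'I[OF Hcl(2) R.zero_closed] w by simp
      show "x \<oplus>\<^bsub>V\<^esub> x' \<in> H'" if xx': "x \<in> H'" "x' \<in> H'" for x x'
      proof -
        obtain h c h' c' where *: "x = h \<oplus>\<^bsub>V\<^esub> c \<odot>\<^bsub>V\<^esub> w" "h \<in> H" "c \<in> carrier K"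
          "x' = h' \<oplus>\<^bsub>V\<^esub> c' \<odot>\<^bsub>V\<^esub> w" "h' \<in> H" "c' \<in> carrier K"
          using xx' unfolding H'_def by blast
        then have "x \<oplus>\<^bsub>V\<^esub> x' = (h \<oplus>\<^bsub>V\<^esub> h') \<oplus>\<^bsub>V\<^esub> (c \<oplus>\<^bsub>K\<^esub> c') \<odot>\<^bsub>V\<^esub> w"
          using Hcl(1) w by (simp add: smult_l_distr M.add.m_ac)
        then show ?thesis
          using H'I * Hcl(3) R.add.m_closed by metis
      qed
      show "c \<odot>\<^bsub>V\<^esub> x \<in> H'" if c: "c \<in> carrier K" and x: "x \<in> H'" for c x
      proof -
        obtain h d where *: "x = h \<oplus>\<^bsub>V\<^esub> d \<odot>\<^bsub>V\<^esub> w" "h \<in> H" "d \<in> carrier K"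
          using x unfolding H'_def by blast
        then have "c \<odot>\<^bsub>V\<^esub> x = c \<odot>\<^bsub>V\<^esub> h \<oplus>\<^bsub>V\<^esub> (c \<otimes>\<^bsub>K\<^esub> d) \<odot>\<^bsub>V\<^esub> w"
          using Hcl(1) w c by (simp add: smult_r_distr smult_assoc1)
        then show ?thesis
          using H'I * Hcl(4) c by (metis R.m_closed)
      qed
    qed
    have "h \<in> H'" if h: "h \<in> H" for h
      using H'I[OF h R.zero_closed] Hcl(1)[OF h] w by simp
    moreover have "w \<in> H'"
      using H'I[OF Hcl(2) R.one_closed] w by simp
    ultimately have "y \<in> H'"
      using max[OF sub] False by blast
    then obtain h c where y_eq: "y = h \<oplus>\<^bsub>V\<^esub> c \<odot>\<^bsub>V\<^esub> w" and hc: "h \<in> H" "c \<in> carrier K"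
      unfolding H'_def by blast
    have c0: "c \<noteq> \<zero>\<^bsub>K\<^esub>"
      using y_eq hc H(3) Hcl(1) w by auto
    have inv: "inv\<^bsub>K\<^esub> c \<in> carrier K"
      using c0 hc by simp
    have "inv\<^bsub>K\<^esub> c \<odot>\<^bsub>V\<^esub> (c \<odot>\<^bsub>V\<^esub> w) = w"
      using mult_inverse[OF hc(2) w refl c0] by simp
    then have "inv\<^bsub>K\<^esub> c \<odot>\<^bsub>V\<^esub> y = inv\<^bsub>K\<^esub> c \<odot>\<^bsub>V\<^esub> h \<oplus>\<^bsub>V\<^esub> w"
      using y_eq hc inv w Hcl(1) by (simp add: smult_r_distr)
    then have "w \<ominus>\<^bsub>V\<^esub> inv\<^bsub>K\<^esub> c \<odot>\<^bsub>V\<^esub> y = \<zero>\<^bsub>V\<^esub> \<ominus>\<^bsub>V\<^esub> inv\<^bsub>K\<^esub> c \<odot>\<^bsub>V\<^esub> h"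
      using inv hc w Hcl(1) by (simp add: a_minus_def M.minus_add M.r_neg1 M.r_neg2 M.add.m_ac)
    also have "\<dots> \<in> H"
      by (intro subspace_minus[OF H(1)] Hcl(2) Hcl(4) inv hc(1))
    finally show ?thesis
      using inv by blast
  qed
  then obtain \<phi> where \<phi>: "\<And>w. w \<in> carrier V \<Longrightarrow> \<phi> w \<in> carrier K"
      "\<And>w. w \<in> carrier V \<Longrightarrow> w \<ominus>\<^bsub>V\<^esub> \<phi> w \<odot>\<^bsub>V\<^esub> y \<in> H"
    by metis
  have unique: "\<phi> w = c" if w: "w \<in> carrier V" and c: "c \<in> carrier K" "w \<ominus>\<^bsub>V\<^esub> c \<odot>\<^bsub>V\<^esub> y \<in> H" for w c
  proof (rule ccontr)
    assume "\<phi> w \<noteq> c"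
    then have "c \<ominus>\<^bsub>K\<^esub> \<phi> w \<noteq> \<zero>\<^bsub>K\<^esub>"
      using c \<phi>(1)[OF w] by auto
    moreover have "(w \<ominus>\<^bsub>V\<^esub> \<phi> w \<odot>\<^bsub>V\<^esub> y) \<ominus>\<^bsub>V\<^esub> (w \<ominus>\<^bsub>V\<^esub> c \<odot>\<^bsub>V\<^esub> y) = (c \<ominus>\<^bsub>K\<^esub> \<phi> w) \<odot>\<^bsub>V\<^esub> y"
      using w c y \<phi>(1)[OF w]
      by (simp add: smult_l_distr smult_l_minus a_minus_def M.minus_add M.add.m_ac M.r_neg1 M.r_neg2)
    ultimately show False
      using smult_mem_subspace_cancel[OF H(1), of "c \<ominus>\<^bsub>K\<^esub> \<phi> w" y]
        subspace_minus[OF H(1) \<phi>(2)[OF w] c(2)] c \<phi>(1)[OF w] y(1) H(3)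
      by simp
  qed
  \<comment> \<open>The right-hand side is an admissible coefficient for the vector on the left, so
    \<open>unique\<close> applies; the same idea gives compatibility with scalars.\<close>
  have "\<phi> (x \<oplus>\<^bsub>V\<^esub> x') = \<phi> x \<oplus>\<^bsub>K\<^esub> \<phi> x'" if "x \<in> carrier V" "x' \<in> carrier V" for x x'
  proof (rule unique)
    have "(x \<ominus>\<^bsub>V\<^esub> \<phi> x \<odot>\<^bsub>V\<^esub> y) \<oplus>\<^bsub>V\<^esub> (x' \<ominus>\<^bsub>V\<^esub> \<phi> x' \<odot>\<^bsub>V\<^esub> y)
        = (x \<oplus>\<^bsub>V\<^esub> x') \<ominus>\<^bsub>V\<^esub> (\<phi> x \<oplus>\<^bsub>K\<^esub> \<phi> x') \<odot>\<^bsub>V\<^esub> y"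
      using that y \<phi>(1) by (simp add: smult_l_distr a_minus_def M.minus_add M.add.m_ac)
    then show "(x \<oplus>\<^bsub>V\<^esub> x') \<ominus>\<^bsub>V\<^esub> (\<phi> x \<oplus>\<^bsub>K\<^esub> \<phi> x') \<odot>\<^bsub>V\<^esub> y \<in> H"
      using that \<phi>(2) Hcl(3) by metis
  qed (use that \<phi>(1) in auto)
  moreover have "\<phi> (c \<odot>\<^bsub>V\<^esub> x) = c \<otimes>\<^bsub>K\<^esub> \<phi> x" if "c \<in> carrier K" "x \<in> carrier V" for c x
  proof (rule unique)
    have "c \<odot>\<^bsub>V\<^esub> (x \<ominus>\<^bsub>V\<^esub> \<phi> x \<odot>\<^bsub>V\<^esub> y) = c \<odot>\<^bsub>V\<^esub> x \<ominus>\<^bsub>V\<^esub> (c \<otimes>\<^bsub>K\<^esub> \<phi> x) \<odot>\<^bsub>V\<^esub> y"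
      using that y \<phi>(1) by (simp add: smult_r_distr a_minus_def smult_r_minus smult_assoc1)
    then show "c \<odot>\<^bsub>V\<^esub> x \<ominus>\<^bsub>V\<^esub> (c \<otimes>\<^bsub>K\<^esub> \<phi> x) \<odot>\<^bsub>V\<^esub> y \<in> H"
      using that \<phi>(2) Hcl(4) by metis
  qed (use that \<phi>(1) in auto)
  ultimately have "\<phi> \<in> dual_space K V"
    using \<phi>(1) unfolding dual_space_def by blast
  moreover have "\<phi> s = \<zero>\<^bsub>K\<^esub>" if "s \<in> S" for s
    using that H(2) Hcl(1) y by (intro unique) (auto simp: M.minus_zero_right)
  moreover have "\<phi> y = \<one>\<^bsub>K\<^esub>"
    using y Hcl(2) by (intro unique) (auto simp: a_minus_def M.r_neg)
  ultimately show ?thesis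
    by blast
qed

section \<open>Eigenspaces of ad\<close>

text \<open>Linearity of \<open>ad\<close> is isolated from the Poisson axioms, so that everything
  in this section applies to the tensor product as soon as its \<open>ad\<close> is known to be
  linear.\<close>

locale ad_linear = vectorspace K P
  for K :: "('k, 'm) ring_scheme" and P :: "('k, 'a, 'n) poisson_scheme" +
  fixes z :: 'a
  assumes ad_hom: "ad P z \<in> module_hom K P P"
begin

lemmas ad_closed = module_hom_mem[OF ad_hom]
  and ad_add = LinearCombinations.module_hom_add[OF ad_hom]
  and ad_smult = module_hom_smult[OF ad_hom]

lemma ad_zero: "ad P z \<zero>\<^bsub>P\<^esub> = \<zero>\<^bsub>P\<^esub>"
  using module_hom_zero[OF ad_hom] module_axioms by blast

lemma funpow_ad_hom: "(ad P z ^^ n) \<in> module_hom K P P"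
proof (induction n)
  case 0
  show ?case by (auto intro: module_homI)
next
  case (Suc n)
  show ?case
    using module_hom_compose[OF Suc ad_hom] by (simp add: comp_def)
qed

lemmas funpow_ad_closed = module_hom_mem[OF funpow_ad_hom]

lemma ad_F_iff:
  "x \<in> ad_F K P z \<longleftrightarrow> x \<in> carrier P \<and>
     (\<exists>B. finite B \<and> B \<subseteq> carrier P \<and> (\<forall>n. (ad P z ^^ n) x \<in> span B))"
proof (cases "x \<in> carrier P")
  case True
  then have "range (\<lambda>n. (ad P z ^^ n) x) \<subseteq> carrier P"
    using funpow_ad_closed by blast
  from fin_dim_span_iff[OF this] True show ?thesis
    unfolding ad_F_def image_subset_iff by simp
qed (simp add: ad_F_def)

lemma ad_eigenspaceD:
  assumes "x \<in> ad_eigenspace P z c"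
  shows "x \<in> carrier P" "ad P z x = c \<odot>\<^bsub>P\<^esub> x"
  using assms unfolding ad_eigenspace_def by auto

lemma ad_eigenspace_subspace:
  assumes c: "c \<in> carrier K"
  shows "subspace K (ad_eigenspace P z c) P"
proof (rule subspaceI)
  show "d \<odot>\<^bsub>P\<^esub> x \<in> ad_eigenspace P z c" if "d \<in> carrier K" "x \<in> ad_eigenspace P z c" for d x
    using that c unfolding ad_eigenspace_def
    by (simp add: ad_smult smult_assoc_simp R.m_comm)
  show "x \<oplus>\<^bsub>P\<^esub> y \<in> ad_eigenspace P z c"
    if "x \<in> ad_eigenspace P z c" "y \<in> ad_eigenspace P z c" for x y
    using that c unfolding ad_eigenspace_def by (simp add: ad_add smult_r_distr)
qed (use c in \<open>auto simp: ad_eigenspace_def ad_zero\<close>)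

lemma ad_Ev_closed: "c \<in> ad_Ev K P z \<Longrightarrow> c \<in> carrier K"
  unfolding ad_Ev_def by simp

lemma ad_D_decomp:
  assumes "x \<in> ad_D K P z"
  shows "\<exists>L v. finite L \<and> L \<subseteq> carrier K \<and> v \<in> L \<rightarrow> carrier P \<and>
    (\<forall>c\<in>L. v c \<in> ad_eigenspace P z c) \<and> x = (\<Oplus>\<^bsub>P\<^esub>c\<in>L. v c)"
proof -
  obtain L v where Lv: "x = (\<Oplus>\<^bsub>P\<^esub>c\<in>L. v c)" "finite L" "L \<subseteq> ad_Ev K P z"
    "\<And>c. c \<in> L \<Longrightarrow> v c \<in> ad_eigenspace P z c"
    using assms unfolding ad_D_def by blast
  show ?thesis
    by (intro exI[of _ L] exI[of _ v] conjI)
      (use Lv ad_Ev_closed ad_eigenspaceD(1)[OF Lv(4)] in auto)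
qed

text \<open>\<open>ad_D\<close> admits only indices from \<open>ad_Ev\<close>, whereas the zero
  vector satisfies the eigenvector equation for every scalar, eigenvalue or not; it is therefore
  represented by the empty sum.\<close>

lemma eigenvector_in_ad_D:
  assumes "c \<in> carrier K" "x \<in> ad_eigenspace P z c"
  shows "x \<in> ad_D K P z"
proof (cases "x = \<zero>\<^bsub>P\<^esub>")
  case True
  then have "x = (\<Oplus>\<^bsub>P\<^esub>c\<in>{}. x)" by simp
  then show ?thesis unfolding ad_D_def by blast
next
  case False
  with assms have "c \<in> ad_Ev K P z"
    unfolding ad_Ev_def ad_eigenspace_def by blast
  moreover have "x = (\<Oplus>\<^bsub>P\<^esub>c\<in>{c}. x)"
    using ad_eigenspaceD(1)[OF assms(2)] by simp
  ultimately show ?thesis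
    unfolding ad_D_def using assms(2)
    by (intro CollectI exI[of _ "{c}"] exI[of _ "\<lambda>_. x"]) auto
qed

lemma ad_D_subspace: "subspace K (ad_D K P z) P"
proof (rule subspaceI)
  show "ad_D K P z \<subseteq> carrier P"
    by (auto dest!: ad_D_decomp)
  show "\<zero>\<^bsub>P\<^esub> \<in> ad_D K P z"
    using eigenvector_in_ad_D[OF R.zero_closed] by (simp add: ad_eigenspace_def ad_zero)
  show "a \<odot>\<^bsub>P\<^esub> x \<in> ad_D K P z" if a: "a \<in> carrier K" and x: "x \<in> ad_D K P z" for a x
  proof -
    obtain L v where Lv: "x = (\<Oplus>\<^bsub>P\<^esub>c\<in>L. v c)" "finite L" "L \<subseteq> ad_Ev K P z"
      "\<And>c. c \<in> L \<Longrightarrow> v c \<in> ad_eigenspace P z c"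
      using x unfolding ad_D_def by blast
    have "a \<odot>\<^bsub>P\<^esub> x = (\<Oplus>\<^bsub>P\<^esub>c\<in>L. a \<odot>\<^bsub>P\<^esub> v c)"
      unfolding Lv(1) using a Lv(2) ad_eigenspaceD(1)[OF Lv(4)] by (intro finsum_smult_ldistr) auto
    moreover have "a \<odot>\<^bsub>P\<^esub> v c \<in> ad_eigenspace P z c" if "c \<in> L" for c
      using subspaceD(4)[OF ad_eigenspace_subspace a Lv(4)[OF that]] ad_Ev_closed Lv(3) that
      by auto
    ultimately show ?thesis
      unfolding ad_D_def using Lv(2,3) by blast
  qed
  show "x \<oplus>\<^bsub>P\<^esub> y \<in> ad_D K P z" if x: "x \<in> ad_D K P z" and y: "y \<in> ad_D K P z" for x y
  proof -
    obtain L v where L: "x = (\<Oplus>\<^bsub>P\<^esub>c\<in>L. v c)" "finite L" "L \<subseteq> ad_Ev K P z"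
      "\<And>c. c \<in> L \<Longrightarrow> v c \<in> ad_eigenspace P z c"
      using x unfolding ad_D_def by blast
    obtain M w where M: "y = (\<Oplus>\<^bsub>P\<^esub>c\<in>M. w c)" "finite M" "M \<subseteq> ad_Ev K P z"
      "\<And>c. c \<in> M \<Longrightarrow> w c \<in> ad_eigenspace P z c"
      using y unfolding ad_D_def by blast
    \<comment> \<open>The two decompositions have different index sets; extension by zero puts both
      over \<open>L \<union> M\<close>.\<close>
    define v' where "v' c = (if c \<in> L then v c else \<zero>\<^bsub>P\<^esub>)" for c
    define w' where "w' c = (if c \<in> M then w c else \<zero>\<^bsub>P\<^esub>)" for c
    have mem: "v' c \<in> ad_eigenspace P z c" "w' c \<in> ad_eigenspace P z c" if "c \<in> L \<union> M" for c
      using that L M ad_Ev_closed subspaceD(2)[OF ad_eigenspace_subspace]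
      by (auto simp: v'_def w'_def)
    have car: "v' \<in> L \<union> M \<rightarrow> carrier P" "w' \<in> L \<union> M \<rightarrow> carrier P"
      using ad_eigenspaceD(1)[OF mem(1)] ad_eigenspaceD(1)[OF mem(2)] by auto
    have "x = (\<Oplus>\<^bsub>P\<^esub>c\<in>L \<union> M. v' c)" "y = (\<Oplus>\<^bsub>P\<^esub>c\<in>L \<union> M. w' c)"
      unfolding L(1) M(1) using L(2) M(2) car
        ad_eigenspaceD(1)[OF L(4)] ad_eigenspaceD(1)[OF M(4)]
      by (intro M.add.finprod_mono_neutral_cong_left; auto simp: v'_def w'_def)+
    then have "x \<oplus>\<^bsub>P\<^esub> y = (\<Oplus>\<^bsub>P\<^esub>c\<in>L \<union> M. v' c \<oplus>\<^bsub>P\<^esub> w' c)"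
      using car by (simp add: M.finsum_addf)
    moreover have "v' c \<oplus>\<^bsub>P\<^esub> w' c \<in> ad_eigenspace P z c" if "c \<in> L \<union> M" for c
    proof -
      have "c \<in> carrier K"
        using that L(3) M(3) ad_Ev_closed by auto
      from subspaceD(3)[OF ad_eigenspace_subspace[OF this] mem[OF that]] show ?thesis .
    qed
    moreover have "finite (L \<union> M)" "L \<union> M \<subseteq> ad_Ev K P z"
      using L M by auto
    ultimately show ?thesis
      unfolding ad_D_def by blast
  qed
qed

lemma hom_finsum:
  assumes "f \<in> module_hom K P P" "v \<in> L \<rightarrow> carrier P"
  shows "f (\<Oplus>\<^bsub>P\<^esub>c\<in>L. v c) = (\<Oplus>\<^bsub>P\<^esub>c\<in>L. f (v c))"
  using assms(2)
proof (induction L rule: infinite_finite_induct)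
  case (insert c L)
  then have "v c \<in> carrier P" "v \<in> L \<rightarrow> carrier P"
    by auto
  with insert show ?case
    using module_hom_mem[OF assms(1)] by (simp add: LinearCombinations.module_hom_add[OF assms(1)] Pi_def)
qed (use module_hom_zero[OF assms(1)] module_axioms in simp_all)

text \<open>Induction on the set of eigenvalues: \<open>g = ad z - c0\<close> annihilates the part
  for \<open>c0\<close> and multiplies the part for each other \<open>c\<close> by the nonzero
  scalar \<open>c - c0\<close>, which leaves a shorter relation.\<close>

lemma eigenvectors_independent:
  assumes "finite L" "L \<subseteq> carrier K" "\<And>c. c \<in> L \<Longrightarrow> v c \<in> ad_eigenspace P z c"
    and "(\<Oplus>\<^bsub>P\<^esub>c\<in>L. v c) = \<zero>\<^bsub>P\<^esub>"
  shows "\<forall>c\<in>L. v c = \<zero>\<^bsub>P\<^esub>"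
  using assms
proof (induction L arbitrary: v rule: finite_induct)
  case empty
  then show ?case by simp
next
  case (insert c0 L)
  define g where "g x = ad P z x \<ominus>\<^bsub>P\<^esub> c0 \<odot>\<^bsub>P\<^esub> x" for x
  have c0: "c0 \<in> carrier K" and LK: "L \<subseteq> carrier K"
    using insert.prems by auto
  have v: "v c \<in> carrier P" "ad P z (v c) = c \<odot>\<^bsub>P\<^esub> v c" if "c \<in> insert c0 L" for c
    using insert.prems(2)[OF that] ad_eigenspaceD by blast+
  have "(\<lambda>x. c0 \<odot>\<^bsub>P\<^esub> x) \<in> module_hom K P P"
    using c0 by (intro module_homI) (auto simp: smult_r_distr smult_assoc_simp R.m_comm)
  then have "g \<in> module_hom K P P"
    unfolding g_def using module_hom_minus[OF ad_hom] module_axioms by blast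
  then interpret g: mod_hom K P P g
    using module_axioms by (simp add: mod_hom_def mod_hom_axioms_def)
  have gv: "g (v c) = (c \<ominus>\<^bsub>K\<^esub> c0) \<odot>\<^bsub>P\<^esub> v c" if "c \<in> insert c0 L" for c
    using that v[OF that] c0 LK by (auto simp: g_def smult_minus_l)
  have vL: "v \<in> L \<rightarrow> carrier P"
    using v by auto
  have "v c0 \<oplus>\<^bsub>P\<^esub> (\<Oplus>\<^bsub>P\<^esub>c\<in>L. v c) = \<zero>\<^bsub>P\<^esub>"
    using insert vL v(1)[of c0] by simp
  then have "g (v c0) \<oplus>\<^bsub>P\<^esub> g (\<Oplus>\<^bsub>P\<^esub>c\<in>L. v c) = \<zero>\<^bsub>P\<^esub>"
    using g.f_add[of "v c0" "\<Oplus>\<^bsub>P\<^esub>c\<in>L. v c"] v(1)[of c0] vL g.f0_is_0 by simp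
  moreover have "g (v c0) = \<zero>\<^bsub>P\<^esub>"
    using v[of c0] c0 by (simp add: g_def)
  ultimately have "g (\<Oplus>\<^bsub>P\<^esub>c\<in>L. v c) = \<zero>\<^bsub>P\<^esub>"
    using vL by simp
  moreover have "g (\<Oplus>\<^bsub>P\<^esub>c\<in>L. v c) = (\<Oplus>\<^bsub>P\<^esub>c\<in>L. g (v c))"
    using hom_finsum[OF g.f_hom vL] .
  moreover have "\<dots> = (\<Oplus>\<^bsub>P\<^esub>c\<in>L. (c \<ominus>\<^bsub>K\<^esub> c0) \<odot>\<^bsub>P\<^esub> v c)"
    using gv v(1) subsetD[OF LK] c0 by (intro M.finsum_cong') auto
  ultimately have sum0: "(\<Oplus>\<^bsub>P\<^esub>c\<in>L. (c \<ominus>\<^bsub>K\<^esub> c0) \<odot>\<^bsub>P\<^esub> v c) = \<zero>\<^bsub>P\<^esub>"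
    by simp
  have mem: "(c \<ominus>\<^bsub>K\<^esub> c0) \<odot>\<^bsub>P\<^esub> v c \<in> ad_eigenspace P z c" if "c \<in> L" for c
  proof (rule subspaceD(4)[OF ad_eigenspace_subspace])
    show "c \<in> carrier K" "c \<ominus>\<^bsub>K\<^esub> c0 \<in> carrier K"
      using that LK c0 by auto
  qed (use that insert.prems in auto)
  have "\<forall>c\<in>L. (c \<ominus>\<^bsub>K\<^esub> c0) \<odot>\<^bsub>P\<^esub> v c = \<zero>\<^bsub>P\<^esub>"
    by (rule insert.IH[OF LK mem sum0])
  moreover have "c \<ominus>\<^bsub>K\<^esub> c0 \<noteq> \<zero>\<^bsub>K\<^esub>" if "c \<in> L" for c
    using that insert.hyps(2) LK c0 by auto
  ultimately have vz: "v c = \<zero>\<^bsub>P\<^esub>" if "c \<in> L" for c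
    using that smult_eq_zeroD[of "c \<ominus>\<^bsub>K\<^esub> c0" "v c"] v(1)[of c] LK c0 by auto
  then have "(\<Oplus>\<^bsub>P\<^esub>c\<in>L. v c) = \<zero>\<^bsub>P\<^esub>"
    by (simp add: M.add.finprod_one_eqI)
  then have "v c0 = \<zero>\<^bsub>P\<^esub>"
    using \<open>v c0 \<oplus>\<^bsub>P\<^esub> _ = \<zero>\<^bsub>P\<^esub>\<close> v(1)[of c0] by simp
  with vz show ?case by simp
qed

text \<open>The finitely many eigencomponents of \<open>x\<close> span a subspace that is stable
  under \<open>ad\<close> and contains \<open>x\<close>, hence the whole orbit.\<close>

lemma ad_D_subset_ad_F: "ad_D K P z \<subseteq> ad_F K P z"
proof
  fix x assume "x \<in> ad_D K P z"
  from ad_D_decomp[OF this] obtain L v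
    where Lv: "finite L" "L \<subseteq> carrier K" "v \<in> L \<rightarrow> carrier P"
      "\<And>c. c \<in> L \<Longrightarrow> v c \<in> ad_eigenspace P z c" "x = (\<Oplus>\<^bsub>P\<^esub>c\<in>L. v c)"
    by blast
  have B: "finite (v ` L)" "v ` L \<subseteq> carrier P"
    using Lv by auto
  note sub = span_is_subspace[OF B(2)]
  have gen: "v c \<in> span (v ` L)" if "c \<in> L" for c
    using that in_own_span[OF B(2)] by blast
  have inv: "ad P z y \<in> span (v ` L)" if "y \<in> span (v ` L)" for y
  proof (rule module_hom_span_subset[OF vectorspace_axioms ad_hom sub B(2) _ that])
    fix b assume "b \<in> v ` L"
    then obtain c where c: "b = v c" "c \<in> L" by blast
    then have "ad P z b = c \<odot>\<^bsub>P\<^esub> v c"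
      using Lv(4) ad_eigenspaceD(2) by blast
    then show "ad P z b \<in> span (v ` L)"
      using subspaceD(4)[OF sub] gen[OF c(2)] c(2) Lv(2) by auto
  qed
  have "(ad P z ^^ n) x \<in> span (v ` L)" for n
  proof (induction n)
    case 0
    then show ?case
      using finsum_mem_subspace[OF sub, of v L] gen Lv(5) by auto
  qed (simp add: inv)
  then show "x \<in> ad_F K P z"
    unfolding ad_F_iff using B Lv by auto
qed

text \<open>Once the orbit reaches zero it stays there, so the orbit is a finite set of
  vectors.\<close>

lemma ad_N_subset_ad_F: "ad_N P z \<subseteq> ad_F K P z"
proof
  fix x assume "x \<in> ad_N P z"
  then obtain m where x: "x \<in> carrier P" and m: "(ad P z ^^ m) x = \<zero>\<^bsub>P\<^esub>"
    unfolding ad_N_def by blast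
  \<comment> \<open>The index \<open>m\<close> is included so that \<open>B\<close> contains the
    terminal value zero, at which the orbit becomes stationary.\<close>
  define B where "B = (\<lambda>n. (ad P z ^^ n) x) ` {..m}"
  have B: "B \<subseteq> carrier P" "finite B"
    unfolding B_def using funpow_ad_closed x by auto
  have "(ad P z ^^ n) x \<in> B" for n
  proof (induction n)
    case (Suc n)
    then obtain k where k: "(ad P z ^^ n) x = (ad P z ^^ k) x" "k \<le> m"
      unfolding B_def by auto
    show ?case
    proof (cases "k = m")
      case True
      then have "(ad P z ^^ Suc n) x = (ad P z ^^ m) x"
        using k m ad_zero by simp
      then show ?thesis
        unfolding B_def by blast
    next
      case False
      then have "(ad P z ^^ Suc n) x = (ad P z ^^ Suc k) x" "Suc k \<le> m"
        using k by auto
      then show ?thesis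
        unfolding B_def by blast
    qed
  qed (auto simp: B_def intro!: image_eqI[of _ _ 0])
  then show "x \<in> ad_F K P z"
    unfolding ad_F_iff using B in_own_span[OF B(1)] x by blast
qed

text \<open>Used below with preimages of subspaces under linear maps: a property that cuts out a
  subspace passes from eigenvectors to all of D(z).\<close>

lemma ad_D_subset_subspace:
  assumes N: "subspace K N P"
    and eig: "\<And>c x. \<lbrakk>c \<in> carrier K; x \<in> ad_eigenspace P z c\<rbrakk> \<Longrightarrow> x \<in> N"
  shows "ad_D K P z \<subseteq> N"
proof
  fix x assume "x \<in> ad_D K P z"
  from ad_D_decomp[OF this] obtain L v
    where Lv: "L \<subseteq> carrier K" "\<And>c. c \<in> L \<Longrightarrow> v c \<in> ad_eigenspace P z c" "x = (\<Oplus>\<^bsub>P\<^esub>c\<in>L. v c)"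
    by blast
  then have "v \<in> L \<rightarrow> N"
    using eig by blast
  then show "x \<in> N"
    unfolding Lv(3) by (rule finsum_mem_subspace[OF N])
qed

text \<open>The m-th power of \<open>ad\<close> acts on \<open>v\<close> as the nonzero scalar
  \<open>c^m\<close>. In the induction the hypothesis is applied to the eigenvector
  \<open>c v\<close> in place of \<open>v\<close>.\<close>

lemma nilpotent_eigenvector:
  assumes "c \<in> carrier K" "c \<noteq> \<zero>\<^bsub>K\<^esub>" "v \<in> ad_eigenspace P z c" "(ad P z ^^ m) v = \<zero>\<^bsub>P\<^esub>"
  shows "v = \<zero>\<^bsub>P\<^esub>"
  using assms(3,4)
proof (induction m arbitrary: v)
  case (Suc m)
  have "(ad P z ^^ m) (c \<odot>\<^bsub>P\<^esub> v) = \<zero>\<^bsub>P\<^esub>"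
    using Suc.prems ad_eigenspaceD(2) by (simp add: funpow_swap1)
  then have "c \<odot>\<^bsub>P\<^esub> v = \<zero>\<^bsub>P\<^esub>"
    using Suc.IH subspaceD(4)[OF ad_eigenspace_subspace] assms(1) Suc.prems(1) by blast
  then show ?case
    using smult_eq_zeroD assms(1,2) ad_eigenspaceD(1)[OF Suc.prems(1)] by blast
qed simp

lemma funpow_ad_eigenspace:
  assumes "c \<in> carrier K" "v \<in> ad_eigenspace P z c"
  shows "(ad P z ^^ m) v \<in> ad_eigenspace P z c"
proof (induction m)
  case (Suc m)
  then show ?case
    using subspaceD(4)[OF ad_eigenspace_subspace[OF assms(1)] assms(1)] ad_eigenspaceD(2) by simp
qed (simp add: assms)

text \<open>Only the component for the eigenvalue zero survives in the sum, and \<open>ad\<close>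
  annihilates it.\<close>

lemma ad_zero_if_eigenparts_fixed:
  assumes "v \<in> L \<rightarrow> carrier P" "\<And>c. c \<in> L \<Longrightarrow> v c \<in> ad_eigenspace P z c"
    and "\<And>c. \<lbrakk>c \<in> L; c \<noteq> \<zero>\<^bsub>K\<^esub>\<rbrakk> \<Longrightarrow> v c = \<zero>\<^bsub>P\<^esub>"
  shows "ad P z (\<Oplus>\<^bsub>P\<^esub>c\<in>L. v c) = \<zero>\<^bsub>P\<^esub>"
proof -
  have "ad P z (v c) = \<zero>\<^bsub>P\<^esub>" if "c \<in> L" for c
    using assms(3)[OF that] ad_eigenspaceD[OF assms(2)[OF that]] ad_zero
    by (cases "c = \<zero>\<^bsub>K\<^esub>") auto
  then show ?thesis
    using hom_finsum[OF ad_hom assms(1)] by (simp add: M.add.finprod_one_eqI)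
qed

text \<open>Powers of \<open>ad\<close> preserve each eigenspace. If a power kills a sum of
  eigenvectors for distinct eigenvalues, independence makes it kill every summand, and a nonzero
  eigenvalue then forces the summand to vanish.\<close>

lemma ad_N_eq_ad_C:
  assumes "ad_F K P z \<subseteq> ad_D K P z"
  shows "ad_N P z = ad_C P z"
proof
  show "ad_C P z \<subseteq> ad_N P z"
  proof
    fix x assume "x \<in> ad_C P z"
    then have "x \<in> carrier P" "(ad P z ^^ 1) x = \<zero>\<^bsub>P\<^esub>"
      unfolding ad_C_def by auto
    then show "x \<in> ad_N P z"
      unfolding ad_N_def by blast
  qed
  show "ad_N P z \<subseteq> ad_C P z"
  proof
    fix x assume x: "x \<in> ad_N P z"
    then obtain m where m: "x \<in> carrier P" "(ad P z ^^ m) x = \<zero>\<^bsub>P\<^esub>"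
      unfolding ad_N_def by blast
    have "x \<in> ad_D K P z"
      using x ad_N_subset_ad_F assms by blast
    from ad_D_decomp[OF this] obtain L v
      where Lv: "finite L" "L \<subseteq> carrier K" "v \<in> L \<rightarrow> carrier P"
        "\<And>c. c \<in> L \<Longrightarrow> v c \<in> ad_eigenspace P z c" "x = (\<Oplus>\<^bsub>P\<^esub>c\<in>L. v c)"
      by blast
    have "(\<Oplus>\<^bsub>P\<^esub>c\<in>L. (ad P z ^^ m) (v c)) = \<zero>\<^bsub>P\<^esub>"
      using m(2) hom_finsum[OF funpow_ad_hom Lv(3)] Lv(5) by simp
    then have "\<forall>c\<in>L. (ad P z ^^ m) (v c) = \<zero>\<^bsub>P\<^esub>"
      using funpow_ad_eigenspace Lv(2,4) by (intro eigenvectors_independent[OF Lv(1,2)]) auto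
    then have "v c = \<zero>\<^bsub>P\<^esub>" if "c \<in> L" "c \<noteq> \<zero>\<^bsub>K\<^esub>" for c
      using that nilpotent_eigenvector Lv(2,4) by (meson subsetD)
    then show "x \<in> ad_C P z"
      unfolding ad_C_def using ad_zero_if_eigenparts_fixed[OF Lv(3,4)] Lv(5) m(1) by simp
  qed
qed

text \<open>Without a nonzero eigenvalue every component with nonzero index would vanish, and D(z)
  would lie in C(z).\<close>

lemma ex_nonzero_eigenvalue:
  assumes "ad_C P z \<subset> ad_D K P z"
  shows "\<exists>c\<in>ad_Ev K P z. c \<noteq> \<zero>\<^bsub>K\<^esub>"
proof (rule ccontr)
  assume no: "\<not> (\<exists>c\<in>ad_Ev K P z. c \<noteq> \<zero>\<^bsub>K\<^esub>)"
  obtain x where x: "x \<in> ad_D K P z" "x \<notin> ad_C P z"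
    using assms by blast
  obtain L v where Lv: "finite L" "L \<subseteq> carrier K" "v \<in> L \<rightarrow> carrier P"
      "\<And>c. c \<in> L \<Longrightarrow> v c \<in> ad_eigenspace P z c" "x = (\<Oplus>\<^bsub>P\<^esub>c\<in>L. v c)"
    using ad_D_decomp[OF x(1)] by blast
  have "v c = \<zero>\<^bsub>P\<^esub>" if "c \<in> L" "c \<noteq> \<zero>\<^bsub>K\<^esub>" for c
    using no that ad_eigenspaceD[OF Lv(4)[OF that(1)]] Lv(2) unfolding ad_Ev_def by blast
  then have "ad P z x = \<zero>\<^bsub>P\<^esub>"
    using ad_zero_if_eigenparts_fixed[OF Lv(3,4)] Lv(5) by simp
  with x subspaceD(1)[OF ad_D_subspace x(1)] show False
    unfolding ad_C_def by blast
qed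

lemma ad_C_psubset_ad_D:
  assumes "c \<in> ad_Ev K P z" "c \<noteq> \<zero>\<^bsub>K\<^esub>"
  shows "ad_C P z \<subset> ad_D K P z"
proof -
  obtain x where x: "x \<in> carrier P" "x \<noteq> \<zero>\<^bsub>P\<^esub>" "ad P z x = c \<odot>\<^bsub>P\<^esub> x" "c \<in> carrier K"
    using assms(1) unfolding ad_Ev_def by blast
  then have "x \<in> ad_D K P z"
    by (intro eigenvector_in_ad_D[of c]) (auto simp: ad_eigenspace_def)
  moreover have "x \<notin> ad_C P z"
    using smult_eq_zeroD[of c x] x assms(2) by (auto simp: ad_C_def)
  moreover have "ad_C P z \<subseteq> ad_D K P z"
    using eigenvector_in_ad_D[OF R.zero_closed] by (auto simp: ad_C_def ad_eigenspace_def)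
  ultimately show ?thesis by blast
qed

end

section \<open>Brackets with the unit\<close>

lemma (in nc_poisson_algebra) bracket_one:
  assumes "z \<in> carrier P"
  shows "bracket P z \<one> = \<zero>"
proof -
  \<comment> \<open>For 1 * 1 = 1 the Leibniz rule says that {z, 1} equals twice itself.\<close>
  have "bracket P z (\<one> \<otimes> \<one>) = bracket P z \<one> \<otimes> \<one> \<oplus> \<one> \<otimes> bracket P z \<one>"
    using assms by (intro leibniz) auto
  then show ?thesis
    using bracket_closed[OF assms P_ring.one_closed] by simp
qed

lemma (in nc_poisson_algebra) ad_linear: "z \<in> carrier P \<Longrightarrow> ad_linear K P z"
  by unfold_locales
    (simp add: module_homI bracket_closed bracket_add_right bracket_smult_right)

text \<open>Polarisation: expanding {1 + z, 1 + z} = 0 leaves {1, z} + {z, 1}, and {z, 1} vanishes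
  by \<open>bracket_one\<close>.\<close>

lemma (in nc_poisson_algebra) bracket_one_left:
  assumes "z \<in> carrier P"
  shows "bracket P \<one> z = \<zero>"
proof -
  have "bracket P (\<one> \<oplus> z) (\<one> \<oplus> z) = \<zero>"
    using assms by (intro bracket_self) auto
  moreover have "bracket P (\<one> \<oplus> z) (\<one> \<oplus> z) = bracket P \<one> z"
    using assms bracket_self[of \<one>] bracket_self[of z]
    by (simp add: bracket_add_left bracket_add_right bracket_closed bracket_one)
  ultimately show ?thesis by simp
qed

section \<open>Linear extension from free spaces\<close>

text \<open>The linear map on the free space with prescribed values \<beta> on the basis. The sum
  runs over the support of \<open>f\<close> because only this part of \<open>I\<close> is known to
  be finite.\<close>

definition free_lift ::
    "('k, 'm) ring_scheme \<Rightarrow> ('k, 'a, 'n) module_scheme \<Rightarrow> 'c set \<Rightarrow> ('c \<Rightarrow> 'a) \<Rightarrow> ('c \<Rightarrow> 'k) \<Rightarrow> 'a" where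
  "free_lift K M I \<beta> f = (\<Oplus>\<^bsub>M\<^esub>x\<in>{x \<in> I. f x \<noteq> \<zero>\<^bsub>K\<^esub>}. f x \<odot>\<^bsub>M\<^esub> \<beta> x)"

lemma carrier_free_space:
  "carrier (free_space K I) = {f \<in> I \<rightarrow>\<^sub>E carrier K. finite {x \<in> I. f x \<noteq> \<zero>\<^bsub>K\<^esub>}}"
  by (simp add: free_space_def)

lemma free_space_ops:
  assumes "ring K"
  shows "zero (free_space K I) = (\<lambda>x\<in>I. \<zero>\<^bsub>K\<^esub>)"
    and "f \<oplus>\<^bsub>free_space K I\<^esub> g = (\<lambda>x\<in>I. f x \<oplus>\<^bsub>K\<^esub> g x)"
    and "c \<odot>\<^bsub>free_space K I\<^esub> f = (\<lambda>x\<in>I. c \<otimes>\<^bsub>K\<^esub> f x)"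
  using assms by (simp_all add: free_space_def ring.func_space_def)

lemma free_space_vectorspace:
  assumes "field K"
  shows "vectorspace K (free_space K I)"
proof -
  interpret field K by fact
  interpret F: module K "func_space I"
    by (rule func_space_is_module)
  note ops = func_space_def
  have fin_add: "finite {x \<in> I. f x \<oplus>\<^bsub>K\<^esub> g x \<noteq> \<zero>\<^bsub>K\<^esub>}"
    if "finite {x \<in> I. f x \<noteq> \<zero>\<^bsub>K\<^esub>}" "finite {x \<in> I. g x \<noteq> \<zero>\<^bsub>K\<^esub>}" for f g
    by (rule finite_subset[OF _ finite_UnI[OF that]]) auto
  have fin_smult: "finite {x \<in> I. c \<otimes>\<^bsub>K\<^esub> f x \<noteq> \<zero>\<^bsub>K\<^esub>}"
    if "c \<in> carrier K" "finite {x \<in> I. f x \<noteq> \<zero>\<^bsub>K\<^esub>}" for c f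
    by (rule finite_subset[OF _ that(2)]) (use that(1) in auto)
  have "LinearCombinations.submodule K (carrier (free_space K I)) (func_space I)"
    unfolding LinearCombinations.submodule_def carrier_free_space
    using F.module_axioms fin_add fin_smult by (auto simp: ops cong: conj_cong)
  then have "module K (func_space I\<lparr>carrier := carrier (free_space K I)\<rparr>)"
    by (rule F.submodule_is_module)
  then have "module K (free_space K I)"
    by (simp add: free_space_def)
  then show ?thesis
    unfolding vectorspace_def using field_axioms by blast
qed

context vectorspace
begin

text \<open>The supports of \<open>f\<close>, \<open>g\<close> and their sum differ in general; this
  permits a common finite index set in the proof of additivity.\<close>

lemma free_lift_eq_sum:
  assumes "\<beta> \<in> I \<rightarrow> carrier V" "f \<in> carrier (free_space K I)"
    and "finite S" "S \<subseteq> I" "{x \<in> I. f x \<noteq> \<zero>\<^bsub>K\<^esub>} \<subseteq> S"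
  shows "free_lift K V I \<beta> f = (\<Oplus>\<^bsub>V\<^esub>x\<in>S. f x \<odot>\<^bsub>V\<^esub> \<beta> x)"
proof -
  have mem: "f x \<in> carrier K" "\<beta> x \<in> carrier V" if "x \<in> I" for x
    using that assms(1,2) by (auto simp: carrier_free_space)
  show ?thesis
    unfolding free_lift_def
    using assms(3-5) mem by (intro M.add.finprod_mono_neutral_cong_left) auto
qed

lemma free_lift_closed:
  assumes "\<beta> \<in> I \<rightarrow> carrier V" "f \<in> carrier (free_space K I)"
  shows "free_lift K V I \<beta> f \<in> carrier V"
  unfolding free_lift_def using assms
  by (intro M.finsum_closed) (auto simp: carrier_free_space)

lemma free_lift_cong:
  assumes "\<And>x. x \<in> I \<Longrightarrow> \<beta> x = \<beta>' x" "\<beta>' \<in> I \<rightarrow> carrier V" "f \<in> carrier (free_space K I)"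
  shows "free_lift K V I \<beta> f = free_lift K V I \<beta>' f"
  unfolding free_lift_def using assms
  by (intro M.finsum_cong') (auto simp: carrier_free_space)

lemma free_lift_hom:
  assumes \<beta>: "\<beta> \<in> I \<rightarrow> carrier V"
  shows "free_lift K V I \<beta> \<in> module_hom K (free_space K I) V"
proof (rule module_homI)
  interpret F: vectorspace K "free_space K I"
    using free_space_vectorspace field_axioms .
  have ring: "ring K" ..
  note ops = free_space_ops[OF ring]
  have mem: "f x \<in> carrier K" if "f \<in> carrier (free_space K I)" "x \<in> I" for f x
    using that by (auto simp: carrier_free_space)
  have fin: "finite {x \<in> I. f x \<noteq> \<zero>\<^bsub>K\<^esub>}" if "f \<in> carrier (free_space K I)" for f
    using that by (auto simp: carrier_free_space)
  show "free_lift K V I \<beta> f \<in> carrier V" if "f \<in> carrier (free_space K I)" for f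
    using that \<beta> by (rule free_lift_closed[rotated])
  show "free_lift K V I \<beta> (f \<oplus>\<^bsub>free_space K I\<^esub> g) = free_lift K V I \<beta> f \<oplus>\<^bsub>V\<^esub> free_lift K V I \<beta> g"
    if f: "f \<in> carrier (free_space K I)" and g: "g \<in> carrier (free_space K I)" for f g
  proof -
    define S where "S = {x \<in> I. f x \<noteq> \<zero>\<^bsub>K\<^esub>} \<union> {x \<in> I. g x \<noteq> \<zero>\<^bsub>K\<^esub>}"
    have S: "finite S" "S \<subseteq> I" "{x \<in> I. f x \<noteq> \<zero>\<^bsub>K\<^esub>} \<subseteq> S" "{x \<in> I. g x \<noteq> \<zero>\<^bsub>K\<^esub>} \<subseteq> S"
      using fin[OF f] fin[OF g] unfolding S_def by auto
    have memS: "x \<in> I" "f x \<in> carrier K" "g x \<in> carrier K" "\<beta> x \<in> carrier V"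
      if "x \<in> S" for x
      using that S(2) \<beta> mem[OF f] mem[OF g] by auto
    have S': "{x \<in> I. (f \<oplus>\<^bsub>free_space K I\<^esub> g) x \<noteq> \<zero>\<^bsub>K\<^esub>} \<subseteq> S"
      unfolding S_def ops by auto
    have "free_lift K V I \<beta> (f \<oplus>\<^bsub>free_space K I\<^esub> g) =
        (\<Oplus>\<^bsub>V\<^esub>x\<in>S. (f \<oplus>\<^bsub>free_space K I\<^esub> g) x \<odot>\<^bsub>V\<^esub> \<beta> x)"
      using f g by (intro free_lift_eq_sum \<beta> S(1,2) S') auto
    also have "\<dots> = (\<Oplus>\<^bsub>V\<^esub>x\<in>S. f x \<odot>\<^bsub>V\<^esub> \<beta> x \<oplus>\<^bsub>V\<^esub> g x \<odot>\<^bsub>V\<^esub> \<beta> x)"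
      using memS by (intro M.finsum_cong') (auto simp: ops smult_l_distr)
    also have "\<dots> = (\<Oplus>\<^bsub>V\<^esub>x\<in>S. f x \<odot>\<^bsub>V\<^esub> \<beta> x) \<oplus>\<^bsub>V\<^esub> (\<Oplus>\<^bsub>V\<^esub>x\<in>S. g x \<odot>\<^bsub>V\<^esub> \<beta> x)"
      using memS by (intro M.finsum_addf) auto
    finally show ?thesis
      using free_lift_eq_sum[OF \<beta> f S(1,2,3)] free_lift_eq_sum[OF \<beta> g S(1,2,4)] by simp
  qed
  show "free_lift K V I \<beta> (c \<odot>\<^bsub>free_space K I\<^esub> f) = c \<odot>\<^bsub>V\<^esub> free_lift K V I \<beta> f"
    if c: "c \<in> carrier K" and f: "f \<in> carrier (free_space K I)" for c f
  proof -
    let ?S = "{x \<in> I. f x \<noteq> \<zero>\<^bsub>K\<^esub>}"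
    have S': "{x \<in> I. (c \<odot>\<^bsub>free_space K I\<^esub> f) x \<noteq> \<zero>\<^bsub>K\<^esub>} \<subseteq> ?S"
      using c unfolding ops by auto
    have "free_lift K V I \<beta> (c \<odot>\<^bsub>free_space K I\<^esub> f) =
        (\<Oplus>\<^bsub>V\<^esub>x\<in>?S. (c \<odot>\<^bsub>free_space K I\<^esub> f) x \<odot>\<^bsub>V\<^esub> \<beta> x)"
      using f c fin[OF f] by (intro free_lift_eq_sum \<beta> S') auto
    also have "\<dots> = (\<Oplus>\<^bsub>V\<^esub>x\<in>?S. c \<odot>\<^bsub>V\<^esub> (f x \<odot>\<^bsub>V\<^esub> \<beta> x))"
      using \<beta> mem[OF f] c
      by (intro M.finsum_cong') (auto simp: ops smult_assoc1 Pi_iff)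
    also have "\<dots> = c \<odot>\<^bsub>V\<^esub> (\<Oplus>\<^bsub>V\<^esub>x\<in>?S. f x \<odot>\<^bsub>V\<^esub> \<beta> x)"
      using \<beta> mem[OF f] c fin[OF f] by (intro finsum_smult_ldistr[symmetric]) auto
    finally show ?thesis
      by (simp add: free_lift_def)
  qed
qed

lemma free_gen_closed: "x \<in> I \<Longrightarrow> free_gen K I x \<in> carrier (free_space K I)"
  by (auto simp: carrier_free_space free_gen_def intro: finite_subset[of _ "{x}"])

lemma free_lift_gen:
  assumes "\<beta> \<in> I \<rightarrow> carrier V" "x \<in> I"
  shows "free_lift K V I \<beta> (free_gen K I x) = \<beta> x"
proof -
  have "free_lift K V I \<beta> (free_gen K I x) = (\<Oplus>\<^bsub>V\<^esub>y\<in>{x}. free_gen K I x y \<odot>\<^bsub>V\<^esub> \<beta> y)"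
    using assms free_gen_closed[OF assms(2)]
    by (intro free_lift_eq_sum) (auto simp: free_gen_def)
  also have "\<dots> = \<beta> x"
  proof -
    have "\<beta> x \<in> carrier V" using assms by auto
    then show ?thesis using assms(2) by (simp add: free_gen_def)
  qed
  finally show ?thesis .
qed

text \<open>Here the argument is fixed and the prescribed values vary, in contrast to
  \<open>free_lift_hom\<close>; operations of two arguments require both kinds of linearity.\<close>

lemma free_lift_add:
  assumes "\<beta> \<in> I \<rightarrow> carrier V" "\<beta>' \<in> I \<rightarrow> carrier V" "f \<in> carrier (free_space K I)"
  shows "free_lift K V I (\<lambda>x. \<beta> x \<oplus>\<^bsub>V\<^esub> \<beta>' x) f =
    free_lift K V I \<beta> f \<oplus>\<^bsub>V\<^esub> free_lift K V I \<beta>' f"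
proof -
  let ?S = "{x \<in> I. f x \<noteq> \<zero>\<^bsub>K\<^esub>}"
  have mem: "f x \<in> carrier K" "\<beta> x \<in> carrier V" "\<beta>' x \<in> carrier V" if "x \<in> I" for x
    using that assms by (auto simp: carrier_free_space)
  have "(\<Oplus>\<^bsub>V\<^esub>x\<in>?S. f x \<odot>\<^bsub>V\<^esub> (\<beta> x \<oplus>\<^bsub>V\<^esub> \<beta>' x)) =
      (\<Oplus>\<^bsub>V\<^esub>x\<in>?S. f x \<odot>\<^bsub>V\<^esub> \<beta> x \<oplus>\<^bsub>V\<^esub> f x \<odot>\<^bsub>V\<^esub> \<beta>' x)"
    using mem by (intro M.finsum_cong') (auto simp: smult_r_distr)
  then show ?thesis
    unfolding free_lift_def using mem by (simp add: M.finsum_addf Pi_iff)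
qed

lemma free_lift_smult:
  assumes "\<beta> \<in> I \<rightarrow> carrier V" "f \<in> carrier (free_space K I)" "c \<in> carrier K"
  shows "free_lift K V I (\<lambda>x. c \<odot>\<^bsub>V\<^esub> \<beta> x) f = c \<odot>\<^bsub>V\<^esub> free_lift K V I \<beta> f"
proof -
  let ?S = "{x \<in> I. f x \<noteq> \<zero>\<^bsub>K\<^esub>}"
  have mem: "f x \<in> carrier K" "\<beta> x \<in> carrier V" if "x \<in> I" for x
    using that assms by (auto simp: carrier_free_space)
  have fin: "finite ?S"
    using assms by (auto simp: carrier_free_space)
  have "(\<Oplus>\<^bsub>V\<^esub>x\<in>?S. f x \<odot>\<^bsub>V\<^esub> (c \<odot>\<^bsub>V\<^esub> \<beta> x)) =
      (\<Oplus>\<^bsub>V\<^esub>x\<in>?S. c \<odot>\<^bsub>V\<^esub> (f x \<odot>\<^bsub>V\<^esub> \<beta> x))"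
    using mem assms(3) by (intro M.finsum_cong') (auto simp: smult_assoc_simp R.m_comm)
  also have "\<dots> = c \<odot>\<^bsub>V\<^esub> (\<Oplus>\<^bsub>V\<^esub>x\<in>?S. f x \<odot>\<^bsub>V\<^esub> \<beta> x)"
    using mem assms(3) fin by (intro finsum_smult_ldistr[symmetric]) auto
  finally show ?thesis
    unfolding free_lift_def .
qed

end

text \<open>Induction over a finite set containing the support: the value at \<open>s\<close> is
  cleared and restored by a multiple of the generator at \<open>s\<close>. Since all members of the
  carrier are \<open>undefined\<close> outside \<open>I\<close>, functions need to be compared only
  on \<open>I\<close>.\<close>

lemma span_free_gen:
  assumes "field K"
  shows "module.span K (free_space K I) (free_gen K I ` I) = carrier (free_space K I)"
proof -
  interpret F: vectorspace K "free_space K I"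
    using free_space_vectorspace assms .
  interpret field K by fact
  have ring: "ring K" ..
  note ops = free_space_ops[OF ring]
  have gens: "free_gen K I ` I \<subseteq> carrier (free_space K I)"
    by (auto intro: F.free_gen_closed)
  note sub = F.span_is_subspace[OF gens]
  have "f \<in> F.span (free_gen K I ` I)"
    if "finite S" "f \<in> carrier (free_space K I)" "{x \<in> I. f x \<noteq> \<zero>\<^bsub>K\<^esub>} \<subseteq> S" for S f
    using that
  proof (induction S arbitrary: f rule: finite_induct)
    case empty
    then have "f = (\<lambda>x\<in>I. \<zero>\<^bsub>K\<^esub>)"
      by (auto simp: carrier_free_space PiE_def extensional_def)
    then have "f = \<zero>\<^bsub>free_space K I\<^esub>"
      by (simp add: ops)
    then show ?case
      using subspaceD(2)[OF sub] by simp
  next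
    case (insert s S)
    show ?case
    proof (cases "s \<in> I")
      case False
      with insert show ?thesis by (intro insert.IH) auto
    next
      case True
      define g where "g = f(s := \<zero>\<^bsub>K\<^esub>)"
      have fs: "f x \<in> carrier K" if "x \<in> I" for x
        using that insert.prems(1) by (auto simp: carrier_free_space)
      have "{x \<in> I. g x \<noteq> \<zero>\<^bsub>K\<^esub>} \<subseteq> {x \<in> I. f x \<noteq> \<zero>\<^bsub>K\<^esub>}"
        by (auto simp: g_def)
      moreover have "finite {x \<in> I. f x \<noteq> \<zero>\<^bsub>K\<^esub>}"
        using insert.prems(1) by (simp add: carrier_free_space)
      ultimately have "finite {x \<in> I. g x \<noteq> \<zero>\<^bsub>K\<^esub>}"
        by (rule finite_subset)
      moreover have "g \<in> I \<rightarrow>\<^sub>E carrier K"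
        using insert.prems(1) True
        by (auto simp: carrier_free_space g_def PiE_def extensional_def)
      ultimately have "g \<in> carrier (free_space K I)"
        by (simp add: carrier_free_space)
      then have "g \<in> F.span (free_gen K I ` I)"
      proof (rule insert.IH)
        show "{x \<in> I. g x \<noteq> \<zero>\<^bsub>K\<^esub>} \<subseteq> S"
          using insert.prems(2) by (auto simp: g_def)
      qed
      moreover have "f s \<odot>\<^bsub>free_space K I\<^esub> free_gen K I s \<in> F.span (free_gen K I ` I)"
        using True fs F.in_own_span[OF gens] by (intro subspaceD(4)[OF sub]) auto
      moreover have "f = f s \<odot>\<^bsub>free_space K I\<^esub> free_gen K I s \<oplus>\<^bsub>free_space K I\<^esub> g"
      proof
        fix x
        show "f x = (f s \<odot>\<^bsub>free_space K I\<^esub> free_gen K I s \<oplus>\<^bsub>free_space K I\<^esub> g) x"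
          using fs insert.prems(1) True
          by (cases "x \<in> I") (auto simp: ops free_gen_def g_def carrier_free_space PiE_def extensional_def)
      qed
      ultimately show ?thesis
        using subspaceD(3)[OF sub] by metis
    qed
  qed
  then have "carrier (free_space K I) \<subseteq> F.span (free_gen K I ` I)"
    by (auto simp: carrier_free_space)
  then show ?thesis
    using F.span_is_subset2[OF gens] by (rule subset_antisym[rotated])
qed

text \<open>Both sides are linear in \<open>f\<close> and take the value
  \<open>h (\<beta> x)\<close> on the generator at \<open>x\<close>.\<close>

lemma module_hom_free_lift:
  assumes "vectorspace K V" "vectorspace K W" "h \<in> module_hom K V W"
    and "\<beta> \<in> I \<rightarrow> carrier V" "f \<in> carrier (free_space K I)"
  shows "h (free_lift K V I \<beta> f) = free_lift K W I (\<lambda>x. h (\<beta> x)) f"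
proof -
  interpret V: vectorspace K V by fact
  interpret W: vectorspace K W by fact
  interpret F: vectorspace K "free_space K I"
    using free_space_vectorspace V.field_axioms .
  have h\<beta>: "(\<lambda>x. h (\<beta> x)) \<in> I \<rightarrow> carrier W"
    using module_hom_mem[OF assms(3)] assms(4) by auto
  have hom: "(\<lambda>f. h (free_lift K V I \<beta> f)) \<in> module_hom K (free_space K I) W"
    using module_hom_compose[OF V.free_lift_hom[OF assms(4)] assms(3)] .
  have gens: "free_gen K I ` I \<subseteq> carrier (free_space K I)"
    by (auto intro: F.free_gen_closed)
  have f: "f \<in> F.span (free_gen K I ` I)"
    using span_free_gen[OF V.field_axioms] assms(5) by blast
  show ?thesis
  proof (rule F.module_hom_eq_on_span[OF W.module_axioms hom W.free_lift_hom[OF h\<beta>] gens _ f])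
    fix g assume "g \<in> free_gen K I ` I"
    then obtain x where "g = free_gen K I x" "x \<in> I"
      by auto
    then show "h (free_lift K V I \<beta> g) = free_lift K W I (\<lambda>x. h (\<beta> x)) g"
      by (simp add: V.free_lift_gen[OF assms(4)] W.free_lift_gen[OF h\<beta>])
  qed
qed

section \<open>The tensor product as a vector space\<close>

definition bilinear_map ::
    "('k, 'm) ring_scheme \<Rightarrow> ('k, 'a, 'n) module_scheme \<Rightarrow> ('k, 'b, 'l) module_scheme \<Rightarrow>
     ('k, 'c, 'p) module_scheme \<Rightarrow> ('a \<Rightarrow> 'b \<Rightarrow> 'c) \<Rightarrow> bool" where
  "bilinear_map K A B M \<beta> \<longleftrightarrow>
     (\<forall>a\<in>carrier A. (\<lambda>b. \<beta> a b) \<in> module_hom K B M) \<and>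
     (\<forall>b\<in>carrier B. (\<lambda>a. \<beta> a b) \<in> module_hom K A M)"

lemma bilinear_mapI:
  assumes "\<And>a b. \<lbrakk>a \<in> carrier A; b \<in> carrier B\<rbrakk> \<Longrightarrow> \<beta> a b \<in> carrier M"
    and "\<And>a a' b. \<lbrakk>a \<in> carrier A; a' \<in> carrier A; b \<in> carrier B\<rbrakk> \<Longrightarrow>
      \<beta> (a \<oplus>\<^bsub>A\<^esub> a') b = \<beta> a b \<oplus>\<^bsub>M\<^esub> \<beta> a' b"
    and "\<And>a b b'. \<lbrakk>a \<in> carrier A; b \<in> carrier B; b' \<in> carrier B\<rbrakk> \<Longrightarrow>
      \<beta> a (b \<oplus>\<^bsub>B\<^esub> b') = \<beta> a b \<oplus>\<^bsub>M\<^esub> \<beta> a b'"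
    and "\<And>c a b. \<lbrakk>c \<in> carrier K; a \<in> carrier A; b \<in> carrier B\<rbrakk> \<Longrightarrow>
      \<beta> (c \<odot>\<^bsub>A\<^esub> a) b = c \<odot>\<^bsub>M\<^esub> \<beta> a b"
    and "\<And>c a b. \<lbrakk>c \<in> carrier K; a \<in> carrier A; b \<in> carrier B\<rbrakk> \<Longrightarrow>
      \<beta> a (c \<odot>\<^bsub>B\<^esub> b) = c \<odot>\<^bsub>M\<^esub> \<beta> a b"
  shows "bilinear_map K A B M \<beta>"
  unfolding bilinear_map_def by (intro conjI ballI module_homI assms)

lemma bilinear_mapD:
  assumes "bilinear_map K A B M \<beta>"
  shows "\<lbrakk>a \<in> carrier A; b \<in> carrier B\<rbrakk> \<Longrightarrow> \<beta> a b \<in> carrier M"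
    and "\<lbrakk>a \<in> carrier A; a' \<in> carrier A; b \<in> carrier B\<rbrakk> \<Longrightarrow>
      \<beta> (a \<oplus>\<^bsub>A\<^esub> a') b = \<beta> a b \<oplus>\<^bsub>M\<^esub> \<beta> a' b"
    and "\<lbrakk>a \<in> carrier A; b \<in> carrier B; b' \<in> carrier B\<rbrakk> \<Longrightarrow>
      \<beta> a (b \<oplus>\<^bsub>B\<^esub> b') = \<beta> a b \<oplus>\<^bsub>M\<^esub> \<beta> a b'"
    and "\<lbrakk>c \<in> carrier K; a \<in> carrier A; b \<in> carrier B\<rbrakk> \<Longrightarrow>
      \<beta> (c \<odot>\<^bsub>A\<^esub> a) b = c \<odot>\<^bsub>M\<^esub> \<beta> a b"
    and "\<lbrakk>c \<in> carrier K; a \<in> carrier A; b \<in> carrier B\<rbrakk> \<Longrightarrow>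
      \<beta> a (c \<odot>\<^bsub>B\<^esub> b) = c \<odot>\<^bsub>M\<^esub> \<beta> a b"
proof -
  have *: "a \<in> carrier A \<Longrightarrow> (\<lambda>b. \<beta> a b) \<in> module_hom K B M"
    "b \<in> carrier B \<Longrightarrow> (\<lambda>a. \<beta> a b) \<in> module_hom K A M" for a b
    using assms unfolding bilinear_map_def by auto
  show "\<lbrakk>a \<in> carrier A; b \<in> carrier B\<rbrakk> \<Longrightarrow> \<beta> a b \<in> carrier M"
    using module_hom_mem[OF *(1)] .
  show "\<lbrakk>a \<in> carrier A; a' \<in> carrier A; b \<in> carrier B\<rbrakk> \<Longrightarrow>
      \<beta> (a \<oplus>\<^bsub>A\<^esub> a') b = \<beta> a b \<oplus>\<^bsub>M\<^esub> \<beta> a' b"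
    using LinearCombinations.module_hom_add[OF *(2)] .
  show "\<lbrakk>a \<in> carrier A; b \<in> carrier B; b' \<in> carrier B\<rbrakk> \<Longrightarrow>
      \<beta> a (b \<oplus>\<^bsub>B\<^esub> b') = \<beta> a b \<oplus>\<^bsub>M\<^esub> \<beta> a b'"
    using LinearCombinations.module_hom_add[OF *(1)] .
  show "\<lbrakk>c \<in> carrier K; a \<in> carrier A; b \<in> carrier B\<rbrakk> \<Longrightarrow>
      \<beta> (c \<odot>\<^bsub>A\<^esub> a) b = c \<odot>\<^bsub>M\<^esub> \<beta> a b"
    using module_hom_smult[OF *(2)] .
  show "\<lbrakk>c \<in> carrier K; a \<in> carrier A; b \<in> carrier B\<rbrakk> \<Longrightarrow>
      \<beta> a (c \<odot>\<^bsub>B\<^esub> b) = c \<odot>\<^bsub>M\<^esub> \<beta> a b"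
    using module_hom_smult[OF *(1)] .
qed

lemma bilinear_map_add:
  assumes "module K A" "module K B" "module K M"
    and "bilinear_map K A B M \<beta>" "bilinear_map K A B M \<gamma>"
  shows "bilinear_map K A B M (\<lambda>a b. \<beta> a b \<oplus>\<^bsub>M\<^esub> \<gamma> a b)"
  using module.module_hom_add[OF assms(3) _ _ assms(1)]
    module.module_hom_add[OF assms(3) _ _ assms(2)] assms(4,5)
  unfolding bilinear_map_def by simp

lemma bilinear_map_compose:
  assumes "bilinear_map K A' B' M \<beta>" "f \<in> module_hom K A A'" "g \<in> module_hom K B B'"
  shows "bilinear_map K A B M (\<lambda>a b. \<beta> (f a) (g b))"
  by (rule bilinear_mapI)
    (use assms(2,3) in \<open>simp_all add: module_hom_mem module_hom_smult
      LinearCombinations.module_hom_add bilinear_mapD[OF assms(1)]\<close>)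

locale tensor_spaces = A: vectorspace K A + B: vectorspace K B
  for K :: "('k, 'm) ring_scheme"
    and A :: "('k, 'a, 'n) poisson_scheme" and B :: "('k, 'b, 'l) poisson_scheme"
begin

abbreviation "I \<equiv> carrier A \<times> carrier B"
abbreviation "F \<equiv> tensor_free K A B"
abbreviation "R \<equiv> tensor_relations K A B"
abbreviation "cl \<equiv> tensor_class K A B"
abbreviation "gen \<equiv> tensor_gen K A B"
abbreviation "pt \<equiv> pure_tensor K A B"
abbreviation "T \<equiv> tensor_poisson K A B"

sublocale F: vectorspace K F
  unfolding tensor_free_def by (rule free_space_vectorspace) (rule A.field_axioms)

lemma gen_closed: "\<lbrakk>a \<in> carrier A; b \<in> carrier B\<rbrakk> \<Longrightarrow> gen a b \<in> carrier F"
  unfolding tensor_gen_def tensor_free_def by (rule A.free_gen_closed) simp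

text \<open>Names the generating set inside \<open>tensor_relations\<close>, so that maps can be
  shown to vanish on the relations by checking generators.\<close>

definition relators :: "('a \<times> 'b \<Rightarrow> 'k) set" where
  "relators =
     {gen (a \<oplus>\<^bsub>A\<^esub> a') b \<ominus>\<^bsub>F\<^esub> (gen a b \<oplus>\<^bsub>F\<^esub> gen a' b)
        | a a' b. a \<in> carrier A \<and> a' \<in> carrier A \<and> b \<in> carrier B} \<union>
      {gen a (b \<oplus>\<^bsub>B\<^esub> b') \<ominus>\<^bsub>F\<^esub> (gen a b \<oplus>\<^bsub>F\<^esub> gen a b')
        | a b b'. a \<in> carrier A \<and> b \<in> carrier B \<and> b' \<in> carrier B} \<union>
      {gen (c \<odot>\<^bsub>A\<^esub> a) b \<ominus>\<^bsub>F\<^esub> c \<odot>\<^bsub>F\<^esub> gen a b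
        | c a b. c \<in> carrier K \<and> a \<in> carrier A \<and> b \<in> carrier B} \<union>
      {gen a (c \<odot>\<^bsub>B\<^esub> b) \<ominus>\<^bsub>F\<^esub> c \<odot>\<^bsub>F\<^esub> gen a b
        | c a b. c \<in> carrier K \<and> a \<in> carrier A \<and> b \<in> carrier B}"

lemma relations_eq: "R = F.span relators"
  unfolding tensor_relations_def relators_def ..

lemma relators_closed: "relators \<subseteq> carrier F"
  unfolding relators_def by (auto intro!: F.M.minus_closed gen_closed)

lemma relators_subset: "relators \<subseteq> R"
  unfolding relations_eq using F.in_own_span[OF relators_closed] .

lemma relations_subspace: "subspace K R F"
  unfolding relations_eq using F.span_is_subspace[OF relators_closed] .

sublocale R: abelian_subgroup R F
proof (rule abelian_subgroupI3)
  show "additive_subgroup R F"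
  proof (intro additive_subgroup.intro)
    show "subgroup R (add_monoid F)"
    proof (rule group.subgroupI[OF F.M.a_group])
      show "R \<subseteq> carrier (add_monoid F)" "R \<noteq> {}"
        using subspaceD(1,2)[OF relations_subspace] by auto
      show "inv\<^bsub>add_monoid F\<^esub> x \<in> R" if x: "x \<in> R" for x
      proof -
        have "\<zero>\<^bsub>F\<^esub> \<ominus>\<^bsub>F\<^esub> x \<in> R"
          by (intro F.subspace_minus relations_subspace subspaceD(2)[OF relations_subspace] x)
        then show ?thesis
          using subspaceD(1)[OF relations_subspace x] by (simp add: a_minus_def a_inv_def)
      qed
      show "x \<otimes>\<^bsub>add_monoid F\<^esub> y \<in> R" if "x \<in> R" "y \<in> R" for x y
        using subspaceD(3)[OF relations_subspace that] by simp
    qed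
  qed
qed (rule F.M.abelian_group_axioms)

text \<open>The difference of cosets formed in \<open>tensor_algebra\<close> agrees with that in
  \<open>T\<close> because it depends only on carrier, addition and zero, which the extension by a
  bracket leaves unchanged. This lets the commutator branch of \<open>tensor_bracket\<close> be read
  in \<open>T\<close>.\<close>

lemma T_simps:
  "carrier T = a_rcosets\<^bsub>F\<^esub> R"
  "zero T = R"
  "S \<oplus>\<^bsub>T\<^esub> S' = S <+>\<^bsub>F\<^esub> S'"
  "c \<odot>\<^bsub>T\<^esub> S = (\<Union>f\<in>S. cl (c \<odot>\<^bsub>F\<^esub> f))"
  "S \<ominus>\<^bsub>tensor_algebra K A B\<^esub> S' = S \<ominus>\<^bsub>T\<^esub> S'"
  "bracket T S S' = tensor_bracket K A B S S'"
  by (simp_all add: tensor_poisson_def tensor_algebra_def module.defs poisson.defs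
      a_minus_def a_inv_def m_inv_def)

lemma carrier_T: "carrier T = cl ` carrier F"
  unfolding T_simps A_RCOSETS_def' tensor_class_def by blast

lemma cl_closed: "f \<in> carrier F \<Longrightarrow> cl f \<in> carrier T"
  unfolding carrier_T by blast

lemma cl_eqI:
  assumes f: "f \<in> carrier F" and g: "g \<in> cl f"
  shows "cl g = cl f"
  using R.a_repr_independence'[OF _ f] g unfolding tensor_class_def by simp

lemma cl_mem: "\<lbrakk>f \<in> carrier F; g \<in> cl f\<rbrakk> \<Longrightarrow> g \<in> carrier F"
  unfolding tensor_class_def by (rule R.a_elemrcos_carrier)

lemma cl_self: "f \<in> carrier F \<Longrightarrow> f \<in> cl f"
  unfolding tensor_class_def using R.a_rcos_self .

lemma cl_memE:
  assumes "g \<in> cl f"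
  obtains r where "r \<in> R" "g = r \<oplus>\<^bsub>F\<^esub> f"
  using assms unfolding tensor_class_def a_r_coset_def' by auto

lemma cl_memI: "r \<in> R \<Longrightarrow> r \<oplus>\<^bsub>F\<^esub> f \<in> cl f"
  unfolding tensor_class_def a_r_coset_def' by auto

lemma cl_zero: "cl \<zero>\<^bsub>F\<^esub> = \<zero>\<^bsub>T\<^esub>"
  unfolding T_simps tensor_class_def
  by (rule F.M.a_coset_add_zero) (use subspaceD(1)[OF relations_subspace] in auto)

lemma cl_add:
  "\<lbrakk>f \<in> carrier F; g \<in> carrier F\<rbrakk> \<Longrightarrow> cl f \<oplus>\<^bsub>T\<^esub> cl g = cl (f \<oplus>\<^bsub>F\<^esub> g)"
  unfolding T_simps tensor_class_def by (rule R.a_rcos_sum)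

text \<open>Scalar multiplication of cosets is a union over representatives; as the relations are
  closed under scalars, every representative contributes the same coset.\<close>

lemma cl_smult:
  assumes c: "c \<in> carrier K" and f: "f \<in> carrier F"
  shows "c \<odot>\<^bsub>T\<^esub> cl f = cl (c \<odot>\<^bsub>F\<^esub> f)"
proof -
  have "cl (c \<odot>\<^bsub>F\<^esub> g) = cl (c \<odot>\<^bsub>F\<^esub> f)" if "g \<in> cl f" for g
  proof (rule cl_eqI)
    obtain r where r: "r \<in> R" "g = r \<oplus>\<^bsub>F\<^esub> f"
      using \<open>g \<in> cl f\<close> by (rule cl_memE)
    then have "c \<odot>\<^bsub>F\<^esub> g = c \<odot>\<^bsub>F\<^esub> r \<oplus>\<^bsub>F\<^esub> c \<odot>\<^bsub>F\<^esub> f"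
      using c f subspaceD(1)[OF relations_subspace] by (simp add: F.smult_r_distr)
    then show "c \<odot>\<^bsub>F\<^esub> g \<in> cl (c \<odot>\<^bsub>F\<^esub> f)"
      using cl_memI subspaceD(4)[OF relations_subspace c r(1)] by simp
  qed (use c f in auto)
  then show ?thesis
    unfolding T_simps using cl_self[OF f] by blast
qed

sublocale T: vectorspace K T
proof (rule vs_criteria)
  note cls = cl_add cl_smult cl_zero[symmetric]
  show "field K" by (rule A.field_axioms)
  show "\<zero>\<^bsub>T\<^esub> \<in> carrier T"
    using cl_closed[OF F.M.zero_closed] cl_zero by simp
  show "\<forall>v\<in>carrier T. \<exists>neg_v\<in>carrier T. v \<oplus>\<^bsub>T\<^esub> neg_v = \<zero>\<^bsub>T\<^esub>"
  proof
    fix v assume "v \<in> carrier T"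
    then obtain f where f: "v = cl f" "f \<in> carrier F"
      unfolding carrier_T by blast
    then have "v \<oplus>\<^bsub>T\<^esub> cl (\<ominus>\<^bsub>F\<^esub> f) = \<zero>\<^bsub>T\<^esub>"
      by (simp add: cls F.M.r_neg)
    then show "\<exists>neg_v\<in>carrier T. v \<oplus>\<^bsub>T\<^esub> neg_v = \<zero>\<^bsub>T\<^esub>"
      using f cl_closed by (metis F.M.a_inv_closed)
  qed
\<comment> \<open>The remaining axioms are inherited from \<open>F\<close>, since every element of
  the carrier is a class \<open>cl f\<close>.\<close>
qed (auto simp: carrier_T cl_add cl_smult cl_zero[symmetric] F.M.add.m_ac F.smult_l_distr
    F.smult_r_distr F.smult_assoc1 intro!: imageI)

lemma cl_hom: "cl \<in> module_hom K F T"
  by (rule module_homI) (simp_all add: cl_closed cl_add cl_smult)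

lemma cl_eqI_diff:
  assumes "f \<in> carrier F" "g \<in> carrier F" "f \<ominus>\<^bsub>F\<^esub> g \<in> relators"
  shows "cl f = cl g"
proof (rule cl_eqI)
  have "f = (f \<ominus>\<^bsub>F\<^esub> g) \<oplus>\<^bsub>F\<^esub> g"
    using assms(1,2) by (simp add: a_minus_def F.M.add.m_ac F.M.l_neg F.M.r_neg)
  then show "f \<in> cl g"
    using cl_memI[of "f \<ominus>\<^bsub>F\<^esub> g" g] assms(3) relators_subset by auto
qed fact

lemma pt_closed: "\<lbrakk>a \<in> carrier A; b \<in> carrier B\<rbrakk> \<Longrightarrow> pt a b \<in> carrier T"
  unfolding pure_tensor_def by (intro cl_closed gen_closed)

lemma pt_bilinear: "bilinear_map K A B T pt"
proof (rule bilinear_mapI)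
  show "pt (a \<oplus>\<^bsub>A\<^esub> a') b = pt a b \<oplus>\<^bsub>T\<^esub> pt a' b"
    if "a \<in> carrier A" "a' \<in> carrier A" "b \<in> carrier B" for a a' b
    unfolding pure_tensor_def cl_add[OF gen_closed[OF that(1,3)] gen_closed[OF that(2,3)]]
    by (rule cl_eqI_diff) (simp_all add: that gen_closed, unfold relators_def, use that in blast)
  show "pt a (b \<oplus>\<^bsub>B\<^esub> b') = pt a b \<oplus>\<^bsub>T\<^esub> pt a b'"
    if "a \<in> carrier A" "b \<in> carrier B" "b' \<in> carrier B" for a b b'
    unfolding pure_tensor_def cl_add[OF gen_closed[OF that(1,2)] gen_closed[OF that(1,3)]]
    by (rule cl_eqI_diff) (simp_all add: that gen_closed, unfold relators_def, use that in blast)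
  show "pt (c \<odot>\<^bsub>A\<^esub> a) b = c \<odot>\<^bsub>T\<^esub> pt a b"
    if "c \<in> carrier K" "a \<in> carrier A" "b \<in> carrier B" for c a b
    unfolding pure_tensor_def cl_smult[OF that(1) gen_closed[OF that(2,3)]]
    by (rule cl_eqI_diff) (simp_all add: that gen_closed, unfold relators_def, use that in blast)
  show "pt a (c \<odot>\<^bsub>B\<^esub> b) = c \<odot>\<^bsub>T\<^esub> pt a b"
    if "c \<in> carrier K" "a \<in> carrier A" "b \<in> carrier B" for c a b
    unfolding pure_tensor_def cl_smult[OF that(1) gen_closed[OF that(2,3)]]
    by (rule cl_eqI_diff) (simp_all add: that gen_closed, unfold relators_def, use that in blast)
qed (rule pt_closed)

text \<open>The classes of the free generators are the pure tensors, so spanning is inherited from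
  the free space along \<open>cl\<close>.\<close>

lemma span_pt: "T.span {pt a b | a b. a \<in> carrier A \<and> b \<in> carrier B} = carrier T"
proof
  let ?S = "{pt a b | a b. a \<in> carrier A \<and> b \<in> carrier B}"
  have S: "?S \<subseteq> carrier T"
    using pt_closed by auto
  show "T.span ?S \<subseteq> carrier T"
    using T.span_is_subset2[OF S] .
  have gens: "free_gen K I ` I \<subseteq> carrier F"
    unfolding tensor_free_def by (auto intro: A.free_gen_closed)
  show "carrier T \<subseteq> T.span ?S"
  proof
    fix t assume "t \<in> carrier T"
    then obtain f where f: "t = cl f" "f \<in> carrier F"
      unfolding carrier_T by blast
    have "f \<in> F.span (free_gen K I ` I)"
      using f(2) span_free_gen[OF A.field_axioms, of I] unfolding tensor_free_def by simp
    then have "cl f \<in> T.span ?S"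
    proof (rule F.module_hom_span_subset[OF T.vectorspace_axioms cl_hom T.span_is_subspace[OF S] gens, rotated])
      fix g assume "g \<in> free_gen K I ` I"
      then obtain a b where "g = gen a b" "a \<in> carrier A" "b \<in> carrier B"
        unfolding tensor_gen_def by auto
      then have "cl g \<in> ?S"
        unfolding pure_tensor_def by blast
      then show "cl g \<in> T.span ?S"
        using T.in_own_span[OF S] by (rule rev_subsetD)
    qed
    then show "t \<in> T.span ?S"
      using f(1) by simp
  qed
qed

lemma module_hom_clI:
  assumes "\<And>f. f \<in> carrier F \<Longrightarrow> h (cl f) \<in> carrier M"
    and "\<And>f g. \<lbrakk>f \<in> carrier F; g \<in> carrier F\<rbrakk> \<Longrightarrow> h (cl (f \<oplus>\<^bsub>F\<^esub> g)) = h (cl f) \<oplus>\<^bsub>M\<^esub> h (cl g)"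
    and "\<And>c f. \<lbrakk>c \<in> carrier K; f \<in> carrier F\<rbrakk> \<Longrightarrow> h (cl (c \<odot>\<^bsub>F\<^esub> f)) = c \<odot>\<^bsub>M\<^esub> h (cl f)"
  shows "h \<in> module_hom K T M"
proof (rule module_homI)
  show "h x \<in> carrier M" if "x \<in> carrier T" for x
    using that assms(1) unfolding carrier_T by auto
  show "h (x \<oplus>\<^bsub>T\<^esub> y) = h x \<oplus>\<^bsub>M\<^esub> h y" if "x \<in> carrier T" "y \<in> carrier T" for x y
    using that assms(2) cl_add unfolding carrier_T by auto
  show "h (c \<odot>\<^bsub>T\<^esub> x) = c \<odot>\<^bsub>M\<^esub> h x" if "c \<in> carrier K" "x \<in> carrier T" for c x
    using that assms(3) cl_smult unfolding carrier_T by auto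
qed

section \<open>The universal property of the tensor product\<close>

context
  fixes M :: "('k, 'c, 'p) module_scheme"
  assumes M: "vectorspace K M"
begin

interpretation M: vectorspace K M by (rule M)

lemma bilinear_map_closed:
  "bilinear_map K A B M \<beta> \<Longrightarrow> case_prod \<beta> \<in> I \<rightarrow> carrier M"
  using bilinear_mapD(1) by fastforce

lemma free_lift_gen_pair:
  assumes "\<beta> \<in> I \<rightarrow> carrier M" "a \<in> carrier A" "b \<in> carrier B"
  shows "free_lift K M I \<beta> (gen a b) = \<beta> (a, b)"
  unfolding tensor_gen_def by (rule M.free_lift_gen) (use assms in auto)

lemma free_lift_hom_F:
  "\<beta> \<in> I \<rightarrow> carrier M \<Longrightarrow> free_lift K M I \<beta> \<in> module_hom K F M"
  unfolding tensor_free_def by (rule M.free_lift_hom)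

text \<open>Each relator expresses one of the bilinearity laws, so the linear extension of a
  bilinear map kills the relators and hence their span.\<close>

lemma free_lift_relations:
  assumes \<beta>: "bilinear_map K A B M \<beta>" and r: "r \<in> R"
  shows "free_lift K M I (case_prod \<beta>) r = \<zero>\<^bsub>M\<^esub>"
proof -
  let ?h = "free_lift K M I (case_prod \<beta>)"
  note car = bilinear_map_closed[OF \<beta>]
  note bil = bilinear_mapD[OF \<beta>]
  note hom = free_lift_hom_F[OF car]
  interpret h: mod_hom K F M ?h
    using hom F.module_axioms M.module_axioms by (simp add: mod_hom_def mod_hom_axioms_def)
  note gen = free_lift_gen_pair[OF car]
  have "(\<lambda>f. \<zero>\<^bsub>M\<^esub>) \<in> module_hom K F M"
    by (rule module_homI) auto
  then show ?thesis
  proof (rule F.module_hom_eq_on_span[OF M.module_axioms hom _ relators_closed])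
    show "?h x = \<zero>\<^bsub>M\<^esub>" if "x \<in> relators" for x
      using that gen_closed bil unfolding relators_def by (auto simp: gen)
    show "r \<in> F.span relators"
      using r by (simp add: relations_eq)
  qed
qed

lemma free_lift_cl_cong:
  assumes \<beta>: "bilinear_map K A B M \<beta>" and f: "f \<in> carrier F" and g: "g \<in> cl f"
  shows "free_lift K M I (case_prod \<beta>) g = free_lift K M I (case_prod \<beta>) f"
proof -
  note hom = free_lift_hom_F[OF bilinear_map_closed[OF \<beta>]]
  obtain r where r: "r \<in> R" "g = r \<oplus>\<^bsub>F\<^esub> f"
    using g by (rule cl_memE)
  have "r \<in> carrier F"
    using subspaceD(1)[OF relations_subspace r(1)] .
  then show ?thesis
    using LinearCombinations.module_hom_add[OF hom _ f, of r] free_lift_relations[OF \<beta> r(1)]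
      module_hom_mem[OF hom f] r(2) by simp
qed

lemma ex_tensor_hom:
  assumes \<beta>: "bilinear_map K A B M \<beta>"
  shows "\<exists>h\<in>module_hom K T M. \<forall>a\<in>carrier A. \<forall>b\<in>carrier B. h (pt a b) = \<beta> a b"
proof -
  \<comment> \<open>Any representative of the coset serves: \<open>free_lift_cl_cong\<close> makes
    the value independent of the choice.\<close>
  define h where "h S = free_lift K M I (case_prod \<beta>) (SOME f. f \<in> S)" for S
  note car = bilinear_map_closed[OF \<beta>]
  note hom = free_lift_hom_F[OF car]
  have h_cl: "h (cl f) = free_lift K M I (case_prod \<beta>) f" if f: "f \<in> carrier F" for f
    unfolding h_def using free_lift_cl_cong[OF \<beta> f] someI[of "\<lambda>g. g \<in> cl f", OF cl_self[OF f]] .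
  have "h \<in> module_hom K T M"
    by (rule module_hom_clI)
      (simp_all add: h_cl module_hom_mem[OF hom]
        LinearCombinations.module_hom_add[OF hom] module_hom_smult[OF hom])
  moreover have "h (pt a b) = \<beta> a b" if "a \<in> carrier A" "b \<in> carrier B" for a b
    unfolding pure_tensor_def using h_cl[OF gen_closed[OF that]] free_lift_gen_pair[OF car that]
    by simp
  ultimately show ?thesis
    by blast
qed

end

text \<open>A linear combination of bilinear maps, with coefficients given by \<open>g\<close>, is
  bilinear. This allows the first argument of an operation to change its representative after the
  second one has been summed.\<close>

lemma bilinear_map_free_lift:
  assumes \<beta>: "\<And>y. y \<in> J \<Longrightarrow> bilinear_map K A B T (\<lambda>a b. \<beta> a b y)"
    and g: "g \<in> carrier (free_space K J)"
  shows "bilinear_map K A B T (\<lambda>a b. free_lift K T J (\<beta> a b) g)"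
proof (rule bilinear_mapI)
  note bil = bilinear_mapD[OF \<beta>]
  have car: "\<beta> a b \<in> J \<rightarrow> carrier T" if "a \<in> carrier A" "b \<in> carrier B" for a b
    using bil(1) that by auto
  show "free_lift K T J (\<beta> a b) g \<in> carrier T" if "a \<in> carrier A" "b \<in> carrier B" for a b
    using T.free_lift_closed[OF car[OF that] g] .
  show "free_lift K T J (\<beta> (a \<oplus>\<^bsub>A\<^esub> a') b) g =
      free_lift K T J (\<beta> a b) g \<oplus>\<^bsub>T\<^esub> free_lift K T J (\<beta> a' b) g"
    if "a \<in> carrier A" "a' \<in> carrier A" "b \<in> carrier B" for a a' b
  proof -
    have "free_lift K T J (\<beta> (a \<oplus>\<^bsub>A\<^esub> a') b) g =
        free_lift K T J (\<lambda>y. \<beta> a b y \<oplus>\<^bsub>T\<^esub> \<beta> a' b y) g"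
      by (rule T.free_lift_cong) (use that bil g in auto)
    then show ?thesis
      using T.free_lift_add[OF car car g] that by simp
  qed
  show "free_lift K T J (\<beta> a (b \<oplus>\<^bsub>B\<^esub> b')) g =
      free_lift K T J (\<beta> a b) g \<oplus>\<^bsub>T\<^esub> free_lift K T J (\<beta> a b') g"
    if "a \<in> carrier A" "b \<in> carrier B" "b' \<in> carrier B" for a b b'
  proof -
    have "free_lift K T J (\<beta> a (b \<oplus>\<^bsub>B\<^esub> b')) g =
        free_lift K T J (\<lambda>y. \<beta> a b y \<oplus>\<^bsub>T\<^esub> \<beta> a b' y) g"
      by (rule T.free_lift_cong) (use that bil g in auto)
    then show ?thesis
      using T.free_lift_add[OF car car g] that by simp
  qed
  show "free_lift K T J (\<beta> (c \<odot>\<^bsub>A\<^esub> a) b) g = c \<odot>\<^bsub>T\<^esub> free_lift K T J (\<beta> a b) g"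
    if "c \<in> carrier K" "a \<in> carrier A" "b \<in> carrier B" for c a b
  proof -
    have "free_lift K T J (\<beta> (c \<odot>\<^bsub>A\<^esub> a) b) g = free_lift K T J (\<lambda>y. c \<odot>\<^bsub>T\<^esub> \<beta> a b y) g"
      by (rule T.free_lift_cong) (use that bil g in auto)
    then show ?thesis
      using T.free_lift_smult[OF car g] that by simp
  qed
  show "free_lift K T J (\<beta> a (c \<odot>\<^bsub>B\<^esub> b)) g = c \<odot>\<^bsub>T\<^esub> free_lift K T J (\<beta> a b) g"
    if "c \<in> carrier K" "a \<in> carrier A" "b \<in> carrier B" for c a b
  proof -
    have "free_lift K T J (\<beta> a (c \<odot>\<^bsub>B\<^esub> b)) g = free_lift K T J (\<lambda>y. c \<odot>\<^bsub>T\<^esub> \<beta> a b y) g"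
      by (rule T.free_lift_cong) (use that bil g in auto)
    then show ?thesis
      using T.free_lift_smult[OF car g] that by simp
  qed
qed

text \<open>Pulling \<open>f x\<close> out of the inner sum turns the double sum of
  \<open>bilinear_ext\<close> into two nested linear extensions, so that the arguments can be
  treated one at a time.\<close>

lemma bilinear_ext_eq:
  assumes \<phi>: "\<And>x y. \<lbrakk>x \<in> I; y \<in> I\<rbrakk> \<Longrightarrow> \<phi> x y \<in> carrier F"
    and f: "f \<in> carrier F" and g: "g \<in> carrier F"
  shows "bilinear_ext K I \<phi> f g \<in> carrier F"
    and "cl (bilinear_ext K I \<phi> f g) =
      free_lift K T I (\<lambda>x. free_lift K T I (\<lambda>y. cl (\<phi> x y)) g) f"
proof -
  have f': "f \<in> carrier (free_space K I)" and g': "g \<in> carrier (free_space K I)"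
    using f g unfolding tensor_free_def by auto
  have mem: "f x \<in> carrier K" "g x \<in> carrier K" if "x \<in> I" for x
    using f' g' that by (auto simp: carrier_free_space)
  have fin: "finite {y \<in> I. g y \<noteq> \<zero>\<^bsub>K\<^esub>}"
    using g' by (auto simp: carrier_free_space)
  have \<phi>x: "\<phi> x \<in> I \<rightarrow> carrier F" if "x \<in> I" for x
    using \<phi> that by auto
  have inner: "(\<Oplus>\<^bsub>F\<^esub>y\<in>{y \<in> I. g y \<noteq> \<zero>\<^bsub>K\<^esub>}. (f x \<otimes>\<^bsub>K\<^esub> g y) \<odot>\<^bsub>F\<^esub> \<phi> x y) =
      f x \<odot>\<^bsub>F\<^esub> free_lift K F I (\<phi> x) g" if x: "x \<in> I" for x
  proof -
    have "(\<Oplus>\<^bsub>F\<^esub>y\<in>{y \<in> I. g y \<noteq> \<zero>\<^bsub>K\<^esub>}. (f x \<otimes>\<^bsub>K\<^esub> g y) \<odot>\<^bsub>F\<^esub> \<phi> x y) =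
        (\<Oplus>\<^bsub>F\<^esub>y\<in>{y \<in> I. g y \<noteq> \<zero>\<^bsub>K\<^esub>}. f x \<odot>\<^bsub>F\<^esub> (g y \<odot>\<^bsub>F\<^esub> \<phi> x y))"
      using mem x \<phi> by (intro F.M.finsum_cong') (auto simp: F.smult_assoc1)
    also have "\<dots> = f x \<odot>\<^bsub>F\<^esub> (\<Oplus>\<^bsub>F\<^esub>y\<in>{y \<in> I. g y \<noteq> \<zero>\<^bsub>K\<^esub>}. g y \<odot>\<^bsub>F\<^esub> \<phi> x y)"
      using fin mem x \<phi> by (intro F.finsum_smult_ldistr[symmetric]) auto
    finally show ?thesis
      unfolding free_lift_def .
  qed
  have car: "(\<lambda>x. free_lift K F I (\<phi> x) g) \<in> I \<rightarrow> carrier F"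
    using F.free_lift_closed[OF \<phi>x g'] by auto
  have eq: "bilinear_ext K I \<phi> f g = free_lift K F I (\<lambda>x. free_lift K F I (\<phi> x) g) f"
    unfolding bilinear_ext_def free_lift_def[of K F I "\<lambda>x. free_lift K F I (\<phi> x) g"]
      tensor_free_def[symmetric]
    using mem inner car by (intro F.M.finsum_cong') auto
  show "bilinear_ext K I \<phi> f g \<in> carrier F"
    unfolding eq using F.free_lift_closed[OF car f'] .
  have "cl (free_lift K F I (\<lambda>x. free_lift K F I (\<phi> x) g) f) =
      free_lift K T I (\<lambda>x. cl (free_lift K F I (\<phi> x) g)) f"
    by (rule module_hom_free_lift[OF F.vectorspace_axioms T.vectorspace_axioms cl_hom car f'])
  also have "\<dots> = free_lift K T I (\<lambda>x. free_lift K T I (\<lambda>y. cl (\<phi> x y)) g) f"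
  proof (rule T.free_lift_cong[OF _ _ f'])
    show "cl (free_lift K F I (\<phi> x) g) = free_lift K T I (\<lambda>y. cl (\<phi> x y)) g" if "x \<in> I" for x
      by (rule module_hom_free_lift[OF F.vectorspace_axioms T.vectorspace_axioms cl_hom \<phi>x[OF that] g'])
    show "(\<lambda>x. free_lift K T I (\<lambda>y. cl (\<phi> x y)) g) \<in> I \<rightarrow> carrier T"
      using \<phi> cl_closed by (intro Pi_I T.free_lift_closed g') auto
  qed
  finally show "cl (bilinear_ext K I \<phi> f g) =
      free_lift K T I (\<lambda>x. free_lift K T I (\<lambda>y. cl (\<phi> x y)) g) f"
    unfolding eq .
qed

section \<open>Operations on cosets induced by maps on pairs of generators\<close>

context
  fixes \<phi> :: "'a \<times> 'b \<Rightarrow> 'a \<times> 'b \<Rightarrow> 'a \<times> 'b \<Rightarrow> 'k"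
  assumes \<phi>_closed: "\<And>x y. \<lbrakk>x \<in> I; y \<in> I\<rbrakk> \<Longrightarrow> \<phi> x y \<in> carrier F"
    and \<phi>_left: "\<And>y. y \<in> I \<Longrightarrow> bilinear_map K A B T (\<lambda>a b. cl (\<phi> (a, b) y))"
    and \<phi>_right: "\<And>x. x \<in> I \<Longrightarrow> bilinear_map K A B T (\<lambda>a b. cl (\<phi> x (a, b)))"
begin

lemma \<phi>_mem: "x \<in> I \<Longrightarrow> (\<lambda>y. cl (\<phi> x y)) \<in> I \<rightarrow> carrier T"
  using \<phi>_closed cl_closed by auto

text \<open>The union in \<open>tensor_lift\<close> collapses to one coset: bilinearity in the
  second pair lets \<open>g'\<close> be replaced by \<open>g\<close> inside the sum, and bilinearity
  in the first pair lets \<open>f'\<close> be replaced by \<open>f\<close> outside.\<close>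

lemma tensor_lift_cl:
  assumes f: "f \<in> carrier F" and g: "g \<in> carrier F"
  shows "tensor_lift K A B \<phi> (cl f) (cl g) =
    free_lift K T I (\<lambda>x. free_lift K T I (\<lambda>y. cl (\<phi> x y)) g) f"
    (is "_ = ?Q f g")
proof -
  have inner: "free_lift K T I (\<lambda>y. cl (\<phi> x y)) g' = free_lift K T I (\<lambda>y. cl (\<phi> x y)) g"
    if "x \<in> I" "g' \<in> cl g" for x g'
    using free_lift_cl_cong[OF T.vectorspace_axioms \<phi>_right g that(2)] that(1)
    by (simp add: case_prod_unfold)
  have outer: "?Q f' g = ?Q f g" if "f' \<in> cl f" for f'
  proof -
    have "bilinear_map K A B T (\<lambda>a b. free_lift K T I (\<lambda>y. cl (\<phi> (a, b) y)) g)"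
      by (rule bilinear_map_free_lift) (use \<phi>_left g in \<open>auto simp: tensor_free_def\<close>)
    from free_lift_cl_cong[OF T.vectorspace_axioms this f that] show ?thesis
      by (simp add: case_prod_unfold)
  qed
  have "cl (bilinear_ext K I \<phi> f' g') = ?Q f g" if "f' \<in> cl f" "g' \<in> cl g" for f' g'
  proof -
    have f': "f' \<in> carrier F" and g': "g' \<in> carrier F"
      using cl_mem f g that by auto
    have "cl (bilinear_ext K I \<phi> f' g') = ?Q f' g'"
      using bilinear_ext_eq(2)[OF \<phi>_closed f' g'] .
    also have "\<dots> = ?Q f' g"
    proof (rule T.free_lift_cong)
      show "f' \<in> carrier (free_space K I)"
        using f' unfolding tensor_free_def .
      show "(\<lambda>x. free_lift K T I (\<lambda>y. cl (\<phi> x y)) g) \<in> I \<rightarrow> carrier T"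
        using g unfolding tensor_free_def by (intro Pi_I T.free_lift_closed \<phi>_mem)
    qed (rule inner[OF _ that(2)])
    finally show ?thesis
      using outer[OF that(1)] by simp
  qed
  then have "tensor_lift K A B \<phi> (cl f) (cl g) = (\<Union>f'\<in>cl f. \<Union>g'\<in>cl g. ?Q f g)"
    unfolding tensor_lift_def by auto
  \<comment> \<open>Both index cosets are nonempty; a union of a constant over an empty set would be
    empty.\<close>
  then show ?thesis
    using cl_self[OF f] cl_self[OF g] by auto
qed

lemma outer_mem:
  "g \<in> carrier F \<Longrightarrow> (\<lambda>x. free_lift K T I (\<lambda>y. cl (\<phi> x y)) g) \<in> I \<rightarrow> carrier T"
  unfolding tensor_free_def by (intro Pi_I T.free_lift_closed \<phi>_mem)

lemma tensor_lift_hom_left: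
  assumes "S' \<in> carrier T"
  shows "(\<lambda>S. tensor_lift K A B \<phi> S S') \<in> module_hom K T T"
proof -
  obtain g where g: "S' = cl g" "g \<in> carrier F"
    using assms unfolding carrier_T by blast
  note hom = free_lift_hom_F[OF T.vectorspace_axioms outer_mem[OF g(2)]]
  show ?thesis
    unfolding g(1)
    by (rule module_hom_clI)
      (simp_all add: tensor_lift_cl g(2) module_hom_mem[OF hom]
        LinearCombinations.module_hom_add[OF hom] module_hom_smult[OF hom])
qed

text \<open>The second argument sits inside the sum over the support of \<open>f\<close>. Linearity
  holds for each inner extension and is carried through the outer one by
  \<open>free_lift_add\<close> and \<open>free_lift_smult\<close>.\<close>

lemma tensor_lift_hom_right:
  assumes "S \<in> carrier T"
  shows "(\<lambda>S'. tensor_lift K A B \<phi> S S') \<in> module_hom K T T"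
proof -
  obtain f where f: "S = cl f" "f \<in> carrier F"
    using assms unfolding carrier_T by blast
  have f': "f \<in> carrier (free_space K I)"
    using f(2) unfolding tensor_free_def .
  note hom = free_lift_hom_F[OF T.vectorspace_axioms \<phi>_mem]
  let ?G = "\<lambda>x. free_lift K T I (\<lambda>y. cl (\<phi> x y))"
  have add: "free_lift K T I (\<lambda>x. ?G x (g \<oplus>\<^bsub>F\<^esub> g')) f =
      free_lift K T I (\<lambda>x. ?G x g) f \<oplus>\<^bsub>T\<^esub> free_lift K T I (\<lambda>x. ?G x g') f"
    if g: "g \<in> carrier F" and g': "g' \<in> carrier F" for g g'
  proof -
    have "free_lift K T I (\<lambda>x. ?G x (g \<oplus>\<^bsub>F\<^esub> g')) f =
        free_lift K T I (\<lambda>x. ?G x g \<oplus>\<^bsub>T\<^esub> ?G x g') f"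
    proof (rule T.free_lift_cong[OF _ _ f'])
      show "?G x (g \<oplus>\<^bsub>F\<^esub> g') = ?G x g \<oplus>\<^bsub>T\<^esub> ?G x g'" if "x \<in> I" for x
        using LinearCombinations.module_hom_add[OF hom[OF that] g g'] .
      show "(\<lambda>x. ?G x g \<oplus>\<^bsub>T\<^esub> ?G x g') \<in> I \<rightarrow> carrier T"
        using module_hom_mem[OF hom g] module_hom_mem[OF hom g'] by (intro Pi_I T.M.a_closed)
    qed
    then show ?thesis
      using T.free_lift_add[OF outer_mem[OF g] outer_mem[OF g'] f'] by simp
  qed
  have smult: "free_lift K T I (\<lambda>x. ?G x (c \<odot>\<^bsub>F\<^esub> g)) f = c \<odot>\<^bsub>T\<^esub> free_lift K T I (\<lambda>x. ?G x g) f"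
    if c: "c \<in> carrier K" and g: "g \<in> carrier F" for c g
  proof -
    have "free_lift K T I (\<lambda>x. ?G x (c \<odot>\<^bsub>F\<^esub> g)) f = free_lift K T I (\<lambda>x. c \<odot>\<^bsub>T\<^esub> ?G x g) f"
    proof (rule T.free_lift_cong[OF _ _ f'])
      show "?G x (c \<odot>\<^bsub>F\<^esub> g) = c \<odot>\<^bsub>T\<^esub> ?G x g" if "x \<in> I" for x
        using module_hom_smult[OF hom[OF that] c g] .
      show "(\<lambda>x. c \<odot>\<^bsub>T\<^esub> ?G x g) \<in> I \<rightarrow> carrier T"
        using module_hom_mem[OF hom g] c by (intro Pi_I T.smult_closed)
    qed
    then show ?thesis
      using T.free_lift_smult[OF outer_mem[OF g] f' c] by simp
  qed
  show ?thesis
    unfolding f(1)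
    by (rule module_hom_clI)
      (simp_all add: tensor_lift_cl f(2) add smult T.free_lift_closed[OF outer_mem f'])
qed

lemma tensor_lift_pt:
  assumes "a \<in> carrier A" "b \<in> carrier B" "a' \<in> carrier A" "b' \<in> carrier B"
  shows "tensor_lift K A B \<phi> (pt a b) (pt a' b') = cl (\<phi> (a, b) (a', b'))"
proof -
  note g = gen_closed[OF assms(1,2)] gen_closed[OF assms(3,4)]
  have "tensor_lift K A B \<phi> (pt a b) (pt a' b') =
      free_lift K T I (\<lambda>y. cl (\<phi> (a, b) y)) (gen a' b')"
    unfolding pure_tensor_def tensor_lift_cl[OF g]
    by (rule free_lift_gen_pair[OF T.vectorspace_axioms outer_mem[OF g(2)] assms(1,2)])
  also have "\<dots> = cl (\<phi> (a, b) (a', b'))"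
    by (rule free_lift_gen_pair[OF T.vectorspace_axioms \<phi>_mem]) (use assms in auto)
  finally show ?thesis .
qed

end

end

section \<open>Contractions\<close>

text \<open>Abstracts from the order of the factors, so that statements about left factors can be
  instantiated a second time with the factors exchanged. The space \<open>T\<close> only has to
  receive a bilinear map and to admit a contraction for every functional on
  \<open>W\<close>.\<close>

locale contractible_tensor =
  V: vectorspace K V + W: vectorspace K W + T: vectorspace K T
  for K :: "('k, 'm) ring_scheme"
    and V :: "('k, 'a, 'n) poisson_scheme" and W :: "('k, 'b, 'l) poisson_scheme"
    and T :: "('k, 'c, 'p) poisson_scheme" +
  fixes t :: "'a \<Rightarrow> 'b \<Rightarrow> 'c"
  assumes t_bilinear: "bilinear_map K V W T t"
    and ex_contraction: "\<phi> \<in> dual_space K W \<Longrightarrow>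
      \<exists>h\<in>module_hom K T V. \<forall>v\<in>carrier V. \<forall>w\<in>carrier W. h (t v w) = \<phi> w \<odot>\<^bsub>V\<^esub> v"
begin

text \<open>A choice among the linear maps with the prescribed values on tensors; for functionals on
  \<open>W\<close> such maps exist by the locale assumption, and later arguments rest on linearity
  and these values.\<close>

definition contraction :: "('b \<Rightarrow> 'k) \<Rightarrow> 'c \<Rightarrow> 'a" where
  "contraction \<phi> = (SOME h. h \<in> module_hom K T V \<and>
     (\<forall>v\<in>carrier V. \<forall>w\<in>carrier W. h (t v w) = \<phi> w \<odot>\<^bsub>V\<^esub> v))"

definition tensors :: "'a set \<Rightarrow> 'b set \<Rightarrow> 'c set" where
  "tensors S S' = {t v w | v w. v \<in> S \<and> w \<in> S'}"

lemma contraction: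
  assumes "\<phi> \<in> dual_space K W"
  shows contraction_hom: "contraction \<phi> \<in> module_hom K T V"
    and contraction_t: "\<lbrakk>v \<in> carrier V; w \<in> carrier W\<rbrakk> \<Longrightarrow>
      contraction \<phi> (t v w) = \<phi> w \<odot>\<^bsub>V\<^esub> v"
proof -
  have "\<exists>h. h \<in> module_hom K T V \<and>
     (\<forall>v\<in>carrier V. \<forall>w\<in>carrier W. h (t v w) = \<phi> w \<odot>\<^bsub>V\<^esub> v)"
    using ex_contraction[OF assms] by blast
  from someI_ex[OF this] have "contraction \<phi> \<in> module_hom K T V \<and>
     (\<forall>v\<in>carrier V. \<forall>w\<in>carrier W. contraction \<phi> (t v w) = \<phi> w \<odot>\<^bsub>V\<^esub> v)"
    unfolding contraction_def .
  then show "contraction \<phi> \<in> module_hom K T V"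
    "\<lbrakk>v \<in> carrier V; w \<in> carrier W\<rbrakk> \<Longrightarrow> contraction \<phi> (t v w) = \<phi> w \<odot>\<^bsub>V\<^esub> v"
    by auto
qed

lemma t_closed: "\<lbrakk>v \<in> carrier V; w \<in> carrier W\<rbrakk> \<Longrightarrow> t v w \<in> carrier T"
  using bilinear_mapD(1)[OF t_bilinear] .

lemma tensors_closed: "\<lbrakk>S \<subseteq> carrier V; S' \<subseteq> carrier W\<rbrakk> \<Longrightarrow> tensors S S' \<subseteq> carrier T"
  unfolding tensors_def using t_closed by auto

lemma tensors_mono: "\<lbrakk>S \<subseteq> S1; S' \<subseteq> S1'\<rbrakk> \<Longrightarrow> T.span (tensors S S') \<subseteq> T.span (tensors S1 S1')"
  by (rule T.span_is_monotone) (auto simp: tensors_def)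

lemma t_hom_left: "w \<in> carrier W \<Longrightarrow> (\<lambda>v. t v w) \<in> module_hom K V T"
  and t_hom_right: "v \<in> carrier V \<Longrightarrow> t v \<in> module_hom K W T"
  using t_bilinear unfolding bilinear_map_def by auto

text \<open>Serves to discard a right factor that depends linearly on the others.\<close>

lemma tensors_span_right:
  assumes v: "v \<in> S" "S \<subseteq> carrier V" and S': "S' \<subseteq> carrier W" and w: "w \<in> W.span S'"
  shows "t v w \<in> T.span (tensors S S')"
proof (rule W.module_hom_span_subset[OF T.vectorspace_axioms t_hom_right _ S' _ w])
  have "tensors S S' \<subseteq> carrier T"
    using tensors_closed v S' by simp
  then show "VectorSpace.subspace K (T.span (tensors S S')) T"
    by (rule T.span_is_subspace)
  show "t v x \<in> T.span (tensors S S')" if "x \<in> S'" for x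
    using T.in_own_span[OF \<open>tensors S S' \<subseteq> carrier T\<close>] v(1) that by (auto simp: tensors_def)
qed (use v in auto)

text \<open>A contraction turns right factors into scalars, so it returns combinations of the left
  factors, whatever the functional. This uniformity in \<phi> is what bounds the contracted
  orbits.\<close>

lemma contraction_span_tensors:
  assumes \<phi>: "\<phi> \<in> dual_space K W" and S: "S \<subseteq> carrier V" "S' \<subseteq> carrier W"
    and u: "u \<in> T.span (tensors S S')"
  shows "contraction \<phi> u \<in> V.span S"
proof (rule T.module_hom_span_subset[OF V.vectorspace_axioms contraction_hom[OF \<phi>]
      V.span_is_subspace[OF S(1)] tensors_closed[OF S] _ u])
  fix x assume "x \<in> tensors S S'"
  then obtain v w where x: "x = t v w" "v \<in> S" "w \<in> S'"
    unfolding tensors_def by blast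
  then have vw: "v \<in> carrier V" "w \<in> carrier W" "v \<in> V.span S"
    using S V.in_own_span[OF S(1)] by auto
  show "contraction \<phi> x \<in> V.span S"
    unfolding x(1) contraction_t[OF \<phi> vw(1,2)]
    using subspaceD(4)[OF V.span_is_subspace[OF S(1)] dual_spaceD(1)[OF \<phi> vw(2)] vw(3)] .
qed

text \<open>Induction on a finite set carrying the right-hand tensor factors: a factor \<open>y\<close> outside the
  span of the others is split off by a functional that isolates its coefficient, which
  therefore lies in \<open>N\<close>.\<close>

lemma mem_span_tensors_if_contractions:
  assumes N: "VectorSpace.subspace K N V"
    and "finite Y" "Y \<subseteq> carrier W" "u \<in> T.span (tensors (carrier V) Y)"
    and "\<And>\<phi>. \<phi> \<in> dual_space K W \<Longrightarrow> contraction \<phi> u \<in> N"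
  shows "u \<in> T.span (tensors N Y)"
  using assms(2-)
proof (induction Y arbitrary: u rule: finite_induct)
  case empty
  then show ?case by (simp add: tensors_def)
next
  case (insert y Y)
  have y: "y \<in> carrier W" and Y: "Y \<subseteq> carrier W"
    using insert.prems(1) by auto
  have NV: "N \<subseteq> carrier V"
    using subspaceD(1)[OF N] by blast
  note car = tensors_closed[OF subset_refl Y] tensors_closed[OF NV Y]
    tensors_closed[OF NV insert.prems(1)] tensors_closed[OF subset_refl insert.prems(1)]
  note sub = T.span_is_subspace[OF car(1)] T.span_is_subspace[OF car(3)]
  \<comment> \<open>The vectors of the form \<open>t v y\<close> plus an element of the span over
    \<open>Y\<close> are closed under the linear operations and include all generating tensors, so
    \<open>u\<close> has this form.\<close>
  have "\<exists>v\<in>carrier V. u \<ominus>\<^bsub>T\<^esub> t v y \<in> T.span (tensors (carrier V) Y)"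
  proof -
    let ?M = "{u \<in> carrier T. \<exists>v\<in>carrier V. u \<ominus>\<^bsub>T\<^esub> t v y \<in> T.span (tensors (carrier V) Y)}"
    have M: "x \<in> ?M" if "x \<in> carrier T" "v \<in> carrier V"
      "x \<ominus>\<^bsub>T\<^esub> t v y \<in> T.span (tensors (carrier V) Y)" for x v
      using that by blast
    have t0: "t \<zero>\<^bsub>V\<^esub> y = \<zero>\<^bsub>T\<^esub>"
      using module_hom_zero[OF t_hom_left[OF y] V.module_axioms T.module_axioms] .
    note bil = bilinear_mapD[OF t_bilinear]
    have "VectorSpace.subspace K ?M T"
    proof (rule T.subspaceI)
      show "?M \<subseteq> carrier T" by blast
      show "\<zero>\<^bsub>T\<^esub> \<in> ?M"
        using M[OF T.M.zero_closed V.M.zero_closed] subspaceD(2)[OF sub(1)] t0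
        by (simp add: T.M.minus_zero_right)
      show "x \<oplus>\<^bsub>T\<^esub> x' \<in> ?M" if xx': "x \<in> ?M" "x' \<in> ?M" for x x'
      proof -
        obtain v v' where *: "x \<in> carrier T" "v \<in> carrier V" "x' \<in> carrier T" "v' \<in> carrier V"
          "x \<ominus>\<^bsub>T\<^esub> t v y \<in> T.span (tensors (carrier V) Y)"
          "x' \<ominus>\<^bsub>T\<^esub> t v' y \<in> T.span (tensors (carrier V) Y)"
          using xx' by blast
        have "(x \<ominus>\<^bsub>T\<^esub> t v y) \<oplus>\<^bsub>T\<^esub> (x' \<ominus>\<^bsub>T\<^esub> t v' y) =
            (x \<oplus>\<^bsub>T\<^esub> x') \<ominus>\<^bsub>T\<^esub> t (v \<oplus>\<^bsub>V\<^esub> v') y"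
          using * y by (simp add: bil t_closed a_minus_def T.M.minus_add T.M.add.m_ac)
        then show ?thesis
          using subspaceD(3)[OF sub(1) *(5,6)] * by (intro M[of _ "v \<oplus>\<^bsub>V\<^esub> v'"]) auto
      qed
      show "c \<odot>\<^bsub>T\<^esub> x \<in> ?M" if c: "c \<in> carrier K" and x: "x \<in> ?M" for c x
      proof -
        obtain v where *: "x \<in> carrier T" "v \<in> carrier V"
          "x \<ominus>\<^bsub>T\<^esub> t v y \<in> T.span (tensors (carrier V) Y)"
          using x by blast
        have "c \<odot>\<^bsub>T\<^esub> (x \<ominus>\<^bsub>T\<^esub> t v y) = c \<odot>\<^bsub>T\<^esub> x \<ominus>\<^bsub>T\<^esub> t (c \<odot>\<^bsub>V\<^esub> v) y"
          using * y c by (simp add: bil t_closed a_minus_def T.smult_r_distr T.smult_r_minus)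
        then show ?thesis
          using subspaceD(4)[OF sub(1) c *(3)] * c by (intro M[of _ "c \<odot>\<^bsub>V\<^esub> v"]) auto
      qed
    qed
    moreover have "tensors (carrier V) (insert y Y) \<subseteq> ?M"
    proof
      fix x assume "x \<in> tensors (carrier V) (insert y Y)"
      then obtain v w where x: "x = t v w" "v \<in> carrier V" "w \<in> insert y Y"
        unfolding tensors_def by blast
      show "x \<in> ?M"
      proof (cases "w = y")
        case True
        have "x \<ominus>\<^bsub>T\<^esub> t v y \<in> T.span (tensors (carrier V) Y)"
          using x True t_closed[OF x(2) y] subspaceD(2)[OF sub(1)]
          by (simp add: a_minus_def T.M.r_neg)
        then show ?thesis
          using x True t_closed[OF x(2) y] by (intro M[of _ v]) auto
      next
        case False
        then have "x \<in> tensors (carrier V) Y"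
          using x unfolding tensors_def by blast
        then have "x \<in> carrier T" "x \<in> T.span (tensors (carrier V) Y)"
          using car(1) T.in_own_span[OF car(1)] by auto
        then show ?thesis
          using t0 by (intro M[of _ "\<zero>\<^bsub>V\<^esub>"]) (simp_all add: T.M.minus_zero_right)
      qed
    qed
    ultimately have "u \<in> ?M"
      using T.span_subset_subspace insert.prems(2) by blast
    then show ?thesis by blast
  qed
  then obtain v where v: "v \<in> carrier V" and uv: "u \<ominus>\<^bsub>T\<^esub> t v y \<in> T.span (tensors (carrier V) Y)"
    by blast
  have u: "u \<in> carrier T"
    using subspaceD(1)[OF T.span_is_subspace[OF car(4)] insert.prems(2)] .
  have u_eq: "(u \<ominus>\<^bsub>T\<^esub> t v y) \<oplus>\<^bsub>T\<^esub> t v y = u"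
    using u t_closed[OF v y] by (simp add: a_minus_def T.M.add.m_ac T.M.l_neg T.M.r_neg)
  show ?case
  proof (cases "y \<in> W.span Y")
    case True
    have "t v y \<in> T.span (tensors (carrier V) Y)"
      by (rule tensors_span_right[OF v subset_refl Y True])
    then have "u \<in> T.span (tensors (carrier V) Y)"
      using subspaceD(3)[OF sub(1) uv, of "t v y"] u_eq by simp
    then have "u \<in> T.span (tensors N Y)"
      using insert.IH[OF Y] insert.prems(3) by simp
    then show ?thesis
      using tensors_mono[OF subset_refl subset_insertI] by (rule rev_subsetD)
  next
    case False
    obtain \<phi> where \<phi>: "\<phi> \<in> dual_space K W" "\<And>w. w \<in> W.span Y \<Longrightarrow> \<phi> w = \<zero>\<^bsub>K\<^esub>" "\<phi> y = \<one>\<^bsub>K\<^esub>"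
      using W.separating_functional[OF W.span_is_subspace[OF Y] y False] by blast
    note hom = contraction_hom[OF \<phi>(1)]
    have zero: "contraction \<phi> x = \<zero>\<^bsub>V\<^esub>" if "x \<in> T.span (tensors (carrier V) Y)" for x
    proof (rule T.module_hom_eq_on_span[OF V.module_axioms hom _ car(1) _ that])
      show "(\<lambda>x. \<zero>\<^bsub>V\<^esub>) \<in> module_hom K T V"
        by (rule module_homI) auto
      fix x assume "x \<in> tensors (carrier V) Y"
      then obtain v' w where x: "x = t v' w" "v' \<in> carrier V" "w \<in> Y"
        unfolding tensors_def by blast
      then have "w \<in> carrier W" "w \<in> W.span Y"
        using Y W.in_own_span[OF Y] by auto
      then show "contraction \<phi> x = \<zero>\<^bsub>V\<^esub>"
        using contraction_t[OF \<phi>(1) x(2)] \<phi>(2) x by simp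
    qed
    have "contraction \<phi> u = contraction \<phi> (u \<ominus>\<^bsub>T\<^esub> t v y) \<oplus>\<^bsub>V\<^esub> contraction \<phi> (t v y)"
      using LinearCombinations.module_hom_add[OF hom _ t_closed[OF v y], of "u \<ominus>\<^bsub>T\<^esub> t v y"] u_eq u
        t_closed[OF v y] by simp
    also have "\<dots> = v"
      using zero[OF uv] contraction_t[OF \<phi>(1) v y] \<phi>(3) v by simp
    finally have vN: "v \<in> N"
      using insert.prems(3)[OF \<phi>(1)] by simp
    \<comment> \<open>As \<open>v\<close> lies in \<open>N\<close>, removing \<open>t v y\<close>
      changes each contraction by a multiple of \<open>v\<close>, so the hypothesis on contractions
      persists.\<close>
    have "u \<ominus>\<^bsub>T\<^esub> t v y \<in> T.span (tensors N Y)"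
    proof (rule insert.IH[OF Y uv])
      fix \<psi> assume \<psi>: "\<psi> \<in> dual_space K W"
      note hom' = contraction_hom[OF \<psi>]
      have "contraction \<psi> u = contraction \<psi> (u \<ominus>\<^bsub>T\<^esub> t v y) \<oplus>\<^bsub>V\<^esub> contraction \<psi> (t v y)"
        using LinearCombinations.module_hom_add[OF hom' _ t_closed[OF v y], of "u \<ominus>\<^bsub>T\<^esub> t v y"] u_eq u
          t_closed[OF v y] by simp
      then have "contraction \<psi> (u \<ominus>\<^bsub>T\<^esub> t v y) = contraction \<psi> u \<ominus>\<^bsub>V\<^esub> \<psi> y \<odot>\<^bsub>V\<^esub> v"
        using contraction_t[OF \<psi> v y] module_hom_mem[OF hom', of "u \<ominus>\<^bsub>T\<^esub> t v y"] u v
          t_closed[OF v y] dual_spaceD(1)[OF \<psi> y]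
        by (simp add: a_minus_def V.M.add.m_ac V.M.r_neg V.M.r_neg1 V.M.r_neg2)
      moreover have "\<psi> y \<odot>\<^bsub>V\<^esub> v \<in> N"
        using subspaceD(4)[OF N dual_spaceD(1)[OF \<psi> y] vN] .
      ultimately show "contraction \<psi> (u \<ominus>\<^bsub>T\<^esub> t v y) \<in> N"
        using V.subspace_minus[OF N insert.prems(3)[OF \<psi>]] by simp
    qed
    then have "u \<ominus>\<^bsub>T\<^esub> t v y \<in> T.span (tensors N (insert y Y))"
      using tensors_mono[OF subset_refl subset_insertI] by (rule rev_subsetD)
    moreover have "t v y \<in> T.span (tensors N (insert y Y))"
      using T.in_own_span[OF car(3)] vN by (auto simp: tensors_def)
    ultimately show ?thesis
      using subspaceD(3)[OF sub(2), of "u \<ominus>\<^bsub>T\<^esub> t v y" "t v y"] u_eq by simp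
  qed
qed

text \<open>Finitely many vectors are combinations of finitely many tensors, and the factors of
  these are again finite in number.\<close>

lemma finite_support:
  assumes "finite U" "U \<subseteq> T.span (tensors S S')"
  shows "\<exists>X0 Y. finite X0 \<and> finite Y \<and> X0 \<subseteq> S \<and> Y \<subseteq> S' \<and> U \<subseteq> T.span (tensors X0 Y)"
proof -
  obtain E where E: "E \<subseteq> tensors S S'" "finite E" "U \<subseteq> T.span E"
    using T.finite_subset_span[OF assms] by blast
  have "\<forall>e\<in>E. \<exists>p. fst p \<in> S \<and> snd p \<in> S' \<and> e = t (fst p) (snd p)"
    using E(1) unfolding tensors_def by fastforce
  then obtain p where p: "\<And>e. e \<in> E \<Longrightarrow> fst (p e) \<in> S \<and> snd (p e) \<in> S' \<and> e = t (fst (p e)) (snd (p e))"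
    by metis
  define X0 where "X0 = (\<lambda>e. fst (p e)) ` E"
  define Y where "Y = (\<lambda>e. snd (p e)) ` E"
  have "E \<subseteq> tensors X0 Y"
    using p unfolding tensors_def X0_def Y_def by blast
  then have "U \<subseteq> T.span (tensors X0 Y)"
    using E(3) T.span_is_monotone by blast
  moreover have "finite X0" "finite Y" "X0 \<subseteq> S" "Y \<subseteq> S'"
    using E(2) p unfolding X0_def Y_def by auto
  ultimately show ?thesis by blast
qed

end

section \<open>Contractions and adjoint maps\<close>

context contractible_tensor
begin

text \<open>Both sides are linear in \<open>u\<close>, so tensors \<open>t v w\<close> suffice:
  contracting \<open>ad T g (t v w)\<close> gives \<open>\<phi> w\<close> times
  \<open>ad V z1 v\<close> plus \<open>\<phi> (ad W z2 w)\<close> times \<open>v\<close>, and the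
  second term is the one subtracted.\<close>

lemma contraction_intertwines:
  assumes span: "T.span (tensors (carrier V) (carrier W)) = carrier T"
    and V: "ad_linear K V z1" and W: "ad_linear K W z2" and T: "ad_linear K T g"
    and ad_t: "\<And>v w. \<lbrakk>v \<in> carrier V; w \<in> carrier W\<rbrakk> \<Longrightarrow>
      ad T g (t v w) = t (ad V z1 v) w \<oplus>\<^bsub>T\<^esub> t v (ad W z2 w)"
    and \<phi>: "\<phi> \<in> dual_space K W" and u: "u \<in> carrier T"
  shows "ad V z1 (contraction \<phi> u) =
    contraction \<phi> (ad T g u) \<ominus>\<^bsub>V\<^esub> contraction (\<lambda>w. \<phi> (ad W z2 w)) u"
proof -
  interpret V1: ad_linear K V z1 by fact
  interpret W2: ad_linear K W z2 by fact
  interpret Tg: ad_linear K T g by fact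
  have \<phi>': "(\<lambda>w. \<phi> (ad W z2 w)) \<in> dual_space K W"
    using dual_space_compose[OF W2.ad_hom \<phi>] .
  note hom = contraction_hom[OF \<phi>] contraction_hom[OF \<phi>']
  note con = contraction_t[OF \<phi>] contraction_t[OF \<phi>']
  have "(\<lambda>u. contraction \<phi> (ad T g u) \<ominus>\<^bsub>V\<^esub> contraction (\<lambda>w. \<phi> (ad W z2 w)) u) \<in> module_hom K T V"
    using V.module_hom_minus[OF module_hom_compose[OF Tg.ad_hom hom(1)] hom(2) T.module_axioms] .
  then show ?thesis
  proof (rule T.module_hom_eq_on_span[OF V.module_axioms module_hom_compose[OF hom(1) V1.ad_hom]])
    show "tensors (carrier V) (carrier W) \<subseteq> carrier T"
      by (rule tensors_closed) auto
    show "u \<in> T.span (tensors (carrier V) (carrier W))"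
      using u span by simp
    fix x assume "x \<in> tensors (carrier V) (carrier W)"
    then obtain v w where x: "x = t v w" and vw: "v \<in> carrier V" "w \<in> carrier W"
      unfolding tensors_def by blast
    note cl = V1.ad_closed[OF vw(1)] W2.ad_closed[OF vw(2)]
    note dl = dual_spaceD(1)[OF \<phi> vw(2)] dual_spaceD(1)[OF \<phi> cl(2)]
    have "contraction \<phi> (ad T g x) = \<phi> w \<odot>\<^bsub>V\<^esub> ad V z1 v \<oplus>\<^bsub>V\<^esub> \<phi> (ad W z2 w) \<odot>\<^bsub>V\<^esub> v"
      unfolding x ad_t[OF vw] using vw cl t_closed
      by (simp add: LinearCombinations.module_hom_add[OF hom(1)] con)
    then show "ad V z1 (contraction \<phi> x) =
        contraction \<phi> (ad T g x) \<ominus>\<^bsub>V\<^esub> contraction (\<lambda>w. \<phi> (ad W z2 w)) x"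
      unfolding x using vw cl dl
      by (simp add: con V1.ad_smult a_minus_def V.M.add.m_ac V.M.r_neg V.M.r_neg1 V.M.r_neg2)
  qed
qed

lemma contraction_mem_ad_F:
  assumes span: "T.span (tensors (carrier V) (carrier W)) = carrier T"
    and V: "ad_linear K V z1" and W: "ad_linear K W z2" and T: "ad_linear K T g"
    and ad_t: "\<And>v w. \<lbrakk>v \<in> carrier V; w \<in> carrier W\<rbrakk> \<Longrightarrow>
      ad T g (t v w) = t (ad V z1 v) w \<oplus>\<^bsub>T\<^esub> t v (ad W z2 w)"
    and \<phi>: "\<phi> \<in> dual_space K W" and u: "u \<in> ad_F K T g"
  shows "contraction \<phi> u \<in> ad_F K V z1"
proof -
  interpret V1: ad_linear K V z1 by fact
  interpret W2: ad_linear K W z2 by fact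
  interpret Tg: ad_linear K T g by fact
  obtain B where B: "finite B" "B \<subseteq> carrier T" "\<And>n. (ad T g ^^ n) u \<in> T.span B"
    and uT: "u \<in> carrier T"
    using u unfolding Tg.ad_F_iff by blast
  \<comment> \<open>\<open>X0\<close> collects left factors whose tensors generate a space
    containing the orbit. It does not depend on the functional, so its span contains every
    contraction of every orbit element.\<close>
  obtain X0 Y where X0: "finite X0" "X0 \<subseteq> carrier V" "Y \<subseteq> carrier W" "B \<subseteq> T.span (tensors X0 Y)"
    using finite_support[OF B(1)] B(2) span by metis
  have "T.span B \<subseteq> T.span (tensors X0 Y)"
    using T.span_subset_subspace[OF X0(4) T.span_is_subspace[OF tensors_closed[OF X0(2,3)]]] .
  then have orbit: "contraction \<psi> ((ad T g ^^ m) u) \<in> V.span X0" if "\<psi> \<in> dual_space K W" for \<psi> m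
    using contraction_span_tensors[OF that X0(2,3)] B(3) by blast
  \<comment> \<open>One application of \<open>ad V z1\<close> yields a term with the orbit advanced
    by one step and a term with the functional composed with \<open>ad W z2\<close>. Hence the
    induction covers all \<open>m\<close> and \<psi> simultaneously.\<close>
  have "(ad V z1 ^^ n) (contraction \<psi> ((ad T g ^^ m) u)) \<in> V.span X0"
    if "\<psi> \<in> dual_space K W" for n m \<psi>
    using that
  proof (induction n arbitrary: m \<psi>)
    case 0
    then show ?case using orbit by simp
  next
    case (Suc n)
    let ?x = "(ad T g ^^ m) u"
    have x: "?x \<in> carrier T" "ad T g ?x \<in> carrier T"
      using Tg.funpow_ad_closed[OF uT, of m] Tg.ad_closed by auto
    have \<psi>': "(\<lambda>w. \<psi> (ad W z2 w)) \<in> dual_space K W"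
      using dual_space_compose[OF W2.ad_hom Suc.prems] .
    have mem: "contraction \<psi> (ad T g ?x) \<in> carrier V" "contraction (\<lambda>w. \<psi> (ad W z2 w)) ?x \<in> carrier V"
      using module_hom_mem[OF contraction_hom[OF Suc.prems] x(2)]
        module_hom_mem[OF contraction_hom[OF \<psi>'] x(1)] .
    interpret pow: mod_hom K V V "ad V z1 ^^ n"
      using V1.funpow_ad_hom V.module_axioms by (simp add: mod_hom_def mod_hom_axioms_def)
    have "(ad V z1 ^^ Suc n) (contraction \<psi> ?x) =
        (ad V z1 ^^ n) (contraction \<psi> (ad T g ?x) \<ominus>\<^bsub>V\<^esub> contraction (\<lambda>w. \<psi> (ad W z2 w)) ?x)"
      using contraction_intertwines[OF span V W T ad_t Suc.prems x(1)]
      by (simp add: funpow_swap1)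
    also have "\<dots> = (ad V z1 ^^ n) (contraction \<psi> (ad T g ?x)) \<ominus>\<^bsub>V\<^esub>
        (ad V z1 ^^ n) (contraction (\<lambda>w. \<psi> (ad W z2 w)) ?x)"
      using pow.f_minus[OF mem] .
    also have "\<dots> \<in> V.span X0"
      using Suc.IH[OF Suc.prems, of "Suc m"] Suc.IH[OF \<psi>', of m]
      by (intro V.subspace_minus V.span_is_subspace X0(2)) simp_all
    finally show ?case .
  qed
  from this[OF \<phi>, of _ 0] show ?thesis
    unfolding V1.ad_F_iff using X0(1,2) module_hom_mem[OF contraction_hom[OF \<phi>] uT] by auto
qed

text \<open>A functional with value one at \<open>w\<close> contracts \<open>t v w\<close> back to
  \<open>v\<close>.\<close>

lemma t_nonzero:
  assumes "v \<in> carrier V" "w \<in> carrier W" "v \<noteq> \<zero>\<^bsub>V\<^esub>" "w \<noteq> \<zero>\<^bsub>W\<^esub>"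
  shows "t v w \<noteq> \<zero>\<^bsub>T\<^esub>"
proof
  assume zero: "t v w = \<zero>\<^bsub>T\<^esub>"
  have "VectorSpace.subspace K {\<zero>\<^bsub>W\<^esub>} W"
    by (rule W.subspaceI) auto
  then obtain \<phi> where \<phi>: "\<phi> \<in> dual_space K W" "\<phi> w = \<one>\<^bsub>K\<^esub>"
    using W.separating_functional assms by blast
  have "contraction \<phi> (t v w) = v"
    using contraction_t[OF \<phi>(1)] \<phi>(2) assms by simp
  moreover have "contraction \<phi> \<zero>\<^bsub>T\<^esub> = \<zero>\<^bsub>V\<^esub>"
    using module_hom_zero[OF contraction_hom[OF \<phi>(1)]] T.module_axioms V.module_axioms by blast
  ultimately show False
    using zero assms(3) by simp
qed

end

text \<open>The source of contractions: the universal property turns this bilinear map into a linear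
  map on the tensor product.\<close>

lemma dual_smult_bilinear:
  assumes "vectorspace K V" "vectorspace K W" "\<phi> \<in> dual_space K W"
  shows "bilinear_map K V W V (\<lambda>v w. \<phi> w \<odot>\<^bsub>V\<^esub> v)"
proof -
  interpret V: vectorspace K V by fact
  interpret W: vectorspace K W by fact
  note \<phi> = dual_spaceD[OF assms(3)]
  show ?thesis
    by (rule bilinear_mapI)
      (simp_all add: \<phi> V.smult_r_distr V.smult_l_distr V.smult_assoc_simp V.R.m_comm)
qed

lemma bilinear_map_swap: "bilinear_map K V W M \<beta> \<Longrightarrow> bilinear_map K W V M (\<lambda>w v. \<beta> v w)"
  unfolding bilinear_map_def by simp

section \<open>Contractions onto either factor and the inclusions they yield\<close>

context tensor_spaces
begin

sublocale left: contractible_tensor K A B T pt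
proof unfold_locales
  show "bilinear_map K A B T pt" by (rule pt_bilinear)
  show "\<exists>h\<in>module_hom K T A. \<forall>a\<in>carrier A. \<forall>b\<in>carrier B. h (pt a b) = \<phi> b \<odot>\<^bsub>A\<^esub> a"
    if "\<phi> \<in> dual_space K B" for \<phi>
    using ex_tensor_hom[OF A.vectorspace_axioms
        dual_smult_bilinear[OF A.vectorspace_axioms B.vectorspace_axioms that]] .
qed

sublocale right: contractible_tensor K B A T "\<lambda>b a. pt a b"
proof unfold_locales
  show "bilinear_map K B A T (\<lambda>b a. pt a b)"
    by (rule bilinear_map_swap) (rule pt_bilinear)
  fix \<phi> assume "\<phi> \<in> dual_space K A"
  from ex_tensor_hom[OF B.vectorspace_axioms
      bilinear_map_swap[OF dual_smult_bilinear[OF B.vectorspace_axioms A.vectorspace_axioms this]]]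
  show "\<exists>h\<in>module_hom K T B. \<forall>b\<in>carrier B. \<forall>a\<in>carrier A. h (pt a b) = \<phi> a \<odot>\<^bsub>B\<^esub> b"
    by blast
qed

lemma span_tensors:
  "T.span (left.tensors (carrier A) (carrier B)) = carrier T"
  "T.span (right.tensors (carrier B) (carrier A)) = carrier T"
proof -
  show "T.span (left.tensors (carrier A) (carrier B)) = carrier T"
    using span_pt unfolding left.tensors_def .
  moreover have "right.tensors (carrier B) (carrier A) = left.tensors (carrier A) (carrier B)"
    unfolding left.tensors_def right.tensors_def by blast
  ultimately show "T.span (right.tensors (carrier B) (carrier A)) = carrier T"
    by simp
qed

context
  fixes z1 z2 g
  assumes adA: "ad_linear K A z1" and adB: "ad_linear K B z2" and adT: "ad_linear K T g"
    and ad_pt: "\<And>a b. \<lbrakk>a \<in> carrier A; b \<in> carrier B\<rbrakk> \<Longrightarrow>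
      ad T g (pt a b) = pt (ad A z1 a) b \<oplus>\<^bsub>T\<^esub> pt a (ad B z2 b)"
begin

interpretation z1: ad_linear K A z1 by (rule adA)
interpretation z2: ad_linear K B z2 by (rule adB)
interpretation g: ad_linear K T g by (rule adT)

text \<open>The contraction criterion treats one side at a time. It moves the left factors into
  \<open>N\<close> over a finite set of right factors; finitely many left factors \<open>X1\<close>
  in \<open>N\<close> then carry \<open>u\<close>, and the exchanged criterion moves the right
  factors into \<open>N'\<close> without leaving \<open>X1\<close>.\<close>

lemma ad_F_subset_tensor:
  assumes N: "VectorSpace.subspace K N A" "ad_F K A z1 \<subseteq> N"
    and N': "VectorSpace.subspace K N' B" "ad_F K B z2 \<subseteq> N'"
  shows "ad_F K T g \<subseteq> T.span (left.tensors N N')"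
proof
  fix u assume u: "u \<in> ad_F K T g"
  have ad_pt': "ad T g (pt a b) = pt a (ad B z2 b) \<oplus>\<^bsub>T\<^esub> pt (ad A z1 a) b"
    if "b \<in> carrier B" "a \<in> carrier A" for a b
    using ad_pt[OF that(2,1)] pt_closed z1.ad_closed z2.ad_closed that
    by (simp add: T.M.add.m_comm)
  have con: "left.contraction \<phi> u \<in> N" if "\<phi> \<in> dual_space K B" for \<phi>
    using left.contraction_mem_ad_F[OF span_tensors(1) adA adB adT ad_pt that u] N(2) by blast
  have con': "right.contraction \<phi> u \<in> N'" if "\<phi> \<in> dual_space K A" for \<phi>
    using right.contraction_mem_ad_F[OF span_tensors(2) adB adA adT ad_pt' that u] N'(2) by blast
  have "u \<in> carrier T"
    using u unfolding g.ad_F_iff by blast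
  then have "{u} \<subseteq> T.span (left.tensors (carrier A) (carrier B))"
    using span_tensors(1) by simp
  from left.finite_support[OF _ this] obtain X0 Y
    where Y: "finite Y" "X0 \<subseteq> carrier A" "Y \<subseteq> carrier B" "u \<in> T.span (left.tensors X0 Y)"
    by auto
  have "u \<in> T.span (left.tensors (carrier A) Y)"
    using left.tensors_mono[OF Y(2) subset_refl] Y(4) by (rule subsetD)
  from left.mem_span_tensors_if_contractions[OF N(1) Y(1,3) this con]
  have "{u} \<subseteq> T.span (left.tensors N Y)"
    by simp
  \<comment> \<open>A finite \<open>X1\<close> is extracted because the exchanged criterion inducts
    on the set of left factors.\<close>
  from left.finite_support[OF _ this] obtain X1 Y1
    where X1: "finite X1" "X1 \<subseteq> N" "Y1 \<subseteq> Y" "u \<in> T.span (left.tensors X1 Y1)"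
    by auto
  have X1A: "X1 \<subseteq> carrier A" and Y1: "Y1 \<subseteq> carrier B"
    using X1(2,3) Y(3) subspaceD(1)[OF N(1)] by auto
  have swap: "right.tensors S' S = left.tensors S S'" for S S'
    unfolding left.tensors_def right.tensors_def by blast
  have "u \<in> T.span (right.tensors (carrier B) X1)"
    unfolding swap using left.tensors_mono[OF subset_refl Y1] X1(4) by (rule subsetD)
  from right.mem_span_tensors_if_contractions[OF N'(1) X1(1) X1A this con']
  have "u \<in> T.span (left.tensors X1 N')"
    unfolding swap .
  then show "u \<in> T.span (left.tensors N N')"
    using left.tensors_mono[OF X1(2) subset_refl] by (rule rev_subsetD)
qed

text \<open>Eigenvalues add: the two summands of \<open>ad T g\<close> act on \<open>pt a b\<close>
  as the scalars \<open>c\<close> and \<open>d\<close>.\<close>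

lemma pt_eigenvector:
  assumes "c \<in> carrier K" "d \<in> carrier K" "a \<in> ad_eigenspace A z1 c" "b \<in> ad_eigenspace B z2 d"
  shows "pt a b \<in> ad_eigenspace T g (c \<oplus>\<^bsub>K\<^esub> d)"
proof -
  note ab = z1.ad_eigenspaceD[OF assms(3)] z2.ad_eigenspaceD[OF assms(4)]
  note bil = bilinear_mapD[OF pt_bilinear]
  have "ad T g (pt a b) = (c \<oplus>\<^bsub>K\<^esub> d) \<odot>\<^bsub>T\<^esub> pt a b"
    using ad_pt[OF ab(1,3)] ab assms(1,2) by (simp add: bil T.smult_l_distr)
  then show ?thesis
    unfolding ad_eigenspace_def using pt_closed[OF ab(1,3)] by simp
qed

text \<open>Bilinearity reduces the claim to pairs of eigenvectors in two stages: with an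
  eigenvector on the left, the right factor ranges over D(z2); with that factor fixed, the left one
  ranges over D(z1).\<close>

lemma tensor_subset_ad_D:
  "T.span (left.tensors (ad_D K A z1) (ad_D K B z2)) \<subseteq> ad_D K T g"
proof (rule T.span_subset_subspace[OF _ g.ad_D_subspace])
  have ev: "pt a b \<in> ad_D K T g"
    if c: "c \<in> carrier K" and a: "a \<in> ad_eigenspace A z1 c" and b: "b \<in> ad_D K B z2" for a b c
  proof -
    have "pt a \<in> module_hom K B T"
      using left.t_hom_right z1.ad_eigenspaceD(1)[OF a] by blast
    from z2.ad_D_subset_subspace[OF B.subspace_vimage[OF T.vectorspace_axioms this g.ad_D_subspace]]
    have "ad_D K B z2 \<subseteq> {b \<in> carrier B. pt a b \<in> ad_D K T g}"
      using g.eigenvector_in_ad_D[OF _ pt_eigenvector[OF c _ a]] c z2.ad_eigenspaceD(1) by auto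
    then show ?thesis using b by blast
  qed
  have "pt a b \<in> ad_D K T g" if a: "a \<in> ad_D K A z1" and b: "b \<in> ad_D K B z2" for a b
  proof -
    have "b \<in> carrier B"
      using subspaceD(1)[OF z2.ad_D_subspace b] .
    from z1.ad_D_subset_subspace[OF A.subspace_vimage[OF T.vectorspace_axioms left.t_hom_left[OF this]
      g.ad_D_subspace]]
    have "ad_D K A z1 \<subseteq> {a \<in> carrier A. pt a b \<in> ad_D K T g}"
      using ev[OF _ _ b] z1.ad_eigenspaceD(1) by auto
    then show ?thesis using a by blast
  qed
  then show "left.tensors (ad_D K A z1) (ad_D K B z2) \<subseteq> ad_D K T g"
    unfolding left.tensors_def by blast
qed

text \<open>The tensor product of two nonzero eigenvectors is an eigenvector for the sum, and
  \<open>t_nonzero\<close> keeps it from vanishing.\<close>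

lemma ad_Ev_tensor:
  assumes "c \<in> ad_Ev K A z1" "d \<in> ad_Ev K B z2"
  shows "c \<oplus>\<^bsub>K\<^esub> d \<in> ad_Ev K T g"
proof -
  obtain a where a: "a \<in> ad_eigenspace A z1 c" "a \<noteq> \<zero>\<^bsub>A\<^esub>" "c \<in> carrier K"
    using assms(1) unfolding ad_Ev_def ad_eigenspace_def by blast
  obtain b where b: "b \<in> ad_eigenspace B z2 d" "b \<noteq> \<zero>\<^bsub>B\<^esub>" "d \<in> carrier K"
    using assms(2) unfolding ad_Ev_def ad_eigenspace_def by blast
  have ab: "a \<in> carrier A" "b \<in> carrier B"
    using a b z1.ad_eigenspaceD(1) z2.ad_eigenspaceD(1) by auto
  have "pt a b \<noteq> \<zero>\<^bsub>T\<^esub>"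
    using left.t_nonzero[OF ab a(2) b(2)] .
  then show ?thesis
    using pt_eigenvector[OF a(3) b(3) a(1) b(1)] a(3) b(3)
    unfolding ad_Ev_def ad_eigenspace_def by auto
qed

end

end

section \<open>The bracket on the tensor product\<close>

text \<open>Agreement on the carriers suffices, which allows the class of a sum of generators to be
  replaced by a sum of pure tensors.\<close>

lemma bilinear_map_cong:
  assumes "module K A" "module K B" "bilinear_map K A B M \<beta>"
    and "\<And>a b. \<lbrakk>a \<in> carrier A; b \<in> carrier B\<rbrakk> \<Longrightarrow> \<gamma> a b = \<beta> a b"
  shows "bilinear_map K A B M \<gamma>"
proof -
  interpret A: module K A by fact
  interpret B: module K B by fact
  show ?thesis
    by (rule bilinear_mapI) (simp_all add: assms(4) bilinear_mapD[OF assms(3)])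
qed

context nc_poisson_algebra
begin

lemma mult_hom:
  assumes "y \<in> carrier P"
  shows "(\<lambda>x. x \<otimes> y) \<in> module_hom K P P" "(\<lambda>x. y \<otimes> x) \<in> module_hom K P P"
  using assms
  by (auto intro!: module_homI simp: P_ring.l_distr P_ring.r_distr mult_smult_left mult_smult_right)

lemma bracket_hom:
  assumes "y \<in> carrier P"
  shows "(\<lambda>x. bracket P x y) \<in> module_hom K P P" "(\<lambda>x. bracket P y x) \<in> module_hom K P P"
  using assms
  by (auto intro!: module_homI simp: bracket_closed bracket_add_left bracket_add_right
      bracket_smult_left bracket_smult_right)

end

locale tensor_poisson_algebras =
  P1: nc_poisson_algebra K A + P2: nc_poisson_algebra K B
  for K :: "('k, 'm) ring_scheme"
    and A :: "('k, 'a, 'n) poisson_scheme" and B :: "('k, 'b, 'l) poisson_scheme"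
begin

sublocale tensor_spaces K A B
  by unfold_locales

text \<open>This and \<open>bracket_gen\<close> repeat the lambda terms in
  \<open>tensor_algebra\<close> and \<open>tensor_bracket\<close>, so the results on
  \<open>tensor_lift\<close> apply once bilinearity in each pair is known.\<close>

abbreviation "mult_gen \<equiv> \<lambda>(a1, a2) (b1, b2). gen (a1 \<otimes>\<^bsub>A\<^esub> b1) (a2 \<otimes>\<^bsub>B\<^esub> b2)"

abbreviation "bracket_gen \<equiv> \<lambda>(a1, a2) (b1, b2).
  gen (bracket A a1 b1) (a2 \<otimes>\<^bsub>B\<^esub> b2) \<oplus>\<^bsub>F\<^esub> gen (b1 \<otimes>\<^bsub>A\<^esub> a1) (bracket B a2 b2)"

lemma pt_zero:
  "b \<in> carrier B \<Longrightarrow> pt \<zero>\<^bsub>A\<^esub> b = \<zero>\<^bsub>T\<^esub>" "a \<in> carrier A \<Longrightarrow> pt a \<zero>\<^bsub>B\<^esub> = \<zero>\<^bsub>T\<^esub>"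
  using module_hom_zero[OF left.t_hom_left P1.module_axioms T.module_axioms]
    module_hom_zero[OF left.t_hom_right P2.module_axioms T.module_axioms] by auto

lemmas pt_compose = bilinear_map_compose[OF pt_bilinear]
lemmas pt_cong = bilinear_map_cong[OF P1.module_axioms P2.module_axioms]

lemma mult_gen:
  shows "\<lbrakk>x \<in> I; y \<in> I\<rbrakk> \<Longrightarrow> mult_gen x y \<in> carrier F"
    and "y \<in> I \<Longrightarrow> bilinear_map K A B T (\<lambda>a b. cl (mult_gen (a, b) y))"
    and "x \<in> I \<Longrightarrow> bilinear_map K A B T (\<lambda>a b. cl (mult_gen x (a, b)))"
proof -
  show "mult_gen x y \<in> carrier F" if "x \<in> I" "y \<in> I"
    using that gen_closed by auto
  show "bilinear_map K A B T (\<lambda>a b. cl (mult_gen (a, b) y))" if "y \<in> I"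
    using that pt_compose[OF P1.mult_hom(1) P2.mult_hom(1)] by (auto simp: pure_tensor_def)
  show "bilinear_map K A B T (\<lambda>a b. cl (mult_gen x (a, b)))" if "x \<in> I"
    using that pt_compose[OF P1.mult_hom(2) P2.mult_hom(2)] by (auto simp: pure_tensor_def)
qed

lemma bracket_gen:
  shows "\<lbrakk>x \<in> I; y \<in> I\<rbrakk> \<Longrightarrow> bracket_gen x y \<in> carrier F"
    and "y \<in> I \<Longrightarrow> bilinear_map K A B T (\<lambda>a b. cl (bracket_gen (a, b) y))"
    and "x \<in> I \<Longrightarrow> bilinear_map K A B T (\<lambda>a b. cl (bracket_gen x (a, b)))"
    and cl_bracket_gen: "\<lbrakk>a1 \<in> carrier A; a2 \<in> carrier B; b1 \<in> carrier A; b2 \<in> carrier B\<rbrakk> \<Longrightarrow>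
      cl (bracket_gen (a1, a2) (b1, b2)) =
        pt (bracket A a1 b1) (a2 \<otimes>\<^bsub>B\<^esub> b2) \<oplus>\<^bsub>T\<^esub> pt (b1 \<otimes>\<^bsub>A\<^esub> a1) (bracket B a2 b2)"
proof -
  show cl: "cl (bracket_gen (a1, a2) (b1, b2)) =
        pt (bracket A a1 b1) (a2 \<otimes>\<^bsub>B\<^esub> b2) \<oplus>\<^bsub>T\<^esub> pt (b1 \<otimes>\<^bsub>A\<^esub> a1) (bracket B a2 b2)"
    if "a1 \<in> carrier A" "a2 \<in> carrier B" "b1 \<in> carrier A" "b2 \<in> carrier B" for a1 a2 b1 b2
    using that by (simp add: pure_tensor_def cl_add gen_closed P1.bracket_closed P2.bracket_closed)
  note bil = bilinear_map_add[OF P1.module_axioms P2.module_axioms T.module_axioms]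
  show "bracket_gen x y \<in> carrier F" if "x \<in> I" "y \<in> I"
    using that by (auto intro!: F.M.a_closed gen_closed P1.bracket_closed P2.bracket_closed)
  show "bilinear_map K A B T (\<lambda>a b. cl (bracket_gen (a, b) y))" if yI: "y \<in> I"
  proof -
    obtain b1 b2 where y: "y = (b1, b2)" "b1 \<in> carrier A" "b2 \<in> carrier B"
      using yI by auto
    show ?thesis
      unfolding y(1)
      \<comment> \<open>The second summand multiplies in reversed order, so its first component
        varies in the right factor and calls for \<open>mult_hom(2)\<close>.\<close>
      by (rule pt_cong[OF bil[OF pt_compose[OF P1.bracket_hom(1) P2.mult_hom(1)]
            pt_compose[OF P1.mult_hom(2) P2.bracket_hom(1)]] cl]) (use y in auto)
  qed
  show "bilinear_map K A B T (\<lambda>a b. cl (bracket_gen x (a, b)))" if xI: "x \<in> I"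
  proof -
    obtain a1 a2 where x: "x = (a1, a2)" "a1 \<in> carrier A" "a2 \<in> carrier B"
      using xI by auto
    show ?thesis
      unfolding x(1)
      by (rule pt_cong[OF bil[OF pt_compose[OF P1.bracket_hom(2) P2.mult_hom(2)]
            pt_compose[OF P1.mult_hom(1) P2.bracket_hom(2)]] cl]) (use x in auto)
  qed
qed

lemma T_mult_hom:
  assumes "S \<in> carrier T"
  shows "(\<lambda>S'. tensor_lift K A B mult_gen S' S) \<in> module_hom K T T"
    and "(\<lambda>S'. tensor_lift K A B mult_gen S S') \<in> module_hom K T T"
  by (rule tensor_lift_hom_left[OF mult_gen] tensor_lift_hom_right[OF mult_gen]; use assms in simp)+

lemma T_bracket_hom:
  assumes "S \<in> carrier T"
  shows "(\<lambda>S'. tensor_lift K A B bracket_gen S' S) \<in> module_hom K T T"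
    and "(\<lambda>S'. tensor_lift K A B bracket_gen S S') \<in> module_hom K T T"
  by (rule tensor_lift_hom_left[OF bracket_gen(1-3)] tensor_lift_hom_right[OF bracket_gen(1-3)];
      use assms in simp)+

lemma T_mult_pt:
  assumes "a \<in> carrier A" "b \<in> carrier B" "a' \<in> carrier A" "b' \<in> carrier B"
  shows "tensor_lift K A B mult_gen (pt a b) (pt a' b') = pt (a \<otimes>\<^bsub>A\<^esub> a') (b \<otimes>\<^bsub>B\<^esub> b')"
proof -
  have "tensor_lift K A B mult_gen (pt a b) (pt a' b') = cl (mult_gen (a, b) (a', b'))"
    by (rule tensor_lift_pt[OF mult_gen]) (use assms in simp_all)
  then show ?thesis
    by (simp add: pure_tensor_def)
qed

lemma T_bracket_pt:
  assumes "a \<in> carrier A" "b \<in> carrier B" "a' \<in> carrier A" "b' \<in> carrier B"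
  shows "tensor_lift K A B bracket_gen (pt a b) (pt a' b') =
    pt (bracket A a a') (b \<otimes>\<^bsub>B\<^esub> b') \<oplus>\<^bsub>T\<^esub> pt (a' \<otimes>\<^bsub>A\<^esub> a) (bracket B b b')"
proof -
  have "tensor_lift K A B bracket_gen (pt a b) (pt a' b') = cl (bracket_gen (a, b) (a', b'))"
    by (rule tensor_lift_pt[OF bracket_gen(1-3)]) (use assms in simp_all)
  then show ?thesis
    using cl_bracket_gen[OF assms] by simp
qed

lemma tensor_algebra_mult:
  "S \<otimes>\<^bsub>tensor_algebra K A B\<^esub> S' = tensor_lift K A B mult_gen S S'"
  by (simp add: tensor_algebra_def)

lemma bracket_T:
  "bracket T S S' = (if class1 A \<and> class1 B then tensor_lift K A B bracket_gen S S'
     else tensor_lift K A B mult_gen S S' \<ominus>\<^bsub>T\<^esub> tensor_lift K A B mult_gen S' S)"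
  by (simp add: T_simps(5,6) tensor_bracket_def tensor_algebra_mult)

text \<open>With the first argument fixed, both branches of the bracket are linear: one is an
  induced operation, the other a difference of two.\<close>

lemma T_ad_linear:
  assumes "S \<in> carrier T"
  shows "ad_linear K T S"
proof -
  have "ad T S \<in> module_hom K T T"
    unfolding bracket_T
    using T_bracket_hom(2)[OF assms] T.module_hom_minus[OF T_mult_hom(2)[OF assms]
      T_mult_hom(1)[OF assms] T.module_axioms]
    by (cases "class1 A \<and> class1 B") (simp_all only: if_True if_False simp_thms)
  then show ?thesis
    by (simp add: ad_linear_def ad_linear_axioms_def T.vectorspace_axioms)
qed

text \<open>In Class 1 the mixed terms contain a bracket with the unit and vanish, leaving {z1, a}
  \<otimes> b and a \<otimes> {z2, b}. In Class 2 the unit makes each commutator act in a single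
  factor, where the bracket is itself the commutator.\<close>

lemma ad_sum_pt:
  assumes same_class: "class1 A \<and> class1 B \<or> class2 A \<and> class2 B"
    and z: "z1 \<in> carrier A" "z2 \<in> carrier B" and ab: "a \<in> carrier A" "b \<in> carrier B"
  shows "ad T (pt z1 \<one>\<^bsub>B\<^esub> \<oplus>\<^bsub>T\<^esub> pt \<one>\<^bsub>A\<^esub> z2) (pt a b) =
    pt (ad A z1 a) b \<oplus>\<^bsub>T\<^esub> pt a (ad B z2 b)"
proof -
  note one = P1.P_ring.one_closed P2.P_ring.one_closed
  note pts = pt_closed[OF z(1) one(2)] pt_closed[OF one(1) z(2)]
  note ptab = pt_closed[OF ab]
  show ?thesis
  proof (cases "class1 A \<and> class1 B")
    case True
    then show ?thesis
      unfolding bracket_T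
      using LinearCombinations.module_hom_add[OF T_bracket_hom(1)[OF ptab] pts] z ab
      by (simp add: T_bracket_pt[OF _ _ ab] P1.bracket_one_left P2.bracket_one_left
          P1.bracket_closed P2.bracket_closed pt_zero pt_closed)
  next
    case False
    with same_class have c2: "class2 A" "class2 B"
      by auto
    have br: "ad A z1 a = z1 \<otimes>\<^bsub>A\<^esub> a \<ominus>\<^bsub>A\<^esub> a \<otimes>\<^bsub>A\<^esub> z1" "ad B z2 b = z2 \<otimes>\<^bsub>B\<^esub> b \<ominus>\<^bsub>B\<^esub> b \<otimes>\<^bsub>B\<^esub> z2"
      using c2 z ab unfolding class2_def by auto
    have minus_left: "pt (x \<ominus>\<^bsub>A\<^esub> x') b = pt x b \<ominus>\<^bsub>T\<^esub> pt x' b"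
      if "x \<in> carrier A" "x' \<in> carrier A" for x x'
    proof -
      interpret h: mod_hom K A T "\<lambda>x. pt x b"
        using left.t_hom_left[OF ab(2)] P1.module_axioms T.module_axioms
        by (simp add: mod_hom_def mod_hom_axioms_def)
      show ?thesis using h.f_minus[OF that] .
    qed
    have minus_right: "pt a (y \<ominus>\<^bsub>B\<^esub> y') = pt a y \<ominus>\<^bsub>T\<^esub> pt a y'"
      if "y \<in> carrier B" "y' \<in> carrier B" for y y'
    proof -
      interpret h: mod_hom K B T "pt a"
        using left.t_hom_right[OF ab(1)] P2.module_axioms T.module_axioms
        by (simp add: mod_hom_def mod_hom_axioms_def)
      show ?thesis using h.f_minus[OF that] .
    qed
    have l: "tensor_lift K A B mult_gen (pt z1 \<one>\<^bsub>B\<^esub> \<oplus>\<^bsub>T\<^esub> pt \<one>\<^bsub>A\<^esub> z2) (pt a b) =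
        pt (z1 \<otimes>\<^bsub>A\<^esub> a) b \<oplus>\<^bsub>T\<^esub> pt a (z2 \<otimes>\<^bsub>B\<^esub> b)"
      using LinearCombinations.module_hom_add[OF T_mult_hom(1)[OF ptab] pts] z ab
      by (simp add: T_mult_pt[OF _ _ ab])
    have r: "tensor_lift K A B mult_gen (pt a b) (pt z1 \<one>\<^bsub>B\<^esub> \<oplus>\<^bsub>T\<^esub> pt \<one>\<^bsub>A\<^esub> z2) =
        pt (a \<otimes>\<^bsub>A\<^esub> z1) b \<oplus>\<^bsub>T\<^esub> pt a (b \<otimes>\<^bsub>B\<^esub> z2)"
      using LinearCombinations.module_hom_add[OF T_mult_hom(2)[OF ptab] pts] z ab
      by (simp add: T_mult_pt[OF ab])
    show ?thesis
      unfolding bracket_T if_not_P[OF False] l r br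
      using z ab
      by (simp add: minus_left minus_right)
        (simp add: pt_closed a_minus_def T.M.minus_add T.M.add.m_ac)
  qed
qed

end

theorem corollary6p7:
  fixes K :: "'k ring"
    and P1 :: "('k, 'a) poisson" and P2 :: "('k, 'b) poisson"
    and u1 :: "'a \<Rightarrow> int extended" and u2 :: "'b \<Rightarrow> int extended"
    and z1 :: 'a and z2 :: 'b
  defines "T \<equiv> tensor_poisson K P1 P2"
    and "G \<equiv> pure_tensor K P1 P2 z1 \<one>\<^bsub>P2\<^esub> \<oplus>\<^bsub>tensor_poisson K P1 P2\<^esub> pure_tensor K P1 P2 \<one>\<^bsub>P1\<^esub> z2"
  assumes "algebraically_closed K"
    and char_zero: "\<And>n::nat. n > 0 \<Longrightarrow> [n] \<cdot>\<^bsub>K\<^esub> \<one>\<^bsub>K\<^esub> \<noteq> \<zero>\<^bsub>K\<^esub>"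
    and "nc_poisson_algebra K P1" and "nc_poisson_algebra K P2"
    and same_class: "(class1 P1 \<and> class1 P2) \<or> (class2 P1 \<and> class2 P2)"
    and "degree_map P1 u1" and "u1 \<in> carrier P1 \<rightarrow> Fin ` {0..} \<union> {-\<infinity>}"
    and "finite_filtration K P1 u1" and "discrete_filtration P1 u1"
    and "degree_map P2 u2" and "u2 \<in> carrier P2 \<rightarrow> Fin ` {0..} \<union> {-\<infinity>}"
    and "finite_filtration K P2 u2" and "discrete_filtration P2 u2"
    and "z1 \<in> carrier P1" and "z2 \<in> carrier P2"
    and "ad_F K P1 z1 = ad_D K P1 z1" and "ad_F K P2 z2 = ad_D K P2 z2"
  shows "ad_F K T G = ad_D K T G \<and>
         ad_D K T G = tensor_subspace K P1 P2 (ad_D K P1 z1) (ad_D K P2 z2) \<and>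
         ad_N T G = ad_C T G \<and>
         (ad_C P1 z1 \<subset> ad_D K P1 z1 \<or> ad_C P2 z2 \<subset> ad_D K P2 z2 \<longrightarrow>
            ad_N T G = ad_C T G \<and> ad_C T G \<subset> ad_D K T G \<and> ad_D K T G = ad_F K T G \<and>
            G \<in> Omega2 K T \<union> Omega2' K T)"
proof -
  interpret tensor_poisson_algebras K P1 P2
    using assms by (simp add: tensor_poisson_algebras_def)
  have z: "z1 \<in> carrier P1" "z2 \<in> carrier P2"
    and FD: "ad_F K P1 z1 = ad_D K P1 z1" "ad_F K P2 z2 = ad_D K P2 z2"
    by fact+
  interpret z1: ad_linear K P1 z1 by (rule P1.ad_linear[OF z(1)])
  interpret z2: ad_linear K P2 z2 by (rule P2.ad_linear[OF z(2)])
  have G: "G \<in> carrier T"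
    unfolding G_def T_def using z pt_closed by auto
  then have adG: "ad_linear K T G"
    unfolding T_def by (rule T_ad_linear)
  then interpret G: ad_linear K T G .
  have ad_pt: "ad T G (pt a b) = pt (ad P1 z1 a) b \<oplus>\<^bsub>T\<^esub> pt a (ad P2 z2 b)"
    if "a \<in> carrier P1" "b \<in> carrier P2" for a b
    unfolding G_def T_def using ad_sum_pt[OF same_class z that] .
  \<comment> \<open>The locale results refer to \<open>tensor_poisson\<close> itself, so the local
    name \<open>T\<close> is unfolded before they are instantiated.\<close>
  note dyn = z1.ad_linear_axioms z2.ad_linear_axioms adG[unfolded T_def] ad_pt[unfolded T_def]
  let ?DD = "tensor_subspace K P1 P2 (ad_D K P1 z1) (ad_D K P2 z2)"
  have DD: "?DD = T.span (left.tensors (ad_D K P1 z1) (ad_D K P2 z2))"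
    unfolding tensor_subspace_def left.tensors_def ..
  have F_DD: "ad_F K T G \<subseteq> ?DD"
    unfolding DD T_def
    \<comment> \<open>The inclusion asks for subspaces containing F(z1) and F(z2); the hypotheses F
      = D make D(z1) and D(z2) admissible.\<close>
    by (rule ad_F_subset_tensor[OF dyn z1.ad_D_subspace _ z2.ad_D_subspace]) (use FD in auto)
  have DD_D: "?DD \<subseteq> ad_D K T G"
    unfolding DD T_def by (rule tensor_subset_ad_D[OF dyn])
  have eqs: "ad_F K T G = ad_D K T G" "ad_D K T G = ?DD"
    using F_DD DD_D G.ad_D_subset_ad_F by blast+
  have NC: "ad_N T G = ad_C T G"
    using G.ad_N_eq_ad_C eqs by blast
  have "ad_C T G \<subset> ad_D K T G \<and> G \<in> Omega2 K T \<union> Omega2' K T"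
    if proper: "ad_C P1 z1 \<subset> ad_D K P1 z1 \<or> ad_C P2 z2 \<subset> ad_D K P2 z2"
  proof -
    \<comment> \<open>The unit is a nonzero eigenvector for zero in each factor. Adding this zero
      turns an eigenvalue of one factor into the same eigenvalue of \<Gamma>.\<close>
    have zero: "\<zero>\<^bsub>K\<^esub> \<in> ad_Ev K P1 z1" "\<zero>\<^bsub>K\<^esub> \<in> ad_Ev K P2 z2"
      unfolding ad_Ev_def
      using P1.bracket_one[OF z(1)] P2.bracket_one[OF z(2)] P1.one_not_zero P2.one_not_zero
      by (auto intro!: bexI[of _ "\<one>\<^bsub>P1\<^esub>"] bexI[of _ "\<one>\<^bsub>P2\<^esub>"])
    have sums: "c \<oplus>\<^bsub>K\<^esub> d \<in> ad_Ev K T G" if "c \<in> ad_Ev K P1 z1" "d \<in> ad_Ev K P2 z2" for c d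
      unfolding T_def by (rule ad_Ev_tensor[OF dyn]) (use that in simp_all)
    have Ev0: "\<zero>\<^bsub>K\<^esub> \<in> ad_Ev K T G"
      using sums[OF zero] by simp
    have "\<exists>c\<in>ad_Ev K T G. c \<noteq> \<zero>\<^bsub>K\<^esub>"
      using proper
    proof
      assume "ad_C P1 z1 \<subset> ad_D K P1 z1"
      then obtain c where "c \<in> ad_Ev K P1 z1" "c \<noteq> \<zero>\<^bsub>K\<^esub>"
        using z1.ex_nonzero_eigenvalue by blast
      then show ?thesis
        using sums[OF _ zero(2), of c] z1.ad_Ev_closed by auto
    next
      assume "ad_C P2 z2 \<subset> ad_D K P2 z2"
      then obtain c where "c \<in> ad_Ev K P2 z2" "c \<noteq> \<zero>\<^bsub>K\<^esub>"
        using z2.ex_nonzero_eigenvalue by blast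
      then show ?thesis
        using sums[OF zero(1), of c] z2.ad_Ev_closed by auto
    qed
    then obtain c where c: "c \<in> ad_Ev K T G" "c \<noteq> \<zero>\<^bsub>K\<^esub>"
      by blast
    have "{\<zero>\<^bsub>K\<^esub>} \<subset> ad_Ev K T G"
      using Ev0 c by blast
    moreover have "ad_F K T G \<subseteq> carrier T"
      unfolding ad_F_def by blast
    \<comment> \<open>\<open>ad_F\<close> is either the whole carrier or a proper part of it, which
      are the two semisimple cases.\<close>
    ultimately have "G \<in> Omega2 K T \<union> Omega2' K T"
      unfolding Omega2_def Omega2'_def using G eqs(1) by auto
    then show ?thesis
      using G.ad_C_psubset_ad_D[OF c] by blast
  qed
  then show ?thesis
    using eqs NC by simp
qed

end
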